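(* Let $M$ be a smooth manifold, let $F,\bar F$ be closed 2-forms on $M$ and let $H$ be a 3-form on $M$ with $dH + F\wedge\bar F = 0$. Let $(\mathcal{E},\mathcal{P})$ and $(\bar{\mathcal{E}},\bar{\mathcal{P}})$ be the corresponding T-dual pair of $\mathbb{R}[2]$-bundles over $\mathbb{R}[1]$-bundles over $M$. Then the T-duality map $$T: (C^*(\mathcal{P}), Q_{\mathcal{P}}) \to (C^*(\bar{\mathcal{P}})[1], Q_{\bar{\mathcal{P}}})$$ fits in the short exact sequence of complexes $$0 \to (\Omega^*M, d) \hookrightarrow (C^*(\mathcal{P}), Q_{\mathcal{P}}) \xrightarrow{T} (C^*(\bar{\mathcal{P}})[1], Q_{\bar{\mathcal{P}}}) \to 0$$ where the first map is the canonical inclusion, and therefore it induces a long exact sequence in cohomology $$\cdots\to H^{k}(\mathcal{P}, Q_{\mathcal{P}}) \xrightarrow{T} H^{k-1}(\bar{\mathcal{P}}, Q_{\bar{\mathcal{P}}}) \to H^{k+1}(M) \to H^{k+1}(\mathcal{P}, Q_{\mathcal{P}}) \xrightarrow{T} H^{k}(\bar{\mathcal{P}}, Q_{\bar{\mathcal{P}}}) \to\cdots$$ In particular, when $k \geq \dim(M)$ the T-duality map induces an isomorphism in cohomology $$T: H^{k+1}(\mathcal{P}, Q_{\mathcal{P}}) \xrightarrow{\cong} H^{k}(\bar{\mathcal{P}}, Q_{\bar{\mathcal{P}}}).$$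
   Context: Let $q,\bar q$ be variables of degree $1$ and $t$ a variable of degree $2$. $\mathcal{E} = (T[1]M\oplus\mathbb{R}[1],\ d+F\partial_q)$ and $\bar{\mathcal{E}} = (T[1]M\oplus\mathbb{R}[1],\ d+\bar F\partial_{\bar q})$ are the dg-manifolds with algebras of functions $\Omega^\bullet M\otimes\Lambda[q]$ and $\Omega^\bullet M\otimes\Lambda[\bar q]$. The $\mathbb{R}[2]$-bundles over them are $$\mathcal{P}:\quad C^*(\mathcal P)=\Omega^\bullet M\otimes\Lambda[q]\otimes\mathbb{R}[t],\qquad Q_{\mathcal{P}} = d + F\partial_q + (H+q\bar F)\partial_t,$$ $$\bar{\mathcal{P}}:\quad C^*(\bar{\mathcal P})=\Omega^\bullet M\otimes\Lambda[\bar q]\otimes\mathbb{R}[t],\qquad Q_{\bar{\mathcal{P}}} = d + \bar F\partial_{\bar q} + (H+\bar q F)\partial_t.$$ All algebras are graded commutative, with total degree, and $Q_{\mathcal P}$ (resp. $Q_{\bar{\mathcal P}}$) is the degree 1 graded derivation equal to the De Rham differential on $\Omega^\bullet M$ and sending $q\mapsto F$, $t\mapsto H+q\bar F$ (resp. $\bar q\mapsto\bar F$, $t\mapsto H+\bar q F$); these square to zero. The pairs $(\mathcal E,\mathcal P)$ and $(\bar{\mathcal E},\bar{\mathcal P})$ are called T-dual. $H^*(\mathcal P,Q_{\mathcal P})$ denotes the cohomology of $(C^*(\mathcal P),Q_{\mathcal P})$, and likewise for $\bar{\mathcal P}$. The shift is $(C^*(\bar{\mathcal P})[1])^k = C^{k-1}(\bar{\mathcal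 P})$. The T-duality map is the degree $-1$ map of complexes given by the composition $T = \bar{\mathbf p}_*\circ e^{\bar q q\partial_t}\circ\mathbf p^*$, where $\mathbf p^*: C^*(\mathcal P)\to\Omega^\bullet M\otimes\Lambda[q,\bar q]\otimes\mathbb{R}[t]$ is the inclusion; $e^{\bar q q\partial_t}$ is the exponential of the degree 0 derivation $\bar q q\,\partial_t$ (which vanishes on $\Omega^\bullet M$, $q$ and $\bar q$, and sends $t\mapsto\bar q q$) acting on $\Omega^\bullet M\otimes\Lambda[q,\bar q]\otimes\mathbb{R}[t]$; and $\bar{\mathbf p}_*:\Omega^\bullet M\otimes\Lambda[q,\bar q]\otimes\mathbb{R}[t]\to \Omega^\bullet M\otimes\Lambda[\bar q]\otimes\mathbb{R}[t]$ is integration along the fiber variable $q$: $\bar{\mathbf p}_*(\alpha q)=\alpha$ and $\bar{\mathbf p}_*(\alpha)=0$ for $\alpha\in\Omega^\bullet M\otimes\Lambda[\bar q]\otimes\mathbb{R}[t]$ (with $q$ written on the right). *)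

theory Defs
  imports
    "HOL-Analysis.Analysis"
    "HOL-Algebra.Module"
    "HOL-Algebra.AbelCoset"
    "HOL-Library.Function_Algebras"
begin

section \<open>Smooth manifolds\<close>

text \<open>
  The model space \<open>\<real>\<^sup>n\<close> is an \<open>n\<close>-dimensional linear subspace \<open>E\<close> of a Euclidean space.  Taking
  \<open>E = UNIV\<close> would exclude dimension 0, because every type of class \<open>euclidean_space\<close> has positive
  dimension.  In \<open>C_diff E k V f\<close> the set \<open>V\<close> is meant to be open in \<open>E\<close>; the Frechet derivative
  within such a \<open>V\<close> is uniquely determined on vectors of \<open>E\<close>, and only these are ever used.
\<close>

primrec C_diff ::
  "'e::euclidean_space set \<Rightarrow> nat \<Rightarrow> 'e set \<Rightarrow> ('e \<Rightarrow> 'b::real_normed_vector) \<Rightarrow> bool" where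
  "C_diff E 0 V f \<longleftrightarrow> continuous_on V f"
| "C_diff E (Suc k) V f \<longleftrightarrow>
     (\<forall>x\<in>V. f differentiable (at x within V)) \<and>
     (\<forall>v\<in>E. C_diff E k V (\<lambda>x. frechet_derivative f (at x within V) v))"

definition smooth_on ::
  "'e::euclidean_space set \<Rightarrow> 'e set \<Rightarrow> ('e \<Rightarrow> 'b::real_normed_vector) \<Rightarrow> bool" where
  "smooth_on E V f \<longleftrightarrow> (\<forall>k. C_diff E k V f)"

text \<open>A chart is a pair of its domain and its coordinate map.\<close>

type_synonym ('a, 'e) chart = "'a set \<times> ('a \<Rightarrow> 'e)"

abbreviation chart_dom :: "('a, 'e) chart \<Rightarrow> 'a set" where
  "chart_dom c \<equiv> fst c"

abbreviation chart_map :: "('a, 'e) chart \<Rightarrow> 'a \<Rightarrow> 'e" where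
  "chart_map c \<equiv> snd c"

abbreviation chart_inv :: "('a, 'e) chart \<Rightarrow> 'e \<Rightarrow> 'a" where
  "chart_inv c \<equiv> inv_into (chart_dom c) (chart_map c)"

definition is_chart :: "'a topology \<Rightarrow> 'e::euclidean_space set \<Rightarrow> ('a, 'e) chart \<Rightarrow> bool" where
  "is_chart X E c \<longleftrightarrow>
     openin X (chart_dom c) \<and>
     openin (top_of_set E) (chart_map c ` chart_dom c) \<and>
     homeomorphic_map (subtopology X (chart_dom c)) (top_of_set (chart_map c ` chart_dom c))
       (chart_map c)"

definition overlap :: "('a, 'e) chart \<Rightarrow> ('a, 'e) chart \<Rightarrow> 'e set" where
  "overlap c c' = chart_map c ` (chart_dom c \<inter> chart_dom c')"

definition transition :: "('a, 'e) chart \<Rightarrow> ('a, 'e) chart \<Rightarrow> 'e \<Rightarrow> 'e" where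
  "transition c c' = chart_map c' \<circ> chart_inv c"

definition smooth_manifold ::
  "'a topology \<Rightarrow> 'e::euclidean_space set \<Rightarrow> ('a, 'e) chart set \<Rightarrow> bool" where
  "smooth_manifold X E A \<longleftrightarrow>
     subspace E \<and> Hausdorff_space X \<and> second_countable X \<and>
     (\<forall>c\<in>A. is_chart X E c) \<and> (\<Union>c\<in>A. chart_dom c) = topspace X \<and>
     (\<forall>c\<in>A. \<forall>c'\<in>A. smooth_on E (overlap c c') (transition c c'))"


section \<open>Differential forms\<close>

text \<open>
  \<open>\<omega> c p [v\<^sub>1, \<dots>, v\<^sub>k]\<close> is the value of the degree \<open>k\<close> component of \<open>\<omega>\<close> at the point \<open>p\<close> on the tangent
  vectors that have coordinates \<open>v\<^sub>1, \<dots>, v\<^sub>k\<close> in the chart \<open>c\<close>.  A form need not be homogeneous: its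
  components are its restrictions to lists of the various lengths.  Outside the meaningful
  arguments the value is fixed to be 0, so that equality of forms is equality of functions.
\<close>

type_synonym ('a, 'e) form = "('a, 'e) chart \<Rightarrow> 'a \<Rightarrow> 'e list \<Rightarrow> real"

definition is_form :: "'e::euclidean_space set \<Rightarrow> ('a, 'e) chart set \<Rightarrow> ('a, 'e) form \<Rightarrow> bool" where
  "is_form E A \<omega> \<longleftrightarrow>
     (\<forall>c p vs. \<not> (c \<in> A \<and> p \<in> chart_dom c \<and> set vs \<subseteq> E) \<longrightarrow> \<omega> c p vs = 0) \<and>
     \<comment> \<open>multilinear\<close>
     (\<forall>c\<in>A. \<forall>p\<in>chart_dom c. \<forall>us ws. \<forall>u\<in>E. \<forall>v\<in>E. \<forall>r s. set us \<subseteq> E \<longrightarrow> set ws \<subseteq> E \<longrightarrow>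
        \<omega> c p (us @ (r *\<^sub>R u + s *\<^sub>R v) # ws) = r * \<omega> c p (us @ u # ws) + s * \<omega> c p (us @ v # ws)) \<and>
     \<comment> \<open>alternating\<close>
     (\<forall>c\<in>A. \<forall>p\<in>chart_dom c. \<forall>vs. set vs \<subseteq> E \<longrightarrow> \<not> distinct vs \<longrightarrow> \<omega> c p vs = 0) \<and>
     \<comment> \<open>independent of the chart\<close>
     (\<forall>c\<in>A. \<forall>c'\<in>A. \<forall>p\<in>chart_dom c \<inter> chart_dom c'. \<forall>vs. set vs \<subseteq> E \<longrightarrow>
        \<omega> c p vs = \<omega> c' p
          (map (frechet_derivative (transition c c') (at (chart_map c p) within overlap c c')) vs)) \<and>
     \<comment> \<open>smooth coefficients\<close>
     (\<forall>c\<in>A. \<forall>vs. set vs \<subseteq> E \<longrightarrow>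
        smooth_on E (chart_map c ` chart_dom c) (\<lambda>x. \<omega> c (chart_inv c x) vs))"

definition fscale :: "real \<Rightarrow> ('a, 'e) form \<Rightarrow> ('a, 'e) form" where
  "fscale r \<omega> = (\<lambda>c p vs. r * \<omega> c p vs)"

text \<open>
  \<open>\<Omega>\<^sup>k(M)\<close> as a real vector space, for an arbitrary integer \<open>k\<close> (it is 0 for \<open>k < 0\<close>).  The fields
  \<open>mult\<close> and \<open>one\<close> of the record play no role in the theory of modules.
\<close>

definition Omega ::
  "'e::euclidean_space set \<Rightarrow> ('a, 'e) chart set \<Rightarrow> int \<Rightarrow> (real, ('a, 'e) form) module" where
  "Omega E A k =
     \<lparr>carrier = {\<omega>. is_form E A \<omega> \<and> (\<forall>c p vs. int (length vs) \<noteq> k \<longrightarrow> \<omega> c p vs = 0)},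
      mult = undefined, one = undefined, zero = 0, add = (+), smult = fscale\<rparr>"

text \<open>The sign of the shuffle that moves the indices in \<open>I\<close> in front of those in \<open>J\<close>.\<close>

definition shuffle_sign :: "nat set \<Rightarrow> nat set \<Rightarrow> real" where
  "shuffle_sign I J = (-1) ^ card {(i, j). i \<in> I \<and> j \<in> J \<and> j < i}"

definition wedge :: "('a, 'e) form \<Rightarrow> ('a, 'e) form \<Rightarrow> ('a, 'e) form" where
  "wedge \<alpha> \<beta> = (\<lambda>c p vs. \<Sum>I\<in>Pow {..<length vs}.
     shuffle_sign I ({..<length vs} - I) *
     (\<alpha> c p (nths vs I) * \<beta> c p (nths vs ({..<length vs} - I))))"

text \<open>
  The de Rham differential, computed in charts:
  \<open>(d\<omega>)(v\<^sub>0, \<dots>, v\<^sub>k) = (\<Sum>i. (-1)\<^sup>i \<partial>\<^bsub>v\<^sub>i\<^esub> (\<omega>(v\<^sub>0, \<dots>, v\<^sub>k without v\<^sub>i)))\<close>.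
\<close>

definition deRham :: "'e::euclidean_space set \<Rightarrow> ('a, 'e) chart set \<Rightarrow> ('a, 'e) form \<Rightarrow> ('a, 'e) form"
  where
  "deRham E A \<omega> = (\<lambda>c p vs.
     if c \<in> A \<and> p \<in> chart_dom c \<and> set vs \<subseteq> E then
       \<Sum>i<length vs. (-1) ^ i *
         frechet_derivative (\<lambda>x. \<omega> c (chart_inv c x) (take i vs @ drop (Suc i) vs))
           (at (chart_map c p) within chart_map c ` chart_dom c) (vs ! i)
     else 0)"

definition unit_form :: "('a, 'e) chart set \<Rightarrow> ('a, 'e) form" where
  "unit_form A = (\<lambda>c p vs. if c \<in> A \<and> p \<in> chart_dom c \<and> vs = [] then 1 else 0)"


section \<open>The graded algebra of forms with values in \<open>\<Lambda>[\<theta>\<^sub>0, \<theta>\<^sub>1, \<dots>] \<otimes> \<real>[t]\<close>\<close>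

text \<open>
  \<open>x I n\<close> is the coefficient, written on the left, of the monomial \<open>\<theta>\<^bsub>i\<^sub>1\<^esub> \<cdots> \<theta>\<^bsub>i\<^sub>r\<^esub> t\<^sup>n\<close> with
  \<open>I = {i\<^sub>1 < \<dots> < i\<^sub>r}\<close>.  The generators \<open>\<theta>\<^sub>i\<close> have degree 1, and \<open>t\<close> has degree 2.
  Numbering \<open>qbar\<close> before \<open>q\<close> puts \<open>q\<close> rightmost in a monomial, as fiber integration requires.
\<close>

type_synonym ('a, 'e) alg = "nat set \<Rightarrow> nat \<Rightarrow> ('a, 'e) form"

abbreviation qbar :: nat where "qbar \<equiv> 0"

abbreviation q :: nat where "q \<equiv> 1"

definition alg_scale :: "real \<Rightarrow> ('a, 'e) alg \<Rightarrow> ('a, 'e) alg" where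
  "alg_scale r x = (\<lambda>I n. fscale r (x I n))"

text \<open>
  The homogeneous elements of total degree \<open>k\<close> of \<open>\<Omega>(M) \<otimes> \<Lambda>[\<theta>\<^sub>i | i \<in> S] \<otimes> \<real>[t]\<close> for finite \<open>S\<close>.
  Such an element is automatically polynomial in \<open>t\<close>, because \<open>\<Omega>\<^sup>j(M) = 0\<close> for \<open>j < 0\<close>.
\<close>

definition Cochains ::
  "'e::euclidean_space set \<Rightarrow> ('a, 'e) chart set \<Rightarrow> nat set \<Rightarrow> int \<Rightarrow> (real, ('a, 'e) alg) module" where
  "Cochains E A S k =
     \<lparr>carrier = {x. (\<forall>I n. x I n \<in> carrier (Omega E A (k - int (card I) - 2 * int n))) \<and>
                    (\<forall>I n. \<not> I \<subseteq> S \<longrightarrow> x I n = 0)},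
      mult = undefined, one = undefined, zero = 0, add = (+), smult = alg_scale\<rparr>"

definition incl :: "('a, 'e) form \<Rightarrow> ('a, 'e) alg" where
  "incl \<omega> = (\<lambda>I n. if I = {} \<and> n = 0 then \<omega> else 0)"

definition odd_gen :: "('a, 'e) chart set \<Rightarrow> nat \<Rightarrow> ('a, 'e) alg" where
  "odd_gen A j = (\<lambda>I n. if I = {j} \<and> n = 0 then unit_form A else 0)"

text \<open>\<open>par r\<close> multiplies a \<open>k\<close>-form by \<open>(-1)\<^bsup>rk\<^esup>\<close>, the sign for moving it past \<open>r\<close> odd generators.\<close>

definition par :: "nat \<Rightarrow> ('a, 'e) form \<Rightarrow> ('a, 'e) form" where
  "par r \<omega> = (\<lambda>c p vs. (-1) ^ (r * length vs) * \<omega> c p vs)"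

text \<open>
  \<open>(\<alpha> \<theta>\<^sub>I t\<^sup>m) (\<beta> \<theta>\<^sub>J t\<^sup>n) = (-1)\<^bsup>\<bar>I\<bar>\<bar>\<beta>\<bar>\<^esup> sign(I, J) (\<alpha> \<and> \<beta>) \<theta>\<^bsub>I \<union> J\<^esub> t\<^bsup>m + n\<^esup>\<close> for disjoint \<open>I\<close>, \<open>J\<close>.
\<close>

definition alg_mult :: "('a, 'e) alg \<Rightarrow> ('a, 'e) alg \<Rightarrow> ('a, 'e) alg" (infixl \<open>\<star>\<close> 70) where
  "x \<star> y = (\<lambda>K n. \<Sum>I\<in>Pow K. \<Sum>m\<le>n.
     fscale (shuffle_sign I (K - I)) (wedge (x I m) (par (card I) (y (K - I) (n - m)))))"

definition d_forms :: "'e::euclidean_space set \<Rightarrow> ('a, 'e) chart set \<Rightarrow> ('a, 'e) alg \<Rightarrow> ('a, 'e) alg"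
  where
  "d_forms E A x = (\<lambda>I n. deRham E A (x I n))"

text \<open>The left derivative with respect to \<open>\<theta>\<^sub>j\<close>; it has degree \<open>-1\<close> and anticommutes with 1-forms.\<close>

definition d_odd :: "nat \<Rightarrow> ('a, 'e) alg \<Rightarrow> ('a, 'e) alg" where
  "d_odd j x = (\<lambda>K n. if j \<in> K then 0
     else fscale ((-1) ^ card {i \<in> K. i < j}) (par 1 (x (insert j K) n)))"

definition d_t :: "('a, 'e) alg \<Rightarrow> ('a, 'e) alg" where
  "d_t x = (\<lambda>K n. fscale (real (Suc n)) (x K (Suc n)))"

text \<open>\<open>d + F \<partial>\<^bsub>\<theta>\<^sub>j\<^esub> + (H + \<theta>\<^sub>j G) \<partial>\<^sub>t\<close>\<close>

definition Qdiff ::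
  "'e::euclidean_space set \<Rightarrow> ('a, 'e) chart set \<Rightarrow> nat \<Rightarrow>
   ('a, 'e) form \<Rightarrow> ('a, 'e) form \<Rightarrow> ('a, 'e) form \<Rightarrow> ('a, 'e) alg \<Rightarrow> ('a, 'e) alg" where
  "Qdiff E A j F G H x =
     d_forms E A x + incl F \<star> d_odd j x + (incl H + odd_gen A j \<star> incl G) \<star> d_t x"

definition C_P :: "'e::euclidean_space set \<Rightarrow> ('a, 'e) chart set \<Rightarrow> int \<Rightarrow> (real, ('a, 'e) alg) module"
  where "C_P E A = Cochains E A {q}"

definition C_Pbar ::
  "'e::euclidean_space set \<Rightarrow> ('a, 'e) chart set \<Rightarrow> int \<Rightarrow> (real, ('a, 'e) alg) module"
  where "C_Pbar E A = Cochains E A {qbar}"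

definition Q_P ::
  "'e::euclidean_space set \<Rightarrow> ('a, 'e) chart set \<Rightarrow>
   ('a, 'e) form \<Rightarrow> ('a, 'e) form \<Rightarrow> ('a, 'e) form \<Rightarrow> ('a, 'e) alg \<Rightarrow> ('a, 'e) alg"
  where "Q_P E A F Fbar H = Qdiff E A q F Fbar H"

definition Q_Pbar ::
  "'e::euclidean_space set \<Rightarrow> ('a, 'e) chart set \<Rightarrow>
   ('a, 'e) form \<Rightarrow> ('a, 'e) form \<Rightarrow> ('a, 'e) form \<Rightarrow> ('a, 'e) alg \<Rightarrow> ('a, 'e) alg"
  where "Q_Pbar E A F Fbar H = Qdiff E A qbar Fbar F H"


section \<open>The T-duality map\<close>

text \<open>
  The exponential series, evaluated coefficientwise; for the locally nilpotent \<open>D\<close> used below it is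
  a finite sum.
\<close>

definition alg_exp :: "(('a, 'e) alg \<Rightarrow> ('a, 'e) alg) \<Rightarrow> ('a, 'e) alg \<Rightarrow> ('a, 'e) alg" where
  "alg_exp D x = (\<lambda>I n c p vs. \<Sum>j. (D ^^ j) x I n c p vs / fact j)"

text \<open>Integration over \<open>q\<close>: \<open>\<alpha> q \<mapsto> \<alpha>\<close> and \<open>\<alpha> \<mapsto> 0\<close> for \<open>\<alpha>\<close> without \<open>q\<close>.\<close>

definition fiber_int :: "('a, 'e) alg \<Rightarrow> ('a, 'e) alg" where
  "fiber_int x = (\<lambda>I n. if q \<in> I then 0 else x (insert q I) n)"

text \<open>
  The pullback \<open>p\<^sup>*\<close> is the inclusion of \<open>C\<^sup>*(P)\<close> into the algebra with both odd generators, that is,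
  the identity in the present encoding.
\<close>

definition T_dual :: "('a, 'e) chart set \<Rightarrow> ('a, 'e) alg \<Rightarrow> ('a, 'e) alg" where
  "T_dual A = fiber_int \<circ> alg_exp (\<lambda>x. (odd_gen A qbar \<star> odd_gen A q) \<star> d_t x) \<circ> id"


section \<open>Cochain complexes of real vector spaces\<close>

definition real_ring :: "real ring" where
  "real_ring = \<lparr>carrier = UNIV, mult = (*), one = 1, zero = 0, add = (+)\<rparr>"

definition linear_map ::
  "(real, 'u) module \<Rightarrow> (real, 'v) module \<Rightarrow> ('u \<Rightarrow> 'v) \<Rightarrow> bool" where
  "linear_map M N f \<longleftrightarrow>
     f \<in> carrier M \<rightarrow> carrier N \<and>
     (\<forall>x\<in>carrier M. \<forall>y\<in>carrier M. f (x \<oplus>\<^bsub>M\<^esub> y) = f x \<oplus>\<^bsub>N\<^esub> f y) \<and>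
     (\<forall>r. \<forall>x\<in>carrier M. f (r \<odot>\<^bsub>M\<^esub> x) = r \<odot>\<^bsub>N\<^esub> f x)"

definition linear_iso ::
  "(real, 'u) module \<Rightarrow> (real, 'v) module \<Rightarrow> ('u \<Rightarrow> 'v) \<Rightarrow> bool" where
  "linear_iso M N f \<longleftrightarrow> linear_map M N f \<and> bij_betw f (carrier M) (carrier N)"

text \<open>Exactness of \<open>L \<rightarrow> M \<rightarrow> N\<close> at \<open>M\<close>, with maps \<open>f\<close> and \<open>g\<close>.\<close>

definition exact_at ::
  "(real, 'u) module \<Rightarrow> ('u \<Rightarrow> 'v) \<Rightarrow> (real, 'v) module \<Rightarrow> ('v \<Rightarrow> 'w) \<Rightarrow> (real, 'w) module \<Rightarrow> bool"
  where
  "exact_at L f M g N \<longleftrightarrow> f ` carrier L = {y \<in> carrier M. g y = \<zero>\<^bsub>N\<^esub>}"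

definition cochain_complex :: "(int \<Rightarrow> (real, 'v) module) \<Rightarrow> ('v \<Rightarrow> 'v) \<Rightarrow> bool" where
  "cochain_complex C D \<longleftrightarrow>
     (\<forall>k. Module.module real_ring (C k) \<and> linear_map (C k) (C (k + 1)) D \<and>
          (\<forall>x\<in>carrier (C k). D (D x) = \<zero>\<^bsub>C (k + 2)\<^esub>))"

definition cochain_map ::
  "(int \<Rightarrow> (real, 'u) module) \<Rightarrow> ('u \<Rightarrow> 'u) \<Rightarrow> (int \<Rightarrow> (real, 'v) module) \<Rightarrow> ('v \<Rightarrow> 'v) \<Rightarrow>
   ('u \<Rightarrow> 'v) \<Rightarrow> bool" where
  "cochain_map C D C' D' f \<longleftrightarrow>
     (\<forall>k. linear_map (C k) (C' k) f \<and> (\<forall>x\<in>carrier (C k). f (D x) = D' (f x)))"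

text \<open>A short exact sequence \<open>0 \<rightarrow> C \<rightarrow> C' \<rightarrow> C'' \<rightarrow> 0\<close> of complexes, with maps \<open>f\<close> and \<open>g\<close>.\<close>

definition short_exact_complexes ::
  "(int \<Rightarrow> (real, 'u) module) \<Rightarrow> ('u \<Rightarrow> 'u) \<Rightarrow> ('u \<Rightarrow> 'v) \<Rightarrow>
   (int \<Rightarrow> (real, 'v) module) \<Rightarrow> ('v \<Rightarrow> 'v) \<Rightarrow> ('v \<Rightarrow> 'w) \<Rightarrow>
   (int \<Rightarrow> (real, 'w) module) \<Rightarrow> ('w \<Rightarrow> 'w) \<Rightarrow> bool" where
  "short_exact_complexes C D f C' D' g C'' D'' \<longleftrightarrow>
     cochain_complex C D \<and> cochain_complex C' D' \<and> cochain_complex C'' D'' \<and>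
     cochain_map C D C' D' f \<and> cochain_map C' D' C'' D'' g \<and>
     (\<forall>k. inj_on f (carrier (C k)) \<and>
          exact_at (C k) f (C' k) g (C'' k) \<and>
          g ` carrier (C' k) = carrier (C'' k))"

text \<open>The sign convention is that the differential of the shifted complex is unchanged.\<close>

definition shift :: "(int \<Rightarrow> (real, 'v) module) \<Rightarrow> int \<Rightarrow> (real, 'v) module" where
  "shift C k = C (k - 1)"

definition quot_module :: "(real, 'v) module \<Rightarrow> 'v set \<Rightarrow> (real, 'v set) module" where
  "quot_module M N =
     \<lparr>carrier = a_rcosets\<^bsub>M\<^esub> N, mult = undefined, one = undefined, zero = N,
      add = (\<lambda>X Y. X <+>\<^bsub>M\<^esub> Y), smult = (\<lambda>r X. \<Union>x\<in>X. N +>\<^bsub>M\<^esub> (r \<odot>\<^bsub>M\<^esub> x))\<rparr>"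

definition cocycles :: "(int \<Rightarrow> (real, 'v) module) \<Rightarrow> ('v \<Rightarrow> 'v) \<Rightarrow> int \<Rightarrow> 'v set" where
  "cocycles C D k = {x \<in> carrier (C k). D x = \<zero>\<^bsub>C (k + 1)\<^esub>}"

definition coboundaries :: "(int \<Rightarrow> (real, 'v) module) \<Rightarrow> ('v \<Rightarrow> 'v) \<Rightarrow> int \<Rightarrow> 'v set" where
  "coboundaries C D k = D ` carrier (C (k - 1))"

definition cohomology ::
  "(int \<Rightarrow> (real, 'v) module) \<Rightarrow> ('v \<Rightarrow> 'v) \<Rightarrow> int \<Rightarrow> (real, 'v set) module" where
  "cohomology C D k =
     quot_module ((C k)\<lparr>carrier := cocycles C D k\<rparr>) (coboundaries C D k)"

definition coh_class :: "(int \<Rightarrow> (real, 'v) module) \<Rightarrow> ('v \<Rightarrow> 'v) \<Rightarrow> int \<Rightarrow> 'v \<Rightarrow> 'v set" where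
  "coh_class C D k x = coboundaries C D k +>\<^bsub>C k\<^esub> x"

text \<open>
  The map induced by \<open>f\<close> on cohomology, with values in the degree \<open>k\<close> cohomology of \<open>(C, D)\<close>.  For
  a cochain map \<open>f\<close> the sets in the union all coincide.
\<close>

definition coh_map ::
  "('u \<Rightarrow> 'v) \<Rightarrow> (int \<Rightarrow> (real, 'v) module) \<Rightarrow> ('v \<Rightarrow> 'v) \<Rightarrow> int \<Rightarrow> 'u set \<Rightarrow> 'v set" where
  "coh_map f C D k X = (\<Union>x\<in>X. coh_class C D k (f x))"


section \<open>The cohomology groups and induced maps of the T-duality sequence\<close>

definition H_M :: "'e::euclidean_space set \<Rightarrow> ('a, 'e) chart set \<Rightarrow> int \<Rightarrow> (real, ('a, 'e) form set) module"
  where "H_M E A = cohomology (Omega E A) (deRham E A)"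

definition H_P ::
  "'e::euclidean_space set \<Rightarrow> ('a, 'e) chart set \<Rightarrow>
   ('a, 'e) form \<Rightarrow> ('a, 'e) form \<Rightarrow> ('a, 'e) form \<Rightarrow> int \<Rightarrow> (real, ('a, 'e) alg set) module"
  where "H_P E A F Fbar H = cohomology (C_P E A) (Q_P E A F Fbar H)"

definition H_Pbar ::
  "'e::euclidean_space set \<Rightarrow> ('a, 'e) chart set \<Rightarrow>
   ('a, 'e) form \<Rightarrow> ('a, 'e) form \<Rightarrow> ('a, 'e) form \<Rightarrow> int \<Rightarrow> (real, ('a, 'e) alg set) module"
  where "H_Pbar E A F Fbar H = cohomology (C_Pbar E A) (Q_Pbar E A F Fbar H)"

text \<open>\<open>H\<^sup>k(M) \<rightarrow> H\<^sup>k(P)\<close>\<close>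

definition incl_coh ::
  "'e::euclidean_space set \<Rightarrow> ('a, 'e) chart set \<Rightarrow>
   ('a, 'e) form \<Rightarrow> ('a, 'e) form \<Rightarrow> ('a, 'e) form \<Rightarrow> int \<Rightarrow> ('a, 'e) form set \<Rightarrow> ('a, 'e) alg set"
  where "incl_coh E A F Fbar H k = coh_map incl (C_P E A) (Q_P E A F Fbar H) k"

text \<open>\<open>T_coh E A F Fbar H k\<close> is the map \<open>H\<^sup>k(P) \<rightarrow> H\<^bsup>k - 1\<^esup>(Pbar)\<close>, indexed by the degree of its source.\<close>

definition T_coh ::
  "'e::euclidean_space set \<Rightarrow> ('a, 'e) chart set \<Rightarrow>
   ('a, 'e) form \<Rightarrow> ('a, 'e) form \<Rightarrow> ('a, 'e) form \<Rightarrow> int \<Rightarrow> ('a, 'e) alg set \<Rightarrow> ('a, 'e) alg set"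
  where "T_coh E A F Fbar H k =
    coh_map (T_dual A) (C_Pbar E A) (Q_Pbar E A F Fbar H) (k - 1)"

text \<open>
  The connecting map \<open>H\<^bsup>k - 1\<^esup>(Pbar) \<rightarrow> H\<^bsup>k + 1\<^esup>(M)\<close> of the short exact sequence: it sends the class
  of \<open>T x\<close> to the class of \<open>\<omega>\<close> whenever \<open>Q x = \<omega>\<close>.
\<close>

definition is_connecting ::
  "'e::euclidean_space set \<Rightarrow> ('a, 'e) chart set \<Rightarrow>
   ('a, 'e) form \<Rightarrow> ('a, 'e) form \<Rightarrow> ('a, 'e) form \<Rightarrow> int \<Rightarrow> (('a, 'e) alg set \<Rightarrow> ('a, 'e) form set) \<Rightarrow> bool"
  where "is_connecting E A F Fbar H k \<delta> \<longleftrightarrow>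
    linear_map (H_Pbar E A F Fbar H (k - 1)) (H_M E A (k + 1)) \<delta> \<and>
    (\<forall>x\<in>carrier (C_P E A k). \<forall>\<omega>\<in>carrier (Omega E A (k + 1)).
       Q_P E A F Fbar H x = incl \<omega> \<longrightarrow>
       \<delta> (coh_class (C_Pbar E A) (Q_Pbar E A F Fbar H) (k - 1) (T_dual A x)) =
       coh_class (Omega E A) (deRham E A) (k + 1) \<omega>)"

end

theory Submission
  imports Defs
begin

text \<open>
  A cochain \<open>\<Sum>n. (a\<^sub>n + b\<^sub>n q) t\<^sup>n\<close> of \<open>P\<close> has the image \<open>\<Sum>n. (b\<^sub>n + (n + 1) a\<^bsub>n + 1\<^esub> qbar) t\<^sup>n\<close> under
  \<open>T\<close>.  Hence \<open>T\<close> is onto and its kernel consists of the forms \<open>a\<^sub>0\<close>, and \<open>T\<close> commutes with the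
  differentials by comparison of coefficients.  The zigzag construction gives the long exact
  sequence, and \<open>H\<^sup>k(M) = 0\<close> for \<open>k > dim E\<close> because there are no such forms.

  The calculus of forms rests on two recursions for the contraction with a constant vector \<open>v\<close> in
  a chart, \<open>\<iota>\<^sub>v(\<alpha> \<and> \<beta>) = \<iota>\<^sub>v\<alpha> \<and> \<beta> + (-1)\<^bsup>\<bar>\<alpha>\<bar>\<^esup> \<alpha> \<and> \<iota>\<^sub>v\<beta>\<close> and \<open>\<iota>\<^sub>v d\<omega> = \<partial>\<^sub>v\<omega> - d \<iota>\<^sub>v\<omega>\<close>.  They turn
  associativity, graded commutativity, the Leibniz rule, \<open>d\<^sup>2 = 0\<close> and naturality of \<open>d\<close> into
  inductions over the list of arguments.
\<close>


section \<open>Directional derivatives within an open subset of a linear space\<close>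

text \<open>Conceptually, conjugation by the exponential on the algebra with both odd generators
  replaces H + q Fbar by H + qbar F, because the differential sends qbar q to Fbar q - qbar F;
  integration over q then commutes with the differentials. Here \<open>T_dual\<close> is evaluated
  once, in \<open>T_dual_eq\<close>, and afterwards only the coefficients a_n and b_n occur. Real
  coefficients matter: inverting the map divides by n + 1. The main labour lies below the algebra.
  Coordinates range over a subspace \<open>E\<close>, possibly of dimension 0, so a Frechet
  derivative within an open subset of \<open>E\<close> is determined only on \<open>E\<close>;
  derivatives are therefore identified along rays, through \<open>dir_deriv\<close>. Forms are
  functions on lists that vanish outside the meaningful arguments, and every operation must be shown
  to preserve \<open>is_form\<close>. For \<open>deRham\<close> the hard clause is independence of
  the chart: pulling back along a transition map makes the arguments of the form vary with the
  point, and the resulting second derivatives of the transition map cancel only by their symmetry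
  together with alternation.\<close>

definition dir_deriv :: "'e::euclidean_space set \<Rightarrow> 'e \<Rightarrow> ('e \<Rightarrow> 'b::real_normed_vector) \<Rightarrow> 'e \<Rightarrow> 'b" where
  "dir_deriv V v f x = frechet_derivative f (at x within V) v"

text \<open>\<open>frechet_derivative\<close> is a choice among all derivatives. Functions that
  agree on \<open>V\<close> have the same derivatives there, so the choices coincide even where a
  derivative is not unique or does not exist.\<close>

lemma frechet_derivative_cong_within:
  assumes "\<And>y. y \<in> V \<Longrightarrow> f y = g y" "x \<in> V"
  shows "frechet_derivative f (at x within V) = frechet_derivative g (at x within V)"
proof -
  have "(f has_derivative f') (at x within V) \<longleftrightarrow> (g has_derivative f') (at x within V)" for f'
    using assms by (auto elim: has_derivative_transform[rotated 2])
  then show ?thesis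
    by (simp add: frechet_derivative_def)
qed

lemma dir_deriv_cong:
  assumes "\<And>y. y \<in> V \<Longrightarrow> f y = g y" "x \<in> V"
  shows "dir_deriv V v f x = dir_deriv V v g x"
  using frechet_derivative_cong_within[OF assms] by (simp add: dir_deriv_def)

lemma differentiable_cong_within:
  assumes "\<And>y. y \<in> V \<Longrightarrow> f y = g y" "x \<in> V"
  shows "f differentiable (at x within V) \<longleftrightarrow> g differentiable (at x within V)"
  unfolding differentiable_def
  by (metis assms has_derivative_transform)

lemma C_diff_cong:
  assumes "\<And>x. x \<in> V \<Longrightarrow> f x = g x"
  shows "C_diff E k V f \<longleftrightarrow> C_diff E k V g"
  using assms
proof (induction k arbitrary: f g)
  case 0
  then show ?case by (simp cong: continuous_on_cong)
next
  case (Suc k)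
  have "frechet_derivative f (at x within V) = frechet_derivative g (at x within V)" if "x \<in> V" for x
    by (intro frechet_derivative_cong_within Suc.prems that)
  then have "C_diff E k V (\<lambda>x. frechet_derivative f (at x within V) v)
      \<longleftrightarrow> C_diff E k V (\<lambda>x. frechet_derivative g (at x within V) v)" for v
    by (intro Suc.IH) simp
  moreover have "(\<forall>x\<in>V. f differentiable (at x within V)) \<longleftrightarrow> (\<forall>x\<in>V. g differentiable (at x within V))"
    by (intro ball_cong refl differentiable_cong_within Suc.prems)
  ultimately show ?case by simp
qed

lemma smooth_on_cong:
  assumes "\<And>x. x \<in> V \<Longrightarrow> f x = g x"
  shows "smooth_on E V f \<longleftrightarrow> smooth_on E V g"
  unfolding smooth_on_def by (intro all_cong1 C_diff_cong assms)

lemma smooth_on_differentiable: "smooth_on E V f \<Longrightarrow> x \<in> V \<Longrightarrow> f differentiable (at x within V)"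
  unfolding smooth_on_def by (drule spec[of _ "Suc 0"]) simp

lemma smooth_on_continuous: "smooth_on E V f \<Longrightarrow> continuous_on V f"
  unfolding smooth_on_def by (drule spec[of _ 0]) simp

lemma smooth_on_dir_deriv: "smooth_on E V f \<Longrightarrow> v \<in> E \<Longrightarrow> smooth_on E V (dir_deriv V v f)"
  unfolding smooth_on_def dir_deriv_def
proof
  fix k assume "\<forall>k. C_diff E k V f" "v \<in> E"
  then have "C_diff E (Suc k) V f" by blast
  then show "C_diff E k V (\<lambda>x. frechet_derivative f (at x within V) v)"
    using \<open>v \<in> E\<close> by simp
qed

section \<open>Derivatives along vectors of the subspace and their calculus\<close>

locale open_in_subspace =
  fixes E V :: "'e::euclidean_space set"
  assumes subspace_E: "subspace E" and openin_V: "openin (top_of_set E) V"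
begin

lemmas smooth_differentiable = smooth_on_differentiable[of E V]
lemmas smooth_continuous = smooth_on_continuous[of E V]

lemma V_subset: "V \<subseteq> E"
  using openin_V by (simp add: openin_imp_subset)

text \<open>\<open>V\<close> is open only relative to \<open>E\<close>, so the direction must lie in
  \<open>E\<close>. Both signs of \<open>t\<close> are covered, which makes two-sided derivatives
  available.\<close>

lemma eventually_ray:
  assumes "x \<in> V" "v \<in> E"
  shows "\<forall>\<^sub>F t in nhds 0. x + t *\<^sub>R v \<in> V"
proof -
  obtain T where T: "open T" "V = E \<inter> T"
    using openin_V by (auto simp: openin_open)
  have "continuous_on UNIV (\<lambda>t::real. x + t *\<^sub>R v)"
    by (intro continuous_intros)
  then have "open ((\<lambda>t::real. x + t *\<^sub>R v) -` T)"
    using T(1) by (simp add: open_vimage)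
  then have "\<forall>\<^sub>F t in nhds 0. t \<in> (\<lambda>t::real. x + t *\<^sub>R v) -` T"
    using assms T by (intro eventually_nhds_in_open) auto
  then show ?thesis
  proof (rule eventually_mono)
    fix t assume "t \<in> (\<lambda>t::real. x + t *\<^sub>R v) -` T"
    moreover have "x + t *\<^sub>R v \<in> E"
      using assms V_subset by (intro subspace_add subspace_scale subspace_E) auto
    ultimately show "x + t *\<^sub>R v \<in> V" using T(2) by simp
  qed
qed

text \<open>Composition with the line through \<open>x\<close> reduces to one real variable, where
  the derivative at 0 is unique.\<close>

lemma has_derivative_ray:
  assumes "(f has_derivative f') (at x within V)" "x \<in> V" "v \<in> E"
  shows "((\<lambda>t. f (x + t *\<^sub>R v)) has_vector_derivative f' v) (at 0)"
proof -
  let ?S = "(\<lambda>t::real. x + t *\<^sub>R v) -` V"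
  have g: "((\<lambda>t::real. x + t *\<^sub>R v) has_derivative (\<lambda>t. t *\<^sub>R v)) (at 0 within ?S)"
    by (auto intro!: derivative_eq_intros)
  have "(f has_derivative f') (at (x + 0 *\<^sub>R v) within (\<lambda>t::real. x + t *\<^sub>R v) ` ?S)"
    using has_derivative_subset[OF assms(1), of "(\<lambda>t::real. x + t *\<^sub>R v) ` ?S"] by auto
  from diff_chain_within[OF g this]
  have "((\<lambda>t. f (x + t *\<^sub>R v)) has_derivative (\<lambda>t. f' (t *\<^sub>R v))) (at 0 within ?S)"
    by (simp add: o_def)
  moreover have "f' (t *\<^sub>R v) = t *\<^sub>R f' v" for t
    using has_derivative_bounded_linear[OF assms(1)] by (intro linear_cmul bounded_linear.linear)
  \<comment> \<open>Near 0 the whole line stays in \<open>V\<close>, so the restriction to the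
    preimage of \<open>V\<close> disappears.\<close>
  moreover have "at 0 within ?S = at 0"
  proof -
    obtain U where "open U" "0 \<in> U" "\<forall>t\<in>U. x + t *\<^sub>R v \<in> V"
      using eventually_ray[OF assms(2,3)] unfolding eventually_nhds by blast
    then show ?thesis
      by (intro at_within_nhd[of _ U]) auto
  qed
  ultimately show ?thesis
    by (simp add: has_vector_derivative_def)
qed

text \<open>Any two derivatives within \<open>V\<close> induce the same vector derivative along the
  ray in direction \<open>v\<close>. The choice in \<open>frechet_derivative\<close> is thus
  harmless on \<open>E\<close>, and the rules below only have to exhibit some derivative.\<close>

lemma dir_deriv_eqI:
  assumes "(f has_derivative f') (at x within V)" "x \<in> V" "v \<in> E"
  shows "dir_deriv V v f x = f' v"
proof -
  have "(f has_derivative frechet_derivative f (at x within V)) (at x within V)"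
    using assms(1) by (metis differentiableI frechet_derivative_works)
  from has_derivative_ray[OF this assms(2,3)] has_derivative_ray[OF assms]
  show ?thesis
    unfolding dir_deriv_def by (rule vector_derivative_unique_at)
qed

lemma has_derivative_dir_deriv:
  assumes "f differentiable (at x within V)"
  shows "(f has_derivative (\<lambda>v. dir_deriv V v f x)) (at x within V)"
  using assms by (simp add: dir_deriv_def frechet_derivative_works)

lemma linear_dir_deriv: "f differentiable (at x within V) \<Longrightarrow> linear (\<lambda>v. dir_deriv V v f x)"
  using linear_frechet_derivative by (auto simp: dir_deriv_def)

lemma dir_deriv_const [simp]: "x \<in> V \<Longrightarrow> v \<in> E \<Longrightarrow> dir_deriv V v (\<lambda>x. c) x = 0"
  by (rule dir_deriv_eqI[where f' = "\<lambda>_. 0"]) auto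

lemma dir_deriv_add:
  assumes "f differentiable (at x within V)" "g differentiable (at x within V)" "x \<in> V" "v \<in> E"
  shows "dir_deriv V v (\<lambda>x. f x + g x) x = dir_deriv V v f x + dir_deriv V v g x"
  using assms
  by (intro dir_deriv_eqI[where f' = "\<lambda>v. dir_deriv V v f x + dir_deriv V v g x"]
      has_derivative_add has_derivative_dir_deriv)

lemma dir_deriv_sum:
  assumes "\<And>i. i \<in> I \<Longrightarrow> f i differentiable (at x within V)" "x \<in> V" "v \<in> E"
  shows "dir_deriv V v (\<lambda>x. \<Sum>i\<in>I. f i x) x = (\<Sum>i\<in>I. dir_deriv V v (f i) x)"
  using assms
  by (intro dir_deriv_eqI[where f' = "\<lambda>v. \<Sum>i\<in>I. dir_deriv V v (f i) x"]
      has_derivative_sum has_derivative_dir_deriv)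

lemma dir_deriv_scaleR:
  assumes "f differentiable (at x within V)" "g differentiable (at x within V)" "x \<in> V" "v \<in> E"
  shows "dir_deriv V v (\<lambda>x. f x *\<^sub>R g x) x = f x *\<^sub>R dir_deriv V v g x + dir_deriv V v f x *\<^sub>R g x"
  using assms
  by (intro dir_deriv_eqI[where f' = "\<lambda>v. f x *\<^sub>R dir_deriv V v g x + dir_deriv V v f x *\<^sub>R g x"]
      has_derivative_scaleR has_derivative_dir_deriv)

lemma dir_deriv_mult:
  fixes f g :: "'e \<Rightarrow> real"
  assumes "f differentiable (at x within V)" "g differentiable (at x within V)" "x \<in> V" "v \<in> E"
  shows "dir_deriv V v (\<lambda>x. f x * g x) x = dir_deriv V v f x * g x + f x * dir_deriv V v g x"
  using dir_deriv_scaleR[OF assms] by simp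

lemma dir_deriv_cmult:
  fixes f :: "'e \<Rightarrow> real"
  assumes "f differentiable (at x within V)" "x \<in> V" "v \<in> E"
  shows "dir_deriv V v (\<lambda>x. c * f x) x = c * dir_deriv V v f x"
  using dir_deriv_mult[of "\<lambda>_. c" x f v] assms by simp

lemma dir_deriv_bounded_linear:
  assumes "bounded_linear h" "f differentiable (at x within V)" "x \<in> V" "v \<in> E"
  shows "dir_deriv V v (\<lambda>x. h (f x)) x = h (dir_deriv V v f x)"
  using dir_deriv_eqI[OF bounded_linear.has_derivative[OF assms(1) has_derivative_dir_deriv[OF assms(2)]] assms(3,4)] .

text \<open>A derivative restricts to the smaller set, where it is still determined along
  \<open>E\<close>. This lets a form be differentiated on an overlap instead of the whole chart
  image.\<close>

lemma dir_deriv_subset: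
  assumes "W \<subseteq> V" "openin (top_of_set E) W" "f differentiable (at x within V)" "x \<in> W" "v \<in> E"
  shows "dir_deriv W v f x = dir_deriv V v f x"
proof -
  interpret W: open_in_subspace E W
    using assms subspace_E by unfold_locales
  show ?thesis
    using assms
    by (intro W.dir_deriv_eqI[where f' = "\<lambda>v. dir_deriv V v f x"]
        has_derivative_subset[OF _ assms(1)] has_derivative_dir_deriv)
qed

lemma dir_deriv_chain:
  assumes "open_in_subspace E W"
    and "\<tau> differentiable (at x within V)" "f differentiable (at (\<tau> x) within W)" "\<tau> ` V \<subseteq> W"
    and "x \<in> V" "v \<in> E"
  shows "dir_deriv V v (\<lambda>x. f (\<tau> x)) x = dir_deriv W (dir_deriv V v \<tau> x) f (\<tau> x)"
proof -
  interpret W: open_in_subspace E W by fact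
  have "(f has_derivative (\<lambda>v. dir_deriv W v f (\<tau> x))) (at (\<tau> x) within \<tau> ` V)"
    using W.has_derivative_dir_deriv[OF assms(3)] assms(4) by (rule has_derivative_subset)
  from diff_chain_within[OF has_derivative_dir_deriv[OF assms(2)] this]
  show ?thesis
    using assms(5,6)
    by (intro dir_deriv_eqI[where f' = "\<lambda>v. dir_deriv W (dir_deriv V v \<tau> x) f (\<tau> x)"]) (simp_all add: o_def)
qed

text \<open>Pairing with a vector orthogonal to \<open>E\<close> gives a function that vanishes
  identically on \<open>V\<close>, so the derivative is orthogonal to the orthogonal complement of
  \<open>E\<close>.\<close>

lemma dir_deriv_in_subspace:
  assumes "f differentiable (at x within V)" "f ` V \<subseteq> E" "x \<in> V" "v \<in> E"
  shows "dir_deriv V v f x \<in> E"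
proof -
  have "dir_deriv V v f x \<bullet> u = 0" if u: "u \<in> E\<^sup>\<bottom>" for u
  proof -
    have "dir_deriv V v f x \<bullet> u = dir_deriv V v (\<lambda>x. f x \<bullet> u) x"
      using assms by (intro dir_deriv_bounded_linear[symmetric] bounded_linear_inner_left)
    also have "\<dots> = dir_deriv V v (\<lambda>x. 0) x"
    proof (rule dir_deriv_cong[OF _ assms(3)])
      fix y assume "y \<in> V"
      then have "f y \<in> E" using assms(2) by blast
      with u show "f y \<bullet> u = 0" by (auto simp: orthogonal_comp_def orthogonal_def)
    qed
    also have "\<dots> = 0" using assms by simp
    finally show ?thesis .
  qed
  then have "dir_deriv V v f x \<in> E\<^sup>\<bottom>\<^sup>\<bottom>"
    by (simp add: orthogonal_comp_def orthogonal_def inner_commute)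
  then show ?thesis
    using orthogonal_comp_self[OF subspace_E] by simp
qed

section \<open>Closure properties of smooth functions\<close>

lemma C_diff_const: "C_diff E k V (\<lambda>x. c)"
proof (induction k arbitrary: c)
  case (Suc k)
  \<comment> \<open>The derivative of a constant is known to be 0 only at points of \<open>V\<close>
    and along \<open>E\<close>; the congruence replaces it by the constant 0, for which the
    induction hypothesis holds.\<close>
  have "C_diff E k V (\<lambda>x. frechet_derivative (\<lambda>x. c) (at x within V) v)" if "v \<in> E" for v
    using Suc[of 0] dir_deriv_const[OF _ that, unfolded dir_deriv_def]
    by (subst C_diff_cong[where g = "\<lambda>x. 0"]) auto
  then show ?case by simp
qed simp

lemma C_diff_add:
  assumes "C_diff E k V f" "C_diff E k V g"
  shows "C_diff E k V (\<lambda>x. f x + g x)"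
  using assms
proof (induction k arbitrary: f g)
  case 0
  then show ?case by (auto intro!: continuous_on_add)
next
  case (Suc k)
  have "C_diff E k V (\<lambda>x. frechet_derivative (\<lambda>x. f x + g x) (at x within V) v)" if v: "v \<in> E" for v
  proof -
    have "C_diff E k V (\<lambda>x. dir_deriv V v f x + dir_deriv V v g x)"
      using Suc.prems v by (intro Suc.IH) (auto simp: dir_deriv_def)
    also have "?this \<longleftrightarrow> C_diff E k V (dir_deriv V v (\<lambda>x. f x + g x))"
      using Suc.prems v by (intro C_diff_cong) (simp add: dir_deriv_add)
    finally show ?thesis by (simp add: dir_deriv_def[abs_def])
  qed
  then show ?case
    using Suc.prems by (auto intro!: differentiable_add)
qed

lemma smooth_on_const [simp]: "smooth_on E V (\<lambda>x. c)"
  by (simp add: smooth_on_def C_diff_const)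

lemma smooth_on_add:
  assumes "smooth_on E V f" "smooth_on E V g"
  shows "smooth_on E V (\<lambda>x. f x + g x)"
  using assms by (simp add: smooth_on_def C_diff_add)

lemma smooth_on_sum:
  assumes "\<And>i. i \<in> I \<Longrightarrow> smooth_on E V (f i)"
  shows "smooth_on E V (\<lambda>x. \<Sum>i\<in>I. f i x)"
  using assms by (induction I rule: infinite_finite_induct) (auto intro: smooth_on_add)

text \<open>The product rule mixes a derivative of one factor with the other factor itself. The
  induction on the order therefore assumes full smoothness of both factors, which passes to
  derivatives, instead of a fixed order that would drop for one factor only.\<close>

lemma smooth_on_scaleR:
  assumes "smooth_on E V f" "smooth_on E V g"
  shows "smooth_on E V (\<lambda>x. f x *\<^sub>R g x)"
proof -
  have "C_diff E k V (\<lambda>x. f x *\<^sub>R g x)" for k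
    using assms
  proof (induction k arbitrary: f g)
    case 0
    then show ?case by (simp add: continuous_on_scaleR smooth_continuous)
  next
    case (Suc k)
    have "C_diff E k V (\<lambda>x. frechet_derivative (\<lambda>x. f x *\<^sub>R g x) (at x within V) v)" if v: "v \<in> E" for v
    proof -
      have "C_diff E k V (\<lambda>x. f x *\<^sub>R dir_deriv V v g x + dir_deriv V v f x *\<^sub>R g x)"
        using Suc.prems v by (intro C_diff_add Suc.IH) (auto intro: smooth_on_dir_deriv)
      also have "?this \<longleftrightarrow> C_diff E k V (dir_deriv V v (\<lambda>x. f x *\<^sub>R g x))"
        using Suc.prems v by (intro C_diff_cong) (simp add: dir_deriv_scaleR smooth_differentiable)
      finally show ?thesis by (simp add: dir_deriv_def[abs_def])
    qed
    then show ?case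
      using Suc.prems by (simp add: differentiable_scaleR smooth_differentiable)
  qed
  then show ?thesis by (simp add: smooth_on_def)
qed

lemma smooth_on_mult:
  fixes f g :: "'e \<Rightarrow> real"
  assumes "smooth_on E V f" "smooth_on E V g"
  shows "smooth_on E V (\<lambda>x. f x * g x)"
  using smooth_on_scaleR[OF assms] by simp

lemma smooth_on_cmult:
  fixes f :: "'e \<Rightarrow> real"
  assumes "smooth_on E V f"
  shows "smooth_on E V (\<lambda>x. c * f x)"
  using smooth_on_mult[OF smooth_on_const assms] .

lemma smooth_on_bounded_linear:
  assumes "bounded_linear h" "smooth_on E V f"
  shows "smooth_on E V (\<lambda>x. h (f x))"
proof -
  have "C_diff E k V (\<lambda>x. h (f x))" for k
    using assms(2)
  proof (induction k arbitrary: f)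
    case 0
    then show ?case
      by (simp add: bounded_linear.continuous_on[OF assms(1)] smooth_continuous)
  next
    case (Suc k)
    have "C_diff E k V (\<lambda>x. frechet_derivative (\<lambda>x. h (f x)) (at x within V) v)" if v: "v \<in> E" for v
    proof -
      have "C_diff E k V (\<lambda>x. h (dir_deriv V v f x))"
        using Suc.prems v by (intro Suc.IH) (auto intro: smooth_on_dir_deriv)
      also have "?this \<longleftrightarrow> C_diff E k V (dir_deriv V v (\<lambda>x. h (f x)))"
        using Suc.prems v
        by (intro C_diff_cong) (simp add: dir_deriv_bounded_linear[OF assms(1)] smooth_differentiable)
      finally show ?thesis by (simp add: dir_deriv_def[abs_def])
    qed
    moreover have "(\<lambda>x. h (f x)) differentiable (at x within V)" if "x \<in> V" for x
      using differentiableI[OF bounded_linear.has_derivative[OF assms(1)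
            has_derivative_dir_deriv[OF smooth_differentiable[OF Suc.prems that]]]] .
    ultimately show ?case by simp
  qed
  then show ?thesis by (simp add: smooth_on_def)
qed

text \<open>Two applications of the mean value theorem to the second difference of \<open>f\<close> on a small square.\<close>

lemma second_difference:
  fixes f :: "'e \<Rightarrow> real"
  assumes f: "smooth_on E V f" and v: "v \<in> E" and w: "w \<in> E" and s: "0 < s"
    and sq: "\<And>a b. 0 \<le> a \<Longrightarrow> a \<le> s \<Longrightarrow> 0 \<le> b \<Longrightarrow> b \<le> s \<Longrightarrow> x + a *\<^sub>R v + b *\<^sub>R w \<in> V"
  obtains a b where "0 \<le> a" "a \<le> s" "0 \<le> b" "b \<le> s"
    "f (x + s *\<^sub>R v + s *\<^sub>R w) - f (x + s *\<^sub>R v) - f (x + s *\<^sub>R w) + f x =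
      s * s * dir_deriv V w (dir_deriv V v f) (x + a *\<^sub>R v + b *\<^sub>R w)"
proof -
  have ray: "((\<lambda>t. g (y + t *\<^sub>R u)) has_real_derivative dir_deriv V u g (y + t *\<^sub>R u)) (at t)"
    if "smooth_on E V g" "u \<in> E" "y + t *\<^sub>R u \<in> V" for g :: "'e \<Rightarrow> real" and u y t
  proof -
    have "((\<lambda>r. g ((y + t *\<^sub>R u) + r *\<^sub>R u)) has_vector_derivative dir_deriv V u g (y + t *\<^sub>R u)) (at 0)"
      using that by (intro has_derivative_ray has_derivative_dir_deriv smooth_differentiable)
    then have "((\<lambda>r. g (y + (t + r) *\<^sub>R u)) has_real_derivative dir_deriv V u g (y + t *\<^sub>R u)) (at 0)"
      by (simp add: has_real_derivative_iff_has_vector_derivative algebra_simps)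
    then show ?thesis
      using DERIV_shift[of "\<lambda>r. g (y + r *\<^sub>R u)" _ 0 t] by (simp add: add.commute)
  qed
  have 1: "((\<lambda>a. f (x + s *\<^sub>R w + a *\<^sub>R v) - f (x + a *\<^sub>R v)) has_real_derivative
      dir_deriv V v f (x + s *\<^sub>R w + a *\<^sub>R v) - dir_deriv V v f (x + a *\<^sub>R v)) (at a)"
    if "0 \<le> a" "a \<le> s" for a
    using that s sq[of a s] sq[of a 0] by (intro DERIV_diff ray f v) (auto simp: add_ac)
  obtain a where a: "0 < a" "a < s"
    "(f (x + s *\<^sub>R w + s *\<^sub>R v) - f (x + s *\<^sub>R v)) - (f (x + s *\<^sub>R w + 0 *\<^sub>R v) - f (x + 0 *\<^sub>R v)) =
      (s - 0) * (dir_deriv V v f (x + s *\<^sub>R w + a *\<^sub>R v) - dir_deriv V v f (x + a *\<^sub>R v))"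
    using MVT2[OF s 1] by blast
  have 2: "((\<lambda>b. dir_deriv V v f (x + a *\<^sub>R v + b *\<^sub>R w)) has_real_derivative
      dir_deriv V w (dir_deriv V v f) (x + a *\<^sub>R v + b *\<^sub>R w)) (at b)" if "0 \<le> b" "b \<le> s" for b
    using that a s sq[of a b] by (intro ray smooth_on_dir_deriv f v w) auto
  obtain b where b: "0 < b" "b < s"
    "dir_deriv V v f (x + a *\<^sub>R v + s *\<^sub>R w) - dir_deriv V v f (x + a *\<^sub>R v + 0 *\<^sub>R w) =
      (s - 0) * dir_deriv V w (dir_deriv V v f) (x + a *\<^sub>R v + b *\<^sub>R w)"
    using MVT2[OF s 2] by blast
  have "x + s *\<^sub>R w + a *\<^sub>R v = x + a *\<^sub>R v + s *\<^sub>R w" "x + s *\<^sub>R w + s *\<^sub>R v = x + s *\<^sub>R v + s *\<^sub>R w"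
    by (simp_all add: add_ac)
  with a b show ?thesis
    by (intro that[of a b]) (auto simp: algebra_simps)
qed

text \<open>On every small square the second difference is s^2 times either mixed derivative at some
  point of the square, by \<open>second_difference\<close> with the directions in both orders. The
  two functions thus agree at points arbitrarily close to \<open>x\<close>, and continuity forces
  equality at \<open>x\<close>.\<close>

lemma dir_deriv_commute_real:
  fixes f :: "'e \<Rightarrow> real"
  assumes f: "smooth_on E V f" and x: "x \<in> V" and v: "v \<in> E" and w: "w \<in> E"
  shows "dir_deriv V v (dir_deriv V w f) x = dir_deriv V w (dir_deriv V v f) x"
proof (rule ccontr)
  let ?g = "dir_deriv V v (dir_deriv V w f)" and ?h = "dir_deriv V w (dir_deriv V v f)"
  assume ne: "?g x \<noteq> ?h x"
  \<comment> \<open>Half the distance: a value within \<open>e\<close> of the first number cannot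
    equal one within \<open>e\<close> of the second.\<close>
  define e where "e = dist (?g x) (?h x) / 2"
  have e: "e > 0" using ne by (simp add: e_def)
  have "continuous_on V ?g" "continuous_on V ?h"
    by (intro smooth_continuous smooth_on_dir_deriv f v w)+
  then obtain d1 d2 where d: "d1 > 0" "d2 > 0"
    "\<And>y. y \<in> V \<Longrightarrow> dist y x < d1 \<Longrightarrow> dist (?g y) (?g x) < e"
    "\<And>y. y \<in> V \<Longrightarrow> dist y x < d2 \<Longrightarrow> dist (?h y) (?h x) < e"
    using x e unfolding continuous_on_iff by metis
  obtain r where r: "r > 0" "\<And>y. y \<in> E \<Longrightarrow> dist y x < r \<Longrightarrow> y \<in> V"
    using openin_V x unfolding openin_euclidean_subtopology_iff by metis
  define m where "m = min r (min d1 d2)"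
  \<comment> \<open>Points of the square are then within s * (norm v + norm w), at most m / 2, of
    \<open>x\<close>; the summand 1 keeps the denominator positive when both vectors are 0.\<close>
  define s where "s = m / (2 * (norm v + norm w + 1))"
  have m: "m > 0" using d r by (simp add: m_def)
  have s: "s > 0" unfolding s_def using m by (intro divide_pos_pos) (auto intro: add_nonneg_pos)
  have near: "x + a *\<^sub>R v + b *\<^sub>R w \<in> V \<and> dist (x + a *\<^sub>R v + b *\<^sub>R w) x < m"
    if "0 \<le> a" "a \<le> s" "0 \<le> b" "b \<le> s" for a b
  proof -
    have "norm (a *\<^sub>R v + b *\<^sub>R w) \<le> a * norm v + b * norm w"
      using that by (metis abs_of_nonneg norm_scaleR norm_triangle_ineq)
    also have "\<dots> \<le> s * norm v + s * norm w"
      using that by (intro add_mono mult_right_mono) auto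
    also have "\<dots> \<le> s * (norm v + norm w + 1)"
      using s by (simp add: algebra_simps)
    also have "\<dots> = m / 2"
      unfolding s_def using norm_ge_zero[of v] norm_ge_zero[of w] by (simp add: field_simps add_nonneg_eq_0_iff)
    also have "\<dots> < m" using m by simp
    finally have "dist (x + a *\<^sub>R v + b *\<^sub>R w) x < m"
      by (simp add: dist_norm add.assoc)
    moreover have "x + a *\<^sub>R v + b *\<^sub>R w \<in> E"
      using x v w V_subset subspace_E by (auto intro!: subspace_add subspace_scale)
    ultimately show ?thesis using r(2) by (auto simp: m_def)
  qed
  obtain a b where ab: "0 \<le> a" "a \<le> s" "0 \<le> b" "b \<le> s"
    "f (x + s *\<^sub>R v + s *\<^sub>R w) - f (x + s *\<^sub>R v) - f (x + s *\<^sub>R w) + f x = s * s * ?h (x + a *\<^sub>R v + b *\<^sub>R w)"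
    using second_difference[OF f v w s] near by metis
  have near': "x + a *\<^sub>R w + b *\<^sub>R v \<in> V" if "0 \<le> a" "a \<le> s" "0 \<le> b" "b \<le> s" for a b
    using near[of b a] that by (simp add: add_ac)
  obtain b' a' where ab': "0 \<le> b'" "b' \<le> s" "0 \<le> a'" "a' \<le> s"
    "f (x + s *\<^sub>R w + s *\<^sub>R v) - f (x + s *\<^sub>R w) - f (x + s *\<^sub>R v) + f x = s * s * ?g (x + b' *\<^sub>R w + a' *\<^sub>R v)"
    using second_difference[OF f w v s] near' by metis
  have eq: "x + s *\<^sub>R w + s *\<^sub>R v = x + s *\<^sub>R v + s *\<^sub>R w" "x + b' *\<^sub>R w + a' *\<^sub>R v = x + a' *\<^sub>R v + b' *\<^sub>R w"
    by (simp_all add: add_ac)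
  have "s * s * ?h (x + a *\<^sub>R v + b *\<^sub>R w) = s * s * ?g (x + a' *\<^sub>R v + b' *\<^sub>R w)"
    using ab(5) ab'(5) unfolding eq by linarith
  then have "?h (x + a *\<^sub>R v + b *\<^sub>R w) = ?g (x + a' *\<^sub>R v + b' *\<^sub>R w)"
    using s by simp
  moreover have "dist (?h (x + a *\<^sub>R v + b *\<^sub>R w)) (?h x) < e"
    using near[OF ab(1-4)] by (intro d(4)) (auto simp: m_def)
  moreover have "dist (?g (x + a' *\<^sub>R v + b' *\<^sub>R w)) (?g x) < e"
    using near[OF ab'(3,4,1,2)] by (intro d(3)) (auto simp: m_def)
  ultimately have "dist (?g x) (?h x) < dist (?g x) (?h x)"
    unfolding e_def by (metis dist_triangle_half_r)
  then show False by simp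
qed

text \<open>Inner products with the basis vectors reduce this to real functions. The vector-valued
  case is what transition maps need.\<close>

lemma dir_deriv_commute:
  fixes f :: "'e \<Rightarrow> 'b::euclidean_space"
  assumes f: "smooth_on E V f" and x: "x \<in> V" and v: "v \<in> E" and w: "w \<in> E"
  shows "dir_deriv V v (dir_deriv V w f) x = dir_deriv V w (dir_deriv V v f) x"
proof (rule euclidean_eqI)
  fix b :: 'b
  have bl: "bounded_linear (\<lambda>y. y \<bullet> b)" by (rule bounded_linear_inner_left)
  have *: "dir_deriv V u (dir_deriv V u' f) x \<bullet> b = dir_deriv V u (dir_deriv V u' (\<lambda>x. f x \<bullet> b)) x"
    if "u \<in> E" "u' \<in> E" for u u'
  proof -
    have "dir_deriv V u (dir_deriv V u' f) x \<bullet> b = dir_deriv V u (\<lambda>x. dir_deriv V u' f x \<bullet> b) x"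
      using f x that
      by (intro dir_deriv_bounded_linear[OF bl, symmetric]) (auto intro: smooth_differentiable smooth_on_dir_deriv)
    also have "\<dots> = dir_deriv V u (dir_deriv V u' (\<lambda>x. f x \<bullet> b)) x"
      using f x that
      by (intro dir_deriv_cong dir_deriv_bounded_linear[OF bl, symmetric]) (auto intro: smooth_differentiable)
    finally show ?thesis .
  qed
  show "dir_deriv V v (dir_deriv V w f) x \<bullet> b = dir_deriv V w (dir_deriv V v f) x \<bullet> b"
    unfolding *[OF v w] *[OF w v]
    by (intro dir_deriv_commute_real smooth_on_bounded_linear[OF bl] f x v w)
qed

end


section \<open>The signed shuffle product\<close>

text \<open>The wedge product at a fixed chart and point. Its arguments are arbitrary functions on
  lists, of mixed degree and neither multilinear nor alternating; the algebraic identities below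
  hold in this generality, so contractions may enter the inductions freely.\<close>

definition shuffle :: "('v list \<Rightarrow> real) \<Rightarrow> ('v list \<Rightarrow> real) \<Rightarrow> 'v list \<Rightarrow> real" where
  "shuffle \<alpha> \<beta> vs = (\<Sum>I\<in>Pow {..<length vs}. shuffle_sign I ({..<length vs} - I) *
     (\<alpha> (nths vs I) * \<beta> (nths vs ({..<length vs} - I))))"

definition contr :: "'v \<Rightarrow> ('v list \<Rightarrow> real) \<Rightarrow> 'v list \<Rightarrow> real" where
  "contr v \<alpha> = (\<lambda>vs. \<alpha> (v # vs))"

text \<open>The grading involution. It carries the sign of moving an odd symbol past a form of mixed
  degree.\<close>

definition alt_sign :: "('v list \<Rightarrow> real) \<Rightarrow> 'v list \<Rightarrow> real" where
  "alt_sign \<alpha> = (\<lambda>vs. (-1) ^ length vs * \<alpha> vs)"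

text \<open>A new smallest index in the front block creates no inversion, and shifting all other
  indices preserves inversions.\<close>

lemma shuffle_sign_Suc_left:
  "shuffle_sign (insert 0 (Suc ` I)) (Suc ` J) = shuffle_sign I J"
proof -
  have "{(i, j). i \<in> insert 0 (Suc ` I) \<and> j \<in> Suc ` J \<and> j < i} =
      map_prod Suc Suc ` {(i, j). i \<in> I \<and> j \<in> J \<and> j < i}"
    by (auto simp: image_iff)
  moreover have "inj_on (map_prod Suc Suc) A" for A
    by (auto simp: inj_on_def)
  ultimately show ?thesis by (simp add: shuffle_sign_def card_image)
qed

text \<open>A new smallest index in the back block is inverted with every element of
  \<open>I\<close>, which adds \<open>card I\<close> inversions.\<close>

lemma shuffle_sign_Suc_right:
  assumes "finite I" "finite J"
  shows "shuffle_sign (Suc ` I) (insert 0 (Suc ` J)) = (-1) ^ card I * shuffle_sign I J"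
proof -
  let ?A = "{(i, j). i \<in> I \<and> j \<in> J \<and> j < i}"
  have "{(i, j). i \<in> Suc ` I \<and> j \<in> insert 0 (Suc ` J) \<and> j < i} =
      (\<lambda>i. (Suc i, 0)) ` I \<union> map_prod Suc Suc ` ?A"
    by (auto simp: image_iff)
  moreover have "card ((\<lambda>i. (Suc i, 0::nat)) ` I \<union> map_prod Suc Suc ` ?A) = card I + card ?A"
  proof (subst card_Un_disjoint)
    have "finite ?A" by (rule finite_subset[of _ "I \<times> J"]) (use assms in auto)
    then show "finite (map_prod Suc Suc ` ?A)" by simp
    show "finite ((\<lambda>i. (Suc i, 0::nat)) ` I)" using assms by simp
    show "(\<lambda>i. (Suc i, 0)) ` I \<inter> map_prod Suc Suc ` ?A = {}" by auto
    have "card ((\<lambda>i. (Suc i, 0::nat)) ` I) = card I"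
      by (intro card_image) (simp add: inj_on_def)
    moreover have "card (map_prod Suc Suc ` ?A) = card ?A"
      by (intro card_image) (auto simp: inj_on_def)
    ultimately show "card ((\<lambda>i. (Suc i, 0::nat)) ` I) + card (map_prod Suc Suc ` ?A) = card I + card ?A"
      by simp
  qed
  ultimately show ?thesis by (simp add: shuffle_sign_def power_add)
qed

lemma shuffle_Nil [simp]: "shuffle \<alpha> \<beta> [] = \<alpha> [] * \<beta> []"
  by (simp add: shuffle_def shuffle_sign_def)

text \<open>The index sets split by whether they contain 0. If so, \<open>v\<close> becomes the
  first argument of \<alpha>; otherwise it becomes the first argument of \<beta>, and the sign for
  passing the arguments of \<alpha> is absorbed into \<open>alt_sign \<alpha>\<close>.\<close>

lemma shuffle_Cons:
  "shuffle \<alpha> \<beta> (v # vs) = shuffle (contr v \<alpha>) \<beta> vs + shuffle (alt_sign \<alpha>) (contr v \<beta>) vs"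
proof -
  let ?N = "{..<length vs}"
  let ?f = "\<lambda>I. shuffle_sign I ({..<length (v # vs)} - I) *
     (\<alpha> (nths (v # vs) I) * \<beta> (nths (v # vs) ({..<length (v # vs)} - I)))"
  have N: "{..<length (v # vs)} = insert 0 (Suc ` ?N)"
    by (simp add: lessThan_Suc_eq_insert_0)
  have P: "Pow (insert 0 (Suc ` ?N)) = (`) Suc ` Pow ?N \<union> (\<lambda>I. insert 0 (Suc ` I)) ` Pow ?N"
    unfolding Pow_insert image_Pow_surj[OF refl, of Suc ?N, symmetric] image_image ..
  have n0: "nths (v # vs) (insert 0 (Suc ` I)) = v # nths vs I" for I
    by (simp add: nths_Cons inj_image_mem_iff)
  have n1: "nths (v # vs) (Suc ` I) = nths vs I" for I
    by (simp add: nths_Cons inj_image_mem_iff)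
  have d0: "insert 0 (Suc ` ?N) - insert 0 (Suc ` I) = Suc ` (?N - I)" for I by auto
  have d1: "insert 0 (Suc ` ?N) - Suc ` I = insert 0 (Suc ` (?N - I))" for I by auto
  have "shuffle \<alpha> \<beta> (v # vs) = (\<Sum>I\<in>(`) Suc ` Pow ?N \<union> (\<lambda>I. insert 0 (Suc ` I)) ` Pow ?N. ?f I)"
    unfolding shuffle_def N P ..
  also have "\<dots> = (\<Sum>I\<in>(`) Suc ` Pow ?N. ?f I) + (\<Sum>I\<in>(\<lambda>I. insert 0 (Suc ` I)) ` Pow ?N. ?f I)"
    by (intro sum.union_disjoint) auto
  also have "(\<Sum>I\<in>(`) Suc ` Pow ?N. ?f I) = (\<Sum>I\<in>Pow ?N. ?f (Suc ` I))"
    by (subst sum.reindex) (auto simp: inj_on_def inj_image_eq_iff)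
  also have "\<dots> = shuffle (alt_sign \<alpha>) (contr v \<beta>) vs"
    unfolding shuffle_def
  proof (rule sum.cong[OF refl])
    fix I assume "I \<in> Pow ?N"
    then have I: "I \<subseteq> ?N" by simp
    then have "{i. i < length vs \<and> i \<in> I} = I" by auto
    \<comment> \<open>The extra inversions counted by \<open>card I\<close> are exactly the degree
      that \<open>alt_sign\<close> sees.\<close>
    then have "length (nths vs I) = card I" by (simp add: length_nths)
    then show "?f (Suc ` I) = shuffle_sign I (?N - I) *
        (alt_sign \<alpha> (nths vs I) * contr v \<beta> (nths vs (?N - I)))"
      using finite_subset[OF I] unfolding N d1 n0 n1
      by (subst shuffle_sign_Suc_right) (simp_all add: alt_sign_def contr_def)
  qed
  also have "(\<Sum>I\<in>(\<lambda>I. insert 0 (Suc ` I)) ` Pow ?N. ?f I) = (\<Sum>I\<in>Pow ?N. ?f (insert 0 (Suc ` I)))"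
  proof (subst sum.reindex)
    show "inj_on (\<lambda>I. insert 0 (Suc ` I)) (Pow ?N)"
    proof (rule inj_onI)
      fix I J assume "insert 0 (Suc ` I) = insert 0 (Suc ` J)"
      then have "Suc ` I = Suc ` J"
        by (metis Diff_insert_absorb imageE nat.distinct(1))
      then show "I = J" by (simp add: inj_image_eq_iff)
    qed
  qed simp
  also have "\<dots> = shuffle (contr v \<alpha>) \<beta> vs"
    unfolding shuffle_def N d0 n0 n1 shuffle_sign_Suc_left by (simp add: contr_def)
  finally show ?thesis by simp
qed

lemma shuffle_cong:
  assumes "set vs \<subseteq> S" "\<And>us. set us \<subseteq> S \<Longrightarrow> \<alpha> us = \<alpha>' us" "\<And>us. set us \<subseteq> S \<Longrightarrow> \<beta> us = \<beta>' us"
  shows "shuffle \<alpha> \<beta> vs = shuffle \<alpha>' \<beta>' vs"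
  unfolding shuffle_def using assms(1)
  by (intro sum.cong refl arg_cong2[where f = "(*)"] assms(2,3)) (meson order_trans set_nths_subset)+

lemma shuffle_add_left: "shuffle (\<lambda>vs. \<alpha> vs + \<alpha>' vs) \<beta> vs = shuffle \<alpha> \<beta> vs + shuffle \<alpha>' \<beta> vs"
  and shuffle_add_right: "shuffle \<alpha> (\<lambda>vs. \<beta> vs + \<beta>' vs) vs = shuffle \<alpha> \<beta> vs + shuffle \<alpha> \<beta>' vs"
  by (simp_all add: shuffle_def sum.distrib distrib_left distrib_right)

lemma shuffle_scale_left: "shuffle (\<lambda>vs. c * \<alpha> vs) \<beta> vs = c * shuffle \<alpha> \<beta> vs"
  and shuffle_scale_right: "shuffle \<alpha> (\<lambda>vs. c * \<beta> vs) vs = c * shuffle \<alpha> \<beta> vs"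
  by (simp_all add: shuffle_def sum_distrib_left mult_ac)

lemma shuffle_minus_left: "shuffle (\<lambda>vs. - \<alpha> vs) \<beta> vs = - shuffle \<alpha> \<beta> vs"
  and shuffle_minus_right: "shuffle \<alpha> (\<lambda>vs. - \<beta> vs) vs = - shuffle \<alpha> \<beta> vs"
  by (simp_all add: shuffle_def sum_negf)

lemma shuffle_diff_left: "shuffle (\<lambda>vs. \<alpha> vs - \<alpha>' vs) \<beta> vs = shuffle \<alpha> \<beta> vs - shuffle \<alpha>' \<beta> vs"
  and shuffle_diff_right: "shuffle \<alpha> (\<lambda>vs. \<beta> vs - \<beta>' vs) vs = shuffle \<alpha> \<beta> vs - shuffle \<alpha> \<beta>' vs"
  by (simp_all add: shuffle_def sum_subtractf left_diff_distrib right_diff_distrib)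

lemma shuffle_zero_left: "shuffle (\<lambda>vs. 0) \<beta> vs = 0"
  and shuffle_zero_right: "shuffle \<alpha> (\<lambda>vs. 0) vs = 0"
  by (simp_all add: shuffle_def)

section \<open>Parity, associativity and graded commutativity\<close>

lemma alt_sign_alt_sign [simp]: "alt_sign (alt_sign \<alpha>) = \<alpha>"
  by (simp add: alt_sign_def fun_eq_iff flip: mult.assoc power_add)

lemma contr_alt_sign: "contr v (alt_sign \<alpha>) = (\<lambda>vs. - alt_sign (contr v \<alpha>) vs)"
  by (simp add: contr_def alt_sign_def)

lemma contr_shuffle: "contr v (shuffle \<alpha> \<beta>) = (\<lambda>vs. shuffle (contr v \<alpha>) \<beta> vs + shuffle (alt_sign \<alpha>) (contr v \<beta>) vs)"
  by (simp add: contr_def[of v "shuffle \<alpha> \<beta>"] shuffle_Cons)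

lemma alt_sign_shuffle: "alt_sign (shuffle \<alpha> \<beta>) vs = shuffle (alt_sign \<alpha>) (alt_sign \<beta>) vs"
proof (induction vs arbitrary: \<alpha> \<beta>)
  case (Cons v vs)
  have "alt_sign (shuffle \<alpha> \<beta>) (v # vs) =
      - (alt_sign (shuffle (contr v \<alpha>) \<beta>) vs + alt_sign (shuffle (alt_sign \<alpha>) (contr v \<beta>)) vs)"
    by (simp add: alt_sign_def shuffle_Cons distrib_left)
  also have "\<dots> = shuffle (alt_sign \<alpha>) (alt_sign \<beta>) (v # vs)"
    by (simp add: Cons.IH shuffle_Cons contr_alt_sign shuffle_minus_left shuffle_minus_right)
  finally show ?case .
qed (simp add: alt_sign_def)

text \<open>Contraction with \<open>v\<close> turns each side into three terms, with
  \<open>v\<close> going into \<alpha>, \<beta> or \<gamma>. They match by the induction hypothesis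
  once the involution of a product is split into the product of the involutions.\<close>

lemma shuffle_assoc: "shuffle (shuffle \<alpha> \<beta>) \<gamma> vs = shuffle \<alpha> (shuffle \<beta> \<gamma>) vs"
proof (induction vs arbitrary: \<alpha> \<beta> \<gamma>)
  case (Cons v vs)
  have "alt_sign (shuffle \<alpha> \<beta>) = shuffle (alt_sign \<alpha>) (alt_sign \<beta>)"
    by (simp add: alt_sign_shuffle fun_eq_iff)
  then show ?case
    by (simp add: shuffle_Cons contr_shuffle shuffle_add_left shuffle_add_right Cons.IH)
qed simp

text \<open>The even and the odd case are proved together, because contracting \<alpha> changes its
  parity and so each case calls on the other. In the odd case the involution on \<beta> supplies the
  sign (-1)^deg \<beta>.\<close>

lemma shuffle_commute:
  shows "alt_sign \<alpha> = \<alpha> \<Longrightarrow> shuffle \<alpha> \<beta> vs = shuffle \<beta> \<alpha> vs"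
    and "alt_sign \<alpha> = (\<lambda>vs. - \<alpha> vs) \<Longrightarrow> shuffle \<alpha> \<beta> vs = shuffle (alt_sign \<beta>) \<alpha> vs"
proof (induction vs arbitrary: \<alpha> \<beta>)
  case Nil
  {
    case 1
    then show ?case by simp
  next
    case 2
    then show ?case by (simp add: alt_sign_def)
  }
next
  case (Cons v vs)
  {
    case 1
    have h: "contr v \<alpha> = (\<lambda>vs. - alt_sign (contr v \<alpha>) vs)"
      using contr_alt_sign[of v \<alpha>] unfolding 1 .
    have "alt_sign (contr v \<alpha>) = (\<lambda>vs. - contr v \<alpha> vs)"
    proof (rule ext)
      fix us show "alt_sign (contr v \<alpha>) us = - contr v \<alpha> us"
        using fun_cong[OF h, of us] by linarith
    qed
    with 1 show ?case
      by (simp add: shuffle_Cons Cons.IH(1)[of \<alpha> "contr v \<beta>"] Cons.IH(2)[of "contr v \<alpha>" \<beta>])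
  next
    case 2
    have h: "contr v (\<lambda>vs. - \<alpha> vs) = (\<lambda>vs. - alt_sign (contr v \<alpha>) vs)"
      using contr_alt_sign[of v \<alpha>] unfolding 2 .
    have "alt_sign (contr v \<alpha>) = contr v \<alpha>"
    proof (rule ext)
      fix us show "alt_sign (contr v \<alpha>) us = contr v \<alpha> us"
        using fun_cong[OF h, of us] by (simp add: contr_def)
    qed
    with 2 have "shuffle \<alpha> \<beta> (v # vs) = shuffle \<beta> (contr v \<alpha>) vs - shuffle (alt_sign (contr v \<beta>)) \<alpha> vs"
      by (simp add: shuffle_Cons Cons.IH(1)[of "contr v \<alpha>"] shuffle_minus_left Cons.IH(2)[of \<alpha>])
    also have "\<dots> = shuffle (alt_sign \<beta>) \<alpha> (v # vs)"
      by (simp add: shuffle_Cons contr_alt_sign shuffle_minus_left)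
    finally show ?case .
  }
qed


section \<open>Alternating multilinear forms\<close>

definition multilinear :: "'e::real_vector set \<Rightarrow> ('e list \<Rightarrow> real) \<Rightarrow> bool" where
  "multilinear E \<alpha> \<longleftrightarrow> (\<forall>us ws. \<forall>u\<in>E. \<forall>v\<in>E. \<forall>r s. set us \<subseteq> E \<longrightarrow> set ws \<subseteq> E \<longrightarrow>
     \<alpha> (us @ (r *\<^sub>R u + s *\<^sub>R v) # ws) = r * \<alpha> (us @ u # ws) + s * \<alpha> (us @ v # ws))"

definition alt :: "'e set \<Rightarrow> ('e list \<Rightarrow> real) \<Rightarrow> bool" where
  "alt E \<alpha> \<longleftrightarrow> (\<forall>vs. set vs \<subseteq> E \<longrightarrow> \<not> distinct vs \<longrightarrow> \<alpha> vs = 0)"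

text \<open>The version of alternation that suits inductions over lists: the arguments in front of
  the equal pair are contracted away one by one until the pair heads the list. For multilinear
  functions on a subspace it amounts to \<open>alt\<close>.\<close>

definition adj_alt :: "'e set \<Rightarrow> ('e list \<Rightarrow> real) \<Rightarrow> bool" where
  "adj_alt E \<alpha> \<longleftrightarrow> (\<forall>us v ws. set us \<subseteq> E \<longrightarrow> v \<in> E \<longrightarrow> set ws \<subseteq> E \<longrightarrow> \<alpha> (us @ v # v # ws) = 0)"

lemma multilinearD:
  assumes "multilinear E \<alpha>" "u \<in> E" "v \<in> E" "set us \<subseteq> E" "set ws \<subseteq> E"
  shows "\<alpha> (us @ (r *\<^sub>R u + s *\<^sub>R v) # ws) = r * \<alpha> (us @ u # ws) + s * \<alpha> (us @ v # ws)"
  using assms unfolding multilinear_def by blast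

lemma multilinearI:
  assumes "\<And>us ws u v r s. set us \<subseteq> E \<Longrightarrow> set ws \<subseteq> E \<Longrightarrow> u \<in> E \<Longrightarrow> v \<in> E \<Longrightarrow>
     \<alpha> (us @ (r *\<^sub>R u + s *\<^sub>R v) # ws) = r * \<alpha> (us @ u # ws) + s * \<alpha> (us @ v # ws)"
  shows "multilinear E \<alpha>"
  using assms unfolding multilinear_def by blast

lemma adj_altD:
  assumes "adj_alt E \<alpha>" "v \<in> E" "set us \<subseteq> E" "set ws \<subseteq> E"
  shows "\<alpha> (us @ v # v # ws) = 0"
  using assms unfolding adj_alt_def by blast

lemma multilinear_contr: "multilinear E \<alpha> \<Longrightarrow> v \<in> E \<Longrightarrow> multilinear E (contr v \<alpha>)"
proof (rule multilinearI)
  fix us ws :: "'a list" and u w r s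
  assume "multilinear E \<alpha>" "v \<in> E" "set us \<subseteq> E" "set ws \<subseteq> E" "u \<in> E" "w \<in> E"
  then show "contr v \<alpha> (us @ (r *\<^sub>R u + s *\<^sub>R w) # ws) =
      r * contr v \<alpha> (us @ u # ws) + s * contr v \<alpha> (us @ w # ws)"
    using multilinearD[of E \<alpha> u w "v # us" ws r s] by (simp add: contr_def)
qed

lemma multilinear_alt_sign: "multilinear E \<alpha> \<Longrightarrow> multilinear E (alt_sign \<alpha>)"
  by (rule multilinearI) (simp add: alt_sign_def multilinearD algebra_simps)

lemma adj_alt_contr: "adj_alt E \<alpha> \<Longrightarrow> v \<in> E \<Longrightarrow> adj_alt E (contr v \<alpha>)"
  unfolding adj_alt_def contr_def by (metis append_Cons insert_subset list.simps(15))

lemma adj_alt_alt_sign: "adj_alt E \<alpha> \<Longrightarrow> adj_alt E (alt_sign \<alpha>)"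
  unfolding adj_alt_def alt_sign_def by simp

lemma alt_contr: "alt E \<alpha> \<Longrightarrow> v \<in> E \<Longrightarrow> alt E (contr v \<alpha>)"
  unfolding alt_def contr_def by simp

lemma multilinear_sum:
  assumes "multilinear E \<alpha>" "subspace E" "finite B" "B \<subseteq> E" "set us \<subseteq> E" "set ws \<subseteq> E"
  shows "\<alpha> (us @ (\<Sum>b\<in>B. c b *\<^sub>R b) # ws) = (\<Sum>b\<in>B. c b * \<alpha> (us @ b # ws))"
  using assms(3,4)
proof (induction B rule: finite_induct)
  case empty
  \<comment> \<open>Linearity with both coefficients 0 says that the value at the zero vector is
    0.\<close>
  show ?case
    using multilinearD[OF assms(1) subspace_0[OF assms(2)] subspace_0[OF assms(2)] assms(5,6), of 0 0] by simp
next
  case (insert b B)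
  then have "(\<Sum>b\<in>B. c b *\<^sub>R b) \<in> E"
    using assms(2) by (intro subspace_sum subspace_scale) auto
  then show ?case
    using insert multilinearD[OF assms(1), of b "\<Sum>b\<in>B. c b *\<^sub>R b" us ws "c b" 1] assms(5,6) by simp
qed

text \<open>Polarization: expand the value on the repeated argument \<open>u + v\<close> and drop
  the terms with a repeated \<open>u\<close> or \<open>v\<close>.\<close>

lemma swap_adjacent:
  assumes "multilinear E \<alpha>" "adj_alt E \<alpha>" "subspace E" "u \<in> E" "v \<in> E" "set us \<subseteq> E" "set ws \<subseteq> E"
  shows "\<alpha> (us @ u # v # ws) = - \<alpha> (us @ v # u # ws)"
proof -
  have uv: "u + v \<in> E" using assms by (simp add: subspace_add)
  have 1: "\<alpha> (us @ (u + v) # x # ws) = \<alpha> (us @ u # x # ws) + \<alpha> (us @ v # x # ws)" if "x \<in> E" for x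
    using multilinearD[OF assms(1,4,5,6), of "x # ws" 1 1] assms that by simp
  have 2: "\<alpha> (us @ x # (u + v) # ws) = \<alpha> (us @ x # u # ws) + \<alpha> (us @ x # v # ws)" if "x \<in> E" for x
    using multilinearD[OF assms(1,4,5) _ assms(7), of "us @ [x]" 1 1] assms that by simp
  have 0: "\<alpha> (us @ x # x # ws) = 0" if "x \<in> E" for x
    using assms that unfolding adj_alt_def by simp
  show ?thesis
    using 0[OF uv] 0[OF assms(4)] 0[OF assms(5)] 1[OF uv] 2[OF assms(4)] 2[OF assms(5)] by linarith
qed

lemma move_right:
  assumes "multilinear E \<alpha>" "adj_alt E \<alpha>" "subspace E" "v \<in> E" "set us \<subseteq> E" "set bs \<subseteq> E" "set ws \<subseteq> E"
  shows "\<alpha> (us @ v # bs @ ws) = (-1) ^ length bs * \<alpha> (us @ bs @ v # ws)"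
  using assms(5,6)
proof (induction bs arbitrary: us)
  case (Cons b bs)
  then have "\<alpha> (us @ v # b # bs @ ws) = - \<alpha> ((us @ [b]) @ v # bs @ ws)"
    using swap_adjacent[OF assms(1-4), of b us "bs @ ws"] assms(7) by simp
  also have "\<alpha> ((us @ [b]) @ v # bs @ ws) = (-1) ^ length bs * \<alpha> ((us @ [b]) @ bs @ v # ws)"
    using Cons.prems by (intro Cons.IH) auto
  finally show ?case by simp
qed simp

text \<open>Moving the first of two equal arguments next to the second costs only a sign.\<close>

lemma alt_if_adj_alt:
  assumes "multilinear E \<alpha>" "adj_alt E \<alpha>" "subspace E"
  shows "alt E \<alpha>"
  unfolding alt_def
proof (intro allI impI)
  fix vs assume vs: "set vs \<subseteq> E" "\<not> distinct vs"
  then obtain xs ys zs y where eq: "vs = xs @ [y] @ ys @ [y] @ zs"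
    using not_distinct_decomp by blast
  have "\<alpha> vs = (-1) ^ length ys * \<alpha> (xs @ ys @ y # y # zs)"
    using move_right[OF assms, of y xs ys "y # zs"] vs(1) by (simp add: eq)
  also have "\<alpha> (xs @ ys @ y # y # zs) = \<alpha> ((xs @ ys) @ y # y # zs)" by simp
  also have "\<dots> = 0"
    using vs(1) by (intro adj_altD[OF assms(2)]) (auto simp: eq)
  finally show "\<alpha> vs = 0" by simp
qed

lemma adj_alt_if_alt: "alt E \<alpha> \<Longrightarrow> adj_alt E \<alpha>"
  unfolding alt_def adj_alt_def by simp

text \<open>The sign counts the \<open>j\<close> transpositions that carry the new entry to the
  front. Naturality uses this to compare the derivative of a field in slot \<open>j\<close> with one
  in the first slot.\<close>

lemma list_update_to_front:
  assumes "multilinear E \<alpha>" "alt E \<alpha>" "subspace E" "w \<in> E" "set ws \<subseteq> E" "j < length ws"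
  shows "\<alpha> (ws[j := w]) = (-1) ^ j * \<alpha> (w # take j ws @ drop (Suc j) ws)"
proof -
  have "set (take j ws) \<subseteq> E" "set (drop (Suc j) ws) \<subseteq> E"
    using assms(5) set_take_subset[of j ws] set_drop_subset[of "Suc j" ws] by blast+
  then have "\<alpha> (w # take j ws @ drop (Suc j) ws) = (-1) ^ j * \<alpha> (take j ws @ w # drop (Suc j) ws)"
    using move_right[OF assms(1) adj_alt_if_alt[OF assms(2)] assms(3,4), of "[]" "take j ws" "drop (Suc j) ws"]
      assms(6) by simp
  then show ?thesis
    using assms(6) by (simp add: upd_conv_take_nth_drop flip: mult.assoc power_add)
qed

text \<open>Contraction removes the arguments in front of the varying slot, with the factors
  generalized. When that slot comes first, it enters \<alpha> or \<beta> linearly.\<close>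

lemma multilinear_shuffle:
  assumes "multilinear E \<alpha>" "multilinear E \<beta>"
  shows "multilinear E (shuffle \<alpha> \<beta>)"
proof (rule multilinearI)
  fix us ws :: "'a list" and u v :: 'a and r s :: real
  assume us: "set us \<subseteq> E" and ws: "set ws \<subseteq> E" and uv: "u \<in> E" "v \<in> E"
  show "shuffle \<alpha> \<beta> (us @ (r *\<^sub>R u + s *\<^sub>R v) # ws) = r * shuffle \<alpha> \<beta> (us @ u # ws) + s * shuffle \<alpha> \<beta> (us @ v # ws)"
    using us assms
  proof (induction us arbitrary: \<alpha> \<beta>)
    case Nil
    have c: "contr (r *\<^sub>R u + s *\<^sub>R v) \<gamma> xs = r * contr u \<gamma> xs + s * contr v \<gamma> xs"
      if "multilinear E \<gamma>" "set xs \<subseteq> E" for \<gamma> xs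
      using multilinearD[OF that(1) uv, of "[]" xs] that(2) by (simp add: contr_def)
    have "shuffle (contr (r *\<^sub>R u + s *\<^sub>R v) \<alpha>) \<beta> ws = shuffle (\<lambda>xs. r * contr u \<alpha> xs + s * contr v \<alpha> xs) \<beta> ws"
      by (rule shuffle_cong[OF ws]) (simp_all add: c Nil.prems)
    moreover have "shuffle (alt_sign \<alpha>) (contr (r *\<^sub>R u + s *\<^sub>R v) \<beta>) ws =
        shuffle (alt_sign \<alpha>) (\<lambda>xs. r * contr u \<beta> xs + s * contr v \<beta> xs) ws"
      by (rule shuffle_cong[OF ws]) (simp_all add: c Nil.prems)
    ultimately show ?case
      by (simp add: shuffle_Cons shuffle_add_left shuffle_add_right shuffle_scale_left shuffle_scale_right algebra_simps)
  next
    case (Cons x us)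
    then show ?case
      by (simp add: shuffle_Cons multilinear_contr multilinear_alt_sign algebra_simps)
  qed
qed

text \<open>With the equal pair in front, two contractions produce four terms. A double contraction
  of one factor vanishes, and the two mixed terms cancel because contraction anticommutes with the
  involution.\<close>

lemma adj_alt_shuffle:
  assumes "adj_alt E \<alpha>" "adj_alt E \<beta>"
  shows "adj_alt E (shuffle \<alpha> \<beta>)"
  unfolding adj_alt_def
proof (intro allI impI)
  fix us ws v
  assume us: "set us \<subseteq> E" and v: "v \<in> E" and ws: "set ws \<subseteq> E"
  show "shuffle \<alpha> \<beta> (us @ v # v # ws) = 0"
    using us assms
  proof (induction us arbitrary: \<alpha> \<beta>)
    case Nil
    have "contr v (contr v \<gamma>) xs = 0" if "adj_alt E \<gamma>" "set xs \<subseteq> E" for \<gamma> xs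
      using that v unfolding adj_alt_def contr_def by (metis append_Nil empty_set empty_subsetI)
    then have "shuffle (contr v (contr v \<alpha>)) \<beta> ws = shuffle (\<lambda>_. 0) \<beta> ws" "shuffle \<alpha> (contr v (contr v \<beta>)) ws = shuffle \<alpha> (\<lambda>_. 0) ws"
      using Nil.prems by (auto intro!: shuffle_cong[OF ws])
    then show ?case
      by (simp add: shuffle_Cons contr_alt_sign shuffle_minus_left shuffle_zero_left shuffle_zero_right)
  next
    case (Cons x us)
    then show ?case
      by (simp add: shuffle_Cons adj_alt_contr adj_alt_alt_sign)
  qed
qed

lemma alt_shuffle:
  assumes "multilinear E \<alpha>" "multilinear E \<beta>" "alt E \<alpha>" "alt E \<beta>" "subspace E"
  shows "alt E (shuffle \<alpha> \<beta>)"
  by (rule alt_if_adj_alt[OF multilinear_shuffle[OF assms(1,2)] adj_alt_shuffle[OF adj_alt_if_alt adj_alt_if_alt] assms(5)]) fact+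

text \<open>Distinct arguments beyond the dimension are dependent. Expressing one of them through
  the others gives a sum whose terms all repeat an argument.\<close>

lemma alt_vanish_above_dim:
  fixes E :: "'e::euclidean_space set"
  assumes "multilinear E \<alpha>" "alt E \<alpha>" "subspace E" "set vs \<subseteq> E" "dim E < length vs"
  shows "\<alpha> vs = 0"
proof (cases "distinct vs")
  case True
  have "dependent (set vs)"
    using assms(4,5) distinct_card[OF True] independent_card_le_dim[of "set vs" E] by linarith
  then obtain v where v: "v \<in> set vs" "v \<in> span (set vs - {v})"
    unfolding dependent_def by blast
  then obtain c where c: "v = (\<Sum>b\<in>set vs - {v}. c b *\<^sub>R b)"
    by (auto simp: span_finite)
  obtain us ws where eq: "vs = us @ v # ws"
    using v(1) by (meson split_list)
  have "\<alpha> vs = \<alpha> (us @ (\<Sum>b\<in>set vs - {v}. c b *\<^sub>R b) # ws)"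
    using c eq by simp
  also have "\<dots> = (\<Sum>b\<in>set vs - {v}. c b * \<alpha> (us @ b # ws))"
    using assms(4) by (intro multilinear_sum[OF assms(1,3)]) (auto simp: eq)
  also have "\<dots> = 0"
  proof (intro sum.neutral ballI)
    fix b assume b: "b \<in> set vs - {v}"
    then have "\<not> distinct (us @ b # ws)" "set (us @ b # ws) \<subseteq> E"
      using assms(4) by (auto simp: eq)
    then show "c b * \<alpha> (us @ b # ws) = 0"
      using assms(2) unfolding alt_def by simp
  qed
  finally show ?thesis .
qed (use assms in \<open>simp add: alt_def\<close>)


section \<open>The de Rham differential in an open subset of a linear space\<close>

text \<open>The formula of \<open>deRham\<close> in the coordinates of one chart, freed from support
  conditions. It then also applies to contractions with constant vectors, which are not
  chart-independent forms.\<close>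

definition dloc :: "'e::euclidean_space set \<Rightarrow> ('e \<Rightarrow> 'e list \<Rightarrow> real) \<Rightarrow> 'e \<Rightarrow> 'e list \<Rightarrow> real" where
  "dloc V \<phi> x vs = (\<Sum>i<length vs. (-1) ^ i *
     dir_deriv V (vs ! i) (\<lambda>y. \<phi> y (take i vs @ drop (Suc i) vs)) x)"

text \<open>Only smoothness is demanded, neither linearity nor alternation, so that the class is
  closed under contraction, directional derivative and the involution.\<close>

definition smooth_coeffs :: "'e::euclidean_space set \<Rightarrow> 'e set \<Rightarrow> ('e \<Rightarrow> 'e list \<Rightarrow> real) \<Rightarrow> bool" where
  "smooth_coeffs E V \<phi> \<longleftrightarrow> (\<forall>vs. set vs \<subseteq> E \<longrightarrow> smooth_on E V (\<lambda>x. \<phi> x vs))"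

definition contr_form :: "'e::euclidean_space \<Rightarrow> ('e \<Rightarrow> 'e list \<Rightarrow> real) \<Rightarrow> 'e \<Rightarrow> 'e list \<Rightarrow> real" where
  "contr_form v \<phi> = (\<lambda>x. contr v (\<phi> x))"

text \<open>The Lie derivative along the constant field \<open>v\<close>: only the coefficients are
  differentiated.\<close>

definition deriv_form :: "'e::euclidean_space set \<Rightarrow> 'e \<Rightarrow> ('e \<Rightarrow> 'e list \<Rightarrow> real) \<Rightarrow> 'e \<Rightarrow> 'e list \<Rightarrow> real" where
  "deriv_form V v \<phi> = (\<lambda>x vs. dir_deriv V v (\<lambda>y. \<phi> y vs) x)"

lemma dloc_Nil [simp]: "dloc V \<phi> x [] = 0"
  by (simp add: dloc_def)

text \<open>The summand of index 0 differentiates along \<open>v\<close>; in the others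
  \<open>v\<close> stays as first argument, and the index shift reverses the signs. This is Cartan's
  formula for a constant field.\<close>

lemma dloc_Cons: "dloc V \<phi> x (v # vs) = deriv_form V v \<phi> x vs - dloc V (contr_form v \<phi>) x vs"
  by (simp add: dloc_def sum.lessThan_Suc_shift deriv_form_def contr_form_def contr_def del: sum.lessThan_Suc flip: sum_negf)

lemma contr_form_dloc: "contr_form v (dloc V \<phi>) = (\<lambda>x vs. deriv_form V v \<phi> x vs - dloc V (contr_form v \<phi>) x vs)"
  by (simp add: contr_form_def[of v "dloc V \<phi>"] contr_def dloc_Cons)

lemma contr_form_deriv_form: "contr_form w (deriv_form V v \<phi>) = deriv_form V v (contr_form w \<phi>)"
  by (simp add: contr_form_def deriv_form_def contr_def)

lemma smooth_coeffsD: "smooth_coeffs E V \<phi> \<Longrightarrow> set vs \<subseteq> E \<Longrightarrow> smooth_on E V (\<lambda>x. \<phi> x vs)"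
  by (simp add: smooth_coeffs_def)

lemma smooth_coeffs_contr_form: "smooth_coeffs E V \<phi> \<Longrightarrow> v \<in> E \<Longrightarrow> smooth_coeffs E V (contr_form v \<phi>)"
  by (simp add: smooth_coeffs_def contr_form_def contr_def)

lemma smooth_coeffs_deriv_form: "smooth_coeffs E V \<phi> \<Longrightarrow> v \<in> E \<Longrightarrow> smooth_coeffs E V (deriv_form V v \<phi>)"
  by (simp add: smooth_coeffs_def deriv_form_def smooth_on_dir_deriv)

context open_in_subspace
begin

lemma dir_deriv_diff:
  assumes "f differentiable (at x within V)" "g differentiable (at x within V)" "x \<in> V" "v \<in> E"
  shows "dir_deriv V v (\<lambda>x. f x - g x) x = dir_deriv V v f x - dir_deriv V v g x"
  using assms
  by (intro dir_deriv_eqI[where f' = "\<lambda>v. dir_deriv V v f x - dir_deriv V v g x"]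
      has_derivative_diff has_derivative_dir_deriv)

lemma smooth_coeffs_differentiable:
  "smooth_coeffs E V \<phi> \<Longrightarrow> set vs \<subseteq> E \<Longrightarrow> x \<in> V \<Longrightarrow> (\<lambda>x. \<phi> x vs) differentiable (at x within V)"
  by (rule smooth_differentiable[OF smooth_coeffsD])

lemma smooth_coeffs_add: "smooth_coeffs E V \<phi> \<Longrightarrow> smooth_coeffs E V \<psi> \<Longrightarrow> smooth_coeffs E V (\<lambda>x vs. \<phi> x vs + \<psi> x vs)"
  by (simp add: smooth_coeffs_def smooth_on_add)

lemma smooth_coeffs_scale: "smooth_coeffs E V \<phi> \<Longrightarrow> smooth_coeffs E V (\<lambda>x vs. c * \<phi> x vs)"
  by (simp add: smooth_coeffs_def smooth_on_cmult)

lemma smooth_coeffs_alt_sign: "smooth_coeffs E V \<phi> \<Longrightarrow> smooth_coeffs E V (\<lambda>x. alt_sign (\<phi> x))"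
  by (simp add: smooth_coeffs_def alt_sign_def smooth_on_cmult)

lemma smooth_coeffs_shuffle:
  assumes "smooth_coeffs E V \<phi>" "smooth_coeffs E V \<psi>"
  shows "smooth_coeffs E V (\<lambda>x. shuffle (\<phi> x) (\<psi> x))"
  unfolding smooth_coeffs_def shuffle_def
proof (intro allI impI, rule smooth_on_sum, rule smooth_on_cmult, rule smooth_on_mult)
  fix vs :: "'e list" and I
  assume "set vs \<subseteq> E"
  then have E: "set (nths vs J) \<subseteq> E" for J
    using set_nths_subset by fast
  show "smooth_on E V (\<lambda>x. \<phi> x (nths vs I))"
    using assms(1) E unfolding smooth_coeffs_def by blast
  show "smooth_on E V (\<lambda>x. \<psi> x (nths vs ({..<length vs} - I)))"
    using assms(2) E unfolding smooth_coeffs_def by blast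
qed

lemma smooth_coeffs_dloc: "smooth_coeffs E V \<phi> \<Longrightarrow> smooth_coeffs E V (dloc V \<phi>)"
proof -
  have "smooth_on E V (\<lambda>x. dloc V \<phi> x vs)" if "smooth_coeffs E V \<phi>" "set vs \<subseteq> E" for vs
    using that
  proof (induction vs arbitrary: \<phi>)
    case (Cons v vs)
    then have v: "v \<in> E" and vs: "set vs \<subseteq> E" by auto
    have "smooth_on E V (\<lambda>x. deriv_form V v \<phi> x vs + (-1) * dloc V (contr_form v \<phi>) x vs)"
      by (rule smooth_on_add[OF smooth_coeffsD[OF smooth_coeffs_deriv_form[OF Cons.prems(1) v] vs]
            smooth_on_cmult[OF Cons.IH[OF smooth_coeffs_contr_form[OF Cons.prems(1) v] vs]]])
    then show ?case by (simp add: dloc_Cons)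
  qed simp
  then show "smooth_coeffs E V \<phi> \<Longrightarrow> smooth_coeffs E V (dloc V \<phi>)" by (simp add: smooth_coeffs_def)
qed

lemma dloc_cong:
  assumes "\<And>y us. y \<in> V \<Longrightarrow> set us \<subseteq> E \<Longrightarrow> \<phi> y us = \<psi> y us" "x \<in> V" "set vs \<subseteq> E"
  shows "dloc V \<phi> x vs = dloc V \<psi> x vs"
  using assms(1,3)
proof (induction vs arbitrary: \<phi> \<psi>)
  case (Cons v vs)
  have "deriv_form V v \<phi> x vs = deriv_form V v \<psi> x vs"
    unfolding deriv_form_def using Cons.prems by (intro dir_deriv_cong assms(2)) simp
  moreover have "dloc V (contr_form v \<phi>) x vs = dloc V (contr_form v \<psi>) x vs"
    using Cons.prems by (intro Cons.IH) (simp_all add: contr_form_def contr_def)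
  ultimately show ?case by (simp add: dloc_Cons)
qed simp

lemma dloc_add:
  assumes "smooth_coeffs E V \<phi>" "smooth_coeffs E V \<psi>" "x \<in> V" "set vs \<subseteq> E"
  shows "dloc V (\<lambda>x vs. \<phi> x vs + \<psi> x vs) x vs = dloc V \<phi> x vs + dloc V \<psi> x vs"
  using assms(1,2,4)
proof (induction vs arbitrary: \<phi> \<psi>)
  case (Cons v vs)
  have "deriv_form V v (\<lambda>x vs. \<phi> x vs + \<psi> x vs) x vs = deriv_form V v \<phi> x vs + deriv_form V v \<psi> x vs"
    unfolding deriv_form_def using Cons.prems assms(3)
    by (simp add: dir_deriv_add smooth_coeffs_differentiable[of \<phi>] smooth_coeffs_differentiable[of \<psi>])
  moreover have "contr_form v (\<lambda>x vs. \<phi> x vs + \<psi> x vs) = (\<lambda>x vs. contr_form v \<phi> x vs + contr_form v \<psi> x vs)"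
    by (simp add: contr_form_def contr_def)
  ultimately show ?case
    using Cons by (simp add: dloc_Cons smooth_coeffs_contr_form)
qed simp

lemma dloc_scale:
  assumes "smooth_coeffs E V \<phi>" "x \<in> V" "set vs \<subseteq> E"
  shows "dloc V (\<lambda>x vs. c * \<phi> x vs) x vs = c * dloc V \<phi> x vs"
  using assms(1,3)
proof (induction vs arbitrary: \<phi>)
  case (Cons v vs)
  have "deriv_form V v (\<lambda>x vs. c * \<phi> x vs) x vs = c * deriv_form V v \<phi> x vs"
    unfolding deriv_form_def using Cons.prems assms(2) by (simp add: dir_deriv_cmult smooth_coeffs_differentiable[of \<phi>])
  moreover have "contr_form v (\<lambda>x vs. c * \<phi> x vs) = (\<lambda>x vs. c * contr_form v \<phi> x vs)"
    by (simp add: contr_form_def contr_def)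
  ultimately show ?case
    using Cons by (simp add: dloc_Cons smooth_coeffs_contr_form right_diff_distrib)
qed simp

lemma dloc_minus:
  assumes "smooth_coeffs E V \<phi>" "x \<in> V" "set vs \<subseteq> E"
  shows "dloc V (\<lambda>x vs. - \<phi> x vs) x vs = - dloc V \<phi> x vs"
  using dloc_scale[OF assms, of "-1"] by simp

lemma dloc_diff:
  assumes "smooth_coeffs E V \<phi>" "smooth_coeffs E V \<psi>" "x \<in> V" "set vs \<subseteq> E"
  shows "dloc V (\<lambda>x vs. \<phi> x vs - \<psi> x vs) x vs = dloc V \<phi> x vs - dloc V \<psi> x vs"
  using dloc_add[OF assms(1) smooth_coeffs_scale[OF assms(2), of "-1"] assms(3,4)] dloc_minus[OF assms(2-4)] by simp

lemma dloc_zero: "x \<in> V \<Longrightarrow> set vs \<subseteq> E \<Longrightarrow> dloc V (\<lambda>x vs. 0) x vs = 0"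
  by (induction vs) (simp_all add: dloc_Cons deriv_form_def contr_form_def contr_def)

text \<open>The differential raises the degree by one, hence anticommutes with the
  involution.\<close>

lemma dloc_alt_sign:
  assumes "smooth_coeffs E V \<phi>" "x \<in> V" "set vs \<subseteq> E"
  shows "dloc V (\<lambda>x. alt_sign (\<phi> x)) x vs = - alt_sign (dloc V \<phi> x) vs"
  using assms(1,3)
proof (induction vs arbitrary: \<phi>)
  case (Cons v vs)
  have 1: "deriv_form V v (\<lambda>x. alt_sign (\<phi> x)) x vs = (-1) ^ length vs * deriv_form V v \<phi> x vs"
    unfolding deriv_form_def alt_sign_def using Cons.prems assms(2)
    by (simp add: dir_deriv_cmult smooth_coeffs_differentiable[of \<phi>])
  have "contr_form v (\<lambda>x. alt_sign (\<phi> x)) = (\<lambda>x vs. - alt_sign (contr_form v \<phi> x) vs)"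
    by (simp add: contr_form_def contr_alt_sign)
  moreover have "dloc V (\<lambda>x vs. - alt_sign (contr_form v \<phi> x) vs) x vs = - dloc V (\<lambda>x. alt_sign (contr_form v \<phi> x)) x vs"
    using Cons.prems assms(2) by (simp add: dloc_minus smooth_coeffs_alt_sign smooth_coeffs_contr_form)
  ultimately have "dloc V (contr_form v (\<lambda>x. alt_sign (\<phi> x))) x vs = alt_sign (dloc V (contr_form v \<phi>) x) vs"
    using Cons.prems Cons.IH[of "contr_form v \<phi>"] by (simp add: smooth_coeffs_contr_form)
  with 1 show ?case
    by (simp add: dloc_Cons alt_sign_def algebra_simps)
qed (simp add: alt_sign_def)

text \<open>Along the recursion for \<open>dloc\<close> the only exchange to justify is that of two
  directional derivatives of a smooth coefficient.\<close>

lemma dir_deriv_dloc: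
  assumes "smooth_coeffs E V \<phi>" "x \<in> V" "set vs \<subseteq> E" "v \<in> E"
  shows "dir_deriv V v (\<lambda>x. dloc V \<phi> x vs) x = dloc V (deriv_form V v \<phi>) x vs"
  using assms(1,3)
proof (induction vs arbitrary: \<phi>)
  case (Cons w ws)
  then have w: "w \<in> E" and ws: "set ws \<subseteq> E" by auto
  have "dir_deriv V v (\<lambda>x. dloc V \<phi> x (w # ws)) x =
      dir_deriv V v (dir_deriv V w (\<lambda>x. \<phi> x ws)) x - dir_deriv V v (\<lambda>x. dloc V (contr_form w \<phi>) x ws) x"
    unfolding dloc_Cons deriv_form_def
    by (rule dir_deriv_diff[OF smooth_differentiable[OF smooth_on_dir_deriv[OF smooth_coeffsD[OF Cons.prems(1) ws] w] assms(2)]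
          smooth_differentiable[OF smooth_coeffsD[OF smooth_coeffs_dloc[OF smooth_coeffs_contr_form[OF Cons.prems(1) w]] ws] assms(2)] assms(2,4)])
  also have "dir_deriv V v (dir_deriv V w (\<lambda>x. \<phi> x ws)) x = dir_deriv V w (dir_deriv V v (\<lambda>x. \<phi> x ws)) x"
    by (rule dir_deriv_commute[OF smooth_coeffsD[OF Cons.prems(1) ws] assms(2,4) w])
  also have "dir_deriv V v (\<lambda>x. dloc V (contr_form w \<phi>) x ws) x = dloc V (contr_form w (deriv_form V v \<phi>)) x ws"
    unfolding contr_form_deriv_form by (rule Cons.IH[OF smooth_coeffs_contr_form[OF Cons.prems(1) w] ws])
  finally show ?case
    by (simp add: dloc_Cons deriv_form_def)
qed (simp add: assms)

text \<open>Contracting twice by Cartan's formula leaves the derivative along \<open>v\<close> of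
  the differential, minus the differential of the derivative along \<open>v\<close>, plus the double
  differential of the contraction. The first two cancel by \<open>dir_deriv_dloc\<close>; the last
  falls to the induction.\<close>

lemma dloc_dloc:
  assumes "smooth_coeffs E V \<phi>" "x \<in> V" "set vs \<subseteq> E"
  shows "dloc V (dloc V \<phi>) x vs = 0"
  using assms(1,3)
proof (induction vs arbitrary: \<phi>)
  case (Cons v vs)
  then have v: "v \<in> E" and vs: "set vs \<subseteq> E" by auto
  note \<phi> = Cons.prems(1)
  have "dloc V (contr_form v (dloc V \<phi>)) x vs = dloc V (deriv_form V v \<phi>) x vs - dloc V (dloc V (contr_form v \<phi>)) x vs"
    unfolding contr_form_dloc by (rule dloc_diff[OF smooth_coeffs_deriv_form[OF \<phi> v] smooth_coeffs_dloc[OF smooth_coeffs_contr_form[OF \<phi> v]] assms(2) vs])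
  moreover have "deriv_form V v (dloc V \<phi>) x vs = dloc V (deriv_form V v \<phi>) x vs"
    unfolding deriv_form_def[of V v "dloc V \<phi>"] by (rule dir_deriv_dloc[OF \<phi> assms(2) vs v])
  moreover have "dloc V (dloc V (contr_form v \<phi>)) x vs = 0"
    by (rule Cons.IH[OF smooth_coeffs_contr_form[OF \<phi> v] vs])
  ultimately show ?case
    by (simp add: dloc_Cons[of V "dloc V \<phi>"])
qed simp

lemma deriv_form_shuffle:
  assumes "smooth_coeffs E V \<phi>" "smooth_coeffs E V \<psi>" "x \<in> V" "set vs \<subseteq> E" "v \<in> E"
  shows "deriv_form V v (\<lambda>x. shuffle (\<phi> x) (\<psi> x)) x vs = shuffle (deriv_form V v \<phi> x) (\<psi> x) vs + shuffle (\<phi> x) (deriv_form V v \<psi> x) vs"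
proof -
  have E: "set (nths vs I) \<subseteq> E" for I
    using assms(4) set_nths_subset by fast
  have d: "(\<lambda>x. \<phi> x (nths vs I)) differentiable at x within V"
      "(\<lambda>x. \<psi> x (nths vs I)) differentiable at x within V" for I
    by (rule smooth_coeffs_differentiable[OF assms(1) E assms(3)], rule smooth_coeffs_differentiable[OF assms(2) E assms(3)])
  show ?thesis
    unfolding deriv_form_def shuffle_def
    using d assms(3,5)
    by (simp add: dir_deriv_sum dir_deriv_cmult dir_deriv_mult differentiable_mult sum.distrib distrib_left)
qed

text \<open>Contract both sides with \<open>v\<close> and use the induction hypothesis for the two
  products that arise, one with a contracted \<phi> and one with the involution of \<phi> and a
  contracted \<psi>.\<close>

lemma dloc_shuffle:
  assumes "smooth_coeffs E V \<phi>" "smooth_coeffs E V \<psi>" "x \<in> V" "set vs \<subseteq> E"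
  shows "dloc V (\<lambda>x. shuffle (\<phi> x) (\<psi> x)) x vs = shuffle (dloc V \<phi> x) (\<psi> x) vs + shuffle (alt_sign (\<phi> x)) (dloc V \<psi> x) vs"
  using assms(1,2,4)
proof (induction vs arbitrary: \<phi> \<psi>)
  case (Cons v vs)
  then have v: "v \<in> E" and vs: "set vs \<subseteq> E" by auto
  note \<phi> = Cons.prems(1) and \<psi> = Cons.prems(2)
  have c: "contr_form v (\<lambda>x. shuffle (\<phi> x) (\<psi> x)) =
      (\<lambda>x vs. shuffle (contr_form v \<phi> x) (\<psi> x) vs + shuffle (alt_sign (\<phi> x)) (contr_form v \<psi> x) vs)"
    by (simp add: contr_form_def contr_shuffle)
  have "dloc V (contr_form v (\<lambda>x. shuffle (\<phi> x) (\<psi> x))) x vs =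
      dloc V (\<lambda>x. shuffle (contr_form v \<phi> x) (\<psi> x)) x vs + dloc V (\<lambda>x. shuffle (alt_sign (\<phi> x)) (contr_form v \<psi> x)) x vs"
    unfolding c by (rule dloc_add[OF smooth_coeffs_shuffle[OF smooth_coeffs_contr_form[OF \<phi> v] \<psi>] smooth_coeffs_shuffle[OF smooth_coeffs_alt_sign[OF \<phi>] smooth_coeffs_contr_form[OF \<psi> v]] assms(3) vs])
  also have "\<dots> = shuffle (dloc V (contr_form v \<phi>) x) (\<psi> x) vs + shuffle (alt_sign (contr_form v \<phi> x)) (dloc V \<psi> x) vs +
      (shuffle (dloc V (\<lambda>x. alt_sign (\<phi> x)) x) (contr_form v \<psi> x) vs + shuffle (\<phi> x) (dloc V (contr_form v \<psi>) x) vs)"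
    using \<phi> \<psi> v vs by (simp add: Cons.IH smooth_coeffs_contr_form smooth_coeffs_alt_sign)
  \<comment> \<open>The second product differentiates the involution of \<phi>; exchanging the two
    yields the sign that the contracted right-hand side carries.\<close>
  also have "shuffle (dloc V (\<lambda>x. alt_sign (\<phi> x)) x) (contr_form v \<psi> x) vs =
      shuffle (\<lambda>vs. - alt_sign (dloc V \<phi> x) vs) (contr_form v \<psi> x) vs"
    by (rule shuffle_cong[OF vs dloc_alt_sign[OF \<phi> assms(3)] refl])
  finally have 1: "dloc V (contr_form v (\<lambda>x. shuffle (\<phi> x) (\<psi> x))) x vs =
      shuffle (dloc V (contr_form v \<phi>) x) (\<psi> x) vs + shuffle (alt_sign (contr_form v \<phi> x)) (dloc V \<psi> x) vs +
      (- shuffle (alt_sign (dloc V \<phi> x)) (contr_form v \<psi> x) vs + shuffle (\<phi> x) (dloc V (contr_form v \<psi>) x) vs)"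
    by (simp add: shuffle_minus_left)
  have 2: "contr v (dloc V \<xi> x) = (\<lambda>us. deriv_form V v \<xi> x us - dloc V (contr_form v \<xi>) x us)" for \<xi>
    using contr_form_dloc[of v V \<xi>] by (simp add: contr_form_def fun_eq_iff)
  show ?case
    unfolding dloc_Cons[of V "\<lambda>x. shuffle (\<phi> x) (\<psi> x)"] 1 shuffle_Cons 2 deriv_form_shuffle[OF \<phi> \<psi> assms(3) vs v]
    by (simp add: contr_alt_sign shuffle_minus_left shuffle_diff_left shuffle_diff_right contr_form_def)
qed simp

text \<open>When the varying slot comes first, it is the direction of differentiation in one term,
  where linearity is that of the derivative, and an argument of \<phi> in the other. Slots further
  back are reached by contraction.\<close>

lemma multilinear_dloc:
  assumes "smooth_coeffs E V \<phi>" "\<And>x. x \<in> V \<Longrightarrow> multilinear E (\<phi> x)" "x \<in> V"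
  shows "multilinear E (dloc V \<phi> x)"
proof (rule multilinearI)
  fix us ws u v r s
  assume us: "set us \<subseteq> E" and ws: "set ws \<subseteq> E" and u: "u \<in> E" and v: "v \<in> E"
  have uv: "r *\<^sub>R u + s *\<^sub>R v \<in> E"
    using u v by (intro subspace_add subspace_scale subspace_E)
  show "dloc V \<phi> x (us @ (r *\<^sub>R u + s *\<^sub>R v) # ws) = r * dloc V \<phi> x (us @ u # ws) + s * dloc V \<phi> x (us @ v # ws)"
    using us assms(1,2)
  proof (induction us arbitrary: \<phi>)
    case Nil
    have "linear (\<lambda>v. deriv_form V v \<phi> x ws)"
      unfolding deriv_form_def by (rule linear_dir_deriv[OF smooth_coeffs_differentiable[OF Nil.prems(2) ws assms(3)]])
    then have 1: "deriv_form V (r *\<^sub>R u + s *\<^sub>R v) \<phi> x ws = r * deriv_form V u \<phi> x ws + s * deriv_form V v \<phi> x ws"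
      by (simp add: linear_iff)
    have "dloc V (contr_form (r *\<^sub>R u + s *\<^sub>R v) \<phi>) x ws = dloc V (\<lambda>x vs. r * contr_form u \<phi> x vs + s * contr_form v \<phi> x vs) x ws"
    proof (rule dloc_cong[OF _ assms(3) ws])
      fix y xs assume "y \<in> V" "set xs \<subseteq> E"
      then show "contr_form (r *\<^sub>R u + s *\<^sub>R v) \<phi> y xs = r * contr_form u \<phi> y xs + s * contr_form v \<phi> y xs"
        using multilinearD[OF Nil.prems(3) u v, of y "[]" xs] by (simp add: contr_form_def contr_def)
    qed
    also have "\<dots> = r * dloc V (contr_form u \<phi>) x ws + s * dloc V (contr_form v \<phi>) x ws"
      using Nil.prems u v ws assms(3) by (simp add: dloc_add dloc_scale smooth_coeffs_scale smooth_coeffs_contr_form)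
    finally show ?case
      using 1 by (simp add: dloc_Cons algebra_simps)
  next
    case (Cons w us)
    then have w: "w \<in> E" and us: "set us \<subseteq> E" by auto
    note \<phi> = Cons.prems(2,3)
    have E: "set (us @ y # ws) \<subseteq> E" if "y \<in> E" for y using us ws that by auto
    have "deriv_form V w \<phi> x (us @ (r *\<^sub>R u + s *\<^sub>R v) # ws) =
        dir_deriv V w (\<lambda>x. r * \<phi> x (us @ u # ws) + s * \<phi> x (us @ v # ws)) x"
      unfolding deriv_form_def by (rule dir_deriv_cong[OF multilinearD[OF \<phi>(2) u v us ws] assms(3)])
    also have "\<dots> = r * deriv_form V w \<phi> x (us @ u # ws) + s * deriv_form V w \<phi> x (us @ v # ws)"
      unfolding deriv_form_def using smooth_coeffs_differentiable[OF \<phi>(1) E[OF u] assms(3)]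
        smooth_coeffs_differentiable[OF \<phi>(1) E[OF v] assms(3)] w assms(3)
      by (simp add: dir_deriv_add dir_deriv_cmult differentiable_mult)
    finally have "deriv_form V w \<phi> x (us @ (r *\<^sub>R u + s *\<^sub>R v) # ws) =
        r * deriv_form V w \<phi> x (us @ u # ws) + s * deriv_form V w \<phi> x (us @ v # ws)" .
    moreover have "dloc V (contr_form w \<phi>) x (us @ (r *\<^sub>R u + s *\<^sub>R v) # ws) =
        r * dloc V (contr_form w \<phi>) x (us @ u # ws) + s * dloc V (contr_form w \<phi>) x (us @ v # ws)"
      by (rule Cons.IH[OF us smooth_coeffs_contr_form[OF \<phi>(1) w]]) (simp add: contr_form_def multilinear_contr \<phi> w)
    ultimately show ?case
      by (simp add: dloc_Cons algebra_simps)
  qed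
qed

text \<open>With the equal pair in front, the recursion produces the derivative along
  \<open>v\<close> of the contraction with \<open>v\<close> twice, with opposite signs; what remains
  is a double contraction.\<close>

lemma adj_alt_dloc:
  assumes "smooth_coeffs E V \<phi>" "\<And>x. x \<in> V \<Longrightarrow> adj_alt E (\<phi> x)" "x \<in> V"
  shows "adj_alt E (dloc V \<phi> x)"
  unfolding adj_alt_def
proof (intro allI impI)
  fix us ws v
  assume us: "set us \<subseteq> E" and v: "v \<in> E" and ws: "set ws \<subseteq> E"
  show "dloc V \<phi> x (us @ v # v # ws) = 0"
    using us assms(1,2)
  proof (induction us arbitrary: \<phi>)
    case Nil
    have "dloc V (contr_form v (contr_form v \<phi>)) x ws = dloc V (\<lambda>x vs. 0) x ws"
    proof (rule dloc_cong[OF _ assms(3) ws])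
      fix y xs assume "y \<in> V" "set xs \<subseteq> E"
      then show "contr_form v (contr_form v \<phi>) y xs = 0"
        using adj_altD[OF Nil.prems(3) v, of y "[]" xs] by (simp add: contr_form_def contr_def)
    qed
    then show ?case
      using ws assms(3) by (simp add: dloc_Cons dloc_zero) (simp add: deriv_form_def contr_form_def contr_def)
  next
    case (Cons w us)
    then have w: "w \<in> E" and us: "set us \<subseteq> E" by auto
    have "deriv_form V w \<phi> x (us @ v # v # ws) = dir_deriv V w (\<lambda>x. 0) x"
      unfolding deriv_form_def by (rule dir_deriv_cong[OF adj_altD[OF Cons.prems(3) v us ws] assms(3)])
    moreover have "dloc V (contr_form w \<phi>) x (us @ v # v # ws) = 0"
      by (rule Cons.IH[OF us smooth_coeffs_contr_form[OF Cons.prems(2) w]]) (simp add: contr_form_def adj_alt_contr Cons.prems w)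
    ultimately show ?case
      using w assms(3) by (simp add: dloc_Cons)
  qed
qed

lemma alt_dloc:
  assumes "smooth_coeffs E V \<phi>" "\<And>x. x \<in> V \<Longrightarrow> multilinear E (\<phi> x)" "\<And>x. x \<in> V \<Longrightarrow> alt E (\<phi> x)" "x \<in> V"
  shows "alt E (dloc V \<phi> x)"
  by (rule alt_if_adj_alt[OF multilinear_dloc[OF assms(1,2,4)] adj_alt_dloc[OF assms(1) adj_alt_if_alt[OF assms(3)] assms(4)] subspace_E])

subsection \<open>Naturality\<close>

text \<open>
  The pullback of a form has values on vectors that depend on the point, so that naturality is
  proved for the following operator, where the \<open>Ys\<close> are vector fields along a map.  If
  \<open>\<partial>\<^bsub>v\<^sub>i\<^esub> Y\<^sub>j\<close> is symmetric in \<open>i\<close> and \<open>j\<close>, the derivatives of the fields cancel.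
\<close>

definition dloc_fields :: "('e \<Rightarrow> 'e list \<Rightarrow> real) \<Rightarrow> 'e list \<Rightarrow> ('e \<Rightarrow> 'e) list \<Rightarrow> 'e \<Rightarrow> real" where
  "dloc_fields \<xi> vs Ys x = (\<Sum>i<length vs. (-1) ^ i *
     dir_deriv V (vs ! i) (\<lambda>y. \<xi> y (map (\<lambda>Y. Y y) (take i Ys @ drop (Suc i) Ys))) x)"

lemma dloc_fields_Cons:
  "dloc_fields \<xi> (v # vs) (Y # Ys) x =
     dir_deriv V v (\<lambda>y. \<xi> y (map (\<lambda>Y. Y y) Ys)) x - dloc_fields (\<lambda>y. contr (Y y) (\<xi> y)) vs Ys x"
  by (simp add: dloc_fields_def sum.lessThan_Suc_shift contr_def del: sum.lessThan_Suc flip: sum_negf)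

text \<open>First derivatives suffice for naturality. Coefficients composed with a smooth map are
  covered by the first-order chain rule alone, without a chain rule of all orders.\<close>

definition diff_coeffs :: "('e \<Rightarrow> 'e list \<Rightarrow> real) \<Rightarrow> bool" where
  "diff_coeffs \<xi> \<longleftrightarrow> (\<forall>vs x. set vs \<subseteq> E \<longrightarrow> x \<in> V \<longrightarrow> (\<lambda>y. \<xi> y vs) differentiable (at x within V)) \<and>
     (\<forall>x\<in>V. multilinear E (\<xi> x) \<and> alt E (\<xi> x))"

definition diff_field :: "('e \<Rightarrow> 'e) \<Rightarrow> bool" where
  "diff_field Y \<longleftrightarrow> Y ` V \<subseteq> E \<and> (\<forall>x\<in>V. Y differentiable (at x within V))"

lemma diff_coeffsD:
  assumes "diff_coeffs \<xi>" "x \<in> V"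
  shows "set vs \<subseteq> E \<Longrightarrow> (\<lambda>y. \<xi> y vs) differentiable (at x within V)"
    and "multilinear E (\<xi> x)" and "alt E (\<xi> x)"
  using assms unfolding diff_coeffs_def by blast+

lemma diff_fieldD:
  assumes "diff_field Y" "x \<in> V"
  shows "Y x \<in> E" and "Y differentiable (at x within V)"
  using assms unfolding diff_field_def by blast+

text \<open>Differentiability of \<xi> is known only for fixed arguments. Expanding the field in a
  basis of \<open>E\<close> turns the contraction into a finite sum of products of real functions,
  to which the product rule applies; both halves are then reassembled by linearity.\<close>

lemma contr_field:
  assumes \<xi>: "diff_coeffs \<xi>" and Y: "diff_field Y" and x: "x \<in> V" and us: "set us \<subseteq> E"
  shows "(\<lambda>y. \<xi> y (Y y # us)) differentiable (at x within V)"
    and "v \<in> E \<Longrightarrow> dir_deriv V v (\<lambda>y. \<xi> y (Y y # us)) x =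
      dir_deriv V v (\<lambda>y. \<xi> y (Y x # us)) x + \<xi> x (dir_deriv V v Y x # us)"
proof -
  \<comment> \<open>A basis of \<open>E\<close> itself is required: standard basis vectors of the
    ambient space may lie outside \<open>E\<close>, where \<xi> is not controlled.\<close>
  obtain B where B: "B \<subseteq> E" "pairwise orthogonal B" "\<And>b. b \<in> B \<Longrightarrow> norm b = 1" "independent B" "span B = E"
    using orthonormal_basis_subspace[OF subspace_E] by metis
  have finB: "finite B" using B(4) by (rule independent_imp_finite)
  have rep: "(\<Sum>b\<in>B. (z \<bullet> b) *\<^sub>R b) = z" if "z \<in> E" for z
  proof -
    have "z \<in> span B" using that B(5) by simp
    then obtain c where c: "z = (\<Sum>b\<in>B. c b *\<^sub>R b)"
      using finB by (auto simp: span_finite)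
    have "z \<bullet> b = c b" if b: "b \<in> B" for b
    proof -
      have "z \<bullet> b = (\<Sum>a\<in>B. c a * (a \<bullet> b))"
        by (simp add: c inner_sum_left)
      also have "\<dots> = (\<Sum>a\<in>B. if a = b then c b else 0)"
      proof (rule sum.cong[OF refl])
        fix a assume "a \<in> B"
        then show "c a * (a \<bullet> b) = (if a = b then c b else 0)"
          using B(2,3) b by (auto simp: pairwise_def orthogonal_def dot_square_norm)
      qed
      finally show ?thesis using b finB by simp
    qed
    then show ?thesis by (simp add: c)
  qed
  have expand: "\<xi> y (z # us) = (\<Sum>b\<in>B. (z \<bullet> b) * \<xi> y (b # us))" if "y \<in> V" "z \<in> E" for y z
    using multilinear_sum[OF diff_coeffsD(2)[OF \<xi> that(1)] subspace_E finB B(1) _ us, of "[]" "\<lambda>b. z \<bullet> b"]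
      rep[OF that(2)] by simp
  have eq: "\<xi> y (Y y # us) = (\<Sum>b\<in>B. (Y y \<bullet> b) * \<xi> y (b # us))" if "y \<in> V" for y
    using expand[OF that diff_fieldD(1)[OF Y that]] .
  have d1: "(\<lambda>y. Y y \<bullet> b) differentiable (at x within V)" for b
    using differentiableI[OF bounded_linear.has_derivative[OF bounded_linear_inner_left
          has_derivative_dir_deriv[OF diff_fieldD(2)[OF Y x]]]] .
  have d2: "(\<lambda>y. \<xi> y (b # us)) differentiable (at x within V)" if "b \<in> E" for b
    using diff_coeffsD(1)[OF \<xi> x, of "b # us"] us that by simp
  have d2': "(\<lambda>y. \<xi> y (b # us)) differentiable (at x within V)" if "b \<in> B" for b
    using that B(1) by (intro d2) auto
  show "(\<lambda>y. \<xi> y (Y y # us)) differentiable (at x within V)"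
    using finB by (subst differentiable_cong_within[OF eq x])
      (simp_all add: differentiable_sum differentiable_mult d1 d2')
  assume v: "v \<in> E"
  have "dir_deriv V v (\<lambda>y. \<xi> y (Y y # us)) x = dir_deriv V v (\<lambda>y. \<Sum>b\<in>B. (Y y \<bullet> b) * \<xi> y (b # us)) x"
    by (intro dir_deriv_cong eq x)
  also have "\<dots> = (\<Sum>b\<in>B. dir_deriv V v (\<lambda>y. Y y \<bullet> b) x * \<xi> x (b # us)) +
      (\<Sum>b\<in>B. (Y x \<bullet> b) * dir_deriv V v (\<lambda>y. \<xi> y (b # us)) x)"
    using v x by (simp add: dir_deriv_sum dir_deriv_mult differentiable_mult d1 d2' sum.distrib)
  also have "(\<Sum>b\<in>B. dir_deriv V v (\<lambda>y. Y y \<bullet> b) x * \<xi> x (b # us)) = \<xi> x (dir_deriv V v Y x # us)"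
  proof -
    \<comment> \<open>\<open>expand\<close> applies to this vector only because fields with values
      in \<open>E\<close> have derivatives in \<open>E\<close>.\<close>
    have "dir_deriv V v Y x \<in> E"
      using Y x v by (intro dir_deriv_in_subspace) (auto simp: diff_field_def)
    then show ?thesis
      using v x diff_fieldD(2)[OF Y x]
      by (simp add: expand dir_deriv_bounded_linear[OF bounded_linear_inner_left])
  qed
  also have "(\<Sum>b\<in>B. (Y x \<bullet> b) * dir_deriv V v (\<lambda>y. \<xi> y (b # us)) x) =
      dir_deriv V v (\<lambda>y. \<Sum>b\<in>B. (Y x \<bullet> b) * \<xi> y (b # us)) x"
    using v x by (simp add: dir_deriv_sum dir_deriv_cmult differentiable_mult d2')
  also have "\<dots> = dir_deriv V v (\<lambda>y. \<xi> y (Y x # us)) x"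
    by (intro dir_deriv_cong[OF _ x] expand[symmetric] diff_fieldD(1)[OF Y x])
  finally show "dir_deriv V v (\<lambda>y. \<xi> y (Y y # us)) x =
      dir_deriv V v (\<lambda>y. \<xi> y (Y x # us)) x + \<xi> x (dir_deriv V v Y x # us)"
    by simp
qed

lemma diff_coeffs_contr_field: "diff_coeffs \<xi> \<Longrightarrow> diff_field Y \<Longrightarrow> diff_coeffs (\<lambda>y. contr (Y y) (\<xi> y))"
  unfolding diff_coeffs_def[of "\<lambda>y. contr (Y y) (\<xi> y)"]
proof (intro conjI allI impI ballI)
  fix us x assume "diff_coeffs \<xi>" "diff_field Y" "set us \<subseteq> E" "x \<in> V"
  then show "(\<lambda>y. contr (Y y) (\<xi> y) us) differentiable (at x within V)"
    unfolding contr_def using contr_field(1) by blast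
next
  fix x assume *: "diff_coeffs \<xi>" "diff_field Y" "x \<in> V"
  show "multilinear E (contr (Y x) (\<xi> x))" "alt E (contr (Y x) (\<xi> x))"
    using multilinear_contr[OF diff_coeffsD(2)[OF *(1,3)] diff_fieldD(1)[OF *(2,3)]]
      alt_contr[OF diff_coeffsD(3)[OF *(1,3)] diff_fieldD(1)[OF *(2,3)]] by blast+
qed

text \<open>The product rule over all slots. The induction absorbs the first field into the
  coefficients, which \<open>diff_coeffs_contr_field\<close> permits.\<close>

lemma dir_deriv_fields:
  assumes "diff_coeffs \<xi>" "\<And>Y. Y \<in> set Ys \<Longrightarrow> diff_field Y" "x \<in> V" "v \<in> E"
  shows "dir_deriv V v (\<lambda>y. \<xi> y (map (\<lambda>Y. Y y) Ys)) x =
    dir_deriv V v (\<lambda>y. \<xi> y (map (\<lambda>Y. Y x) Ys)) x +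
    (\<Sum>j<length Ys. \<xi> x ((map (\<lambda>Y. Y x) Ys)[j := dir_deriv V v (Ys ! j) x]))"
  using assms(1,2)
proof (induction Ys arbitrary: \<xi>)
  case (Cons Y Ys)
  have Y: "diff_field Y" using Cons.prems by simp
  have us: "set (map (\<lambda>Y. Y x) Ys) \<subseteq> E"
    using Cons.prems(2) diff_fieldD(1) assms(3) by auto
  have "dir_deriv V v (\<lambda>y. contr (Y y) (\<xi> y) (map (\<lambda>Y. Y y) Ys)) x =
      dir_deriv V v (\<lambda>y. contr (Y y) (\<xi> y) (map (\<lambda>Y. Y x) Ys)) x +
      (\<Sum>j<length Ys. contr (Y x) (\<xi> x) ((map (\<lambda>Y. Y x) Ys)[j := dir_deriv V v (Ys ! j) x]))"
    using Cons.prems by (intro Cons.IH diff_coeffs_contr_field) auto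
  then show ?case
    using contr_field(2)[OF Cons.prems(1) Y assms(3) us assms(4)]
    by (simp add: contr_def sum.lessThan_Suc_shift del: sum.lessThan_Suc)
qed simp

text \<open>Freezes the field that was absorbed into the coefficients. Each summand leaves behind
  the derivative of that field in the first slot.\<close>

lemma dloc_fields_contr:
  assumes "diff_coeffs \<xi>" "diff_field Y" "x \<in> V" "set vs \<subseteq> E" "set us \<subseteq> E"
  shows "dloc_fields (\<lambda>y. contr (Y y) (\<xi> y)) vs (map (\<lambda>u _. u) us) x =
    dloc_fields (\<lambda>y. contr (Y x) (\<xi> y)) vs (map (\<lambda>u _. u) us) x +
    (\<Sum>j<length vs. (-1) ^ j * \<xi> x (dir_deriv V (vs ! j) Y x # take j us @ drop (Suc j) us))"
  unfolding dloc_fields_def sum.distrib[symmetric]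
proof (rule sum.cong[OF refl])
  fix j assume "j \<in> {..<length vs}"
  then have v: "vs ! j \<in> E" using assms(4) by (auto dest: nth_mem)
  have us: "set (take j us @ drop (Suc j) us) \<subseteq> E"
    using assms(5) set_take_subset[of j us] set_drop_subset[of "Suc j" us] by auto
  show "(-1) ^ j * dir_deriv V (vs ! j) (\<lambda>y. contr (Y y) (\<xi> y)
        (map (\<lambda>Y. Y y) (take j (map (\<lambda>u _. u) us) @ drop (Suc j) (map (\<lambda>u _. u) us)))) x =
      (-1) ^ j * dir_deriv V (vs ! j) (\<lambda>y. contr (Y x) (\<xi> y)
        (map (\<lambda>Y. Y y) (take j (map (\<lambda>u _. u) us) @ drop (Suc j) (map (\<lambda>u _. u) us)))) x +
      (-1) ^ j * \<xi> x (dir_deriv V (vs ! j) Y x # take j us @ drop (Suc j) us)"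
    using contr_field(2)[OF assms(1-3) us v]
    by (simp add: contr_def take_map drop_map o_def distrib_left)
qed

text \<open>The leading summand contributes derivatives of each later field along \<open>v\<close>,
  each in its own slot; the later summands contribute derivatives of the first field, all in the
  first slot. Symmetry identifies the vectors, alternation identifies the slots, and the minus sign
  of the recursion makes the corrections cancel.\<close>

lemma dloc_fields_eq:
  assumes "length vs = length Ys" "diff_coeffs \<xi>" "\<And>Y. Y \<in> set Ys \<Longrightarrow> diff_field Y" "x \<in> V" "set vs \<subseteq> E"
    and "\<And>i j. i < length vs \<Longrightarrow> j < length vs \<Longrightarrow> dir_deriv V (vs ! i) (Ys ! j) x = dir_deriv V (vs ! j) (Ys ! i) x"
  shows "dloc_fields \<xi> vs Ys x = dloc_fields \<xi> vs (map (\<lambda>Y _. Y x) Ys) x"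
  using assms(1,2,3,5,6)
proof (induction vs Ys arbitrary: \<xi> rule: list_induct2)
  case (Cons v vs Y Ys)
  let ?L = "map (\<lambda>Y. Y x) Ys"
  have Y: "diff_field Y" and v: "v \<in> E" and vs: "set vs \<subseteq> E"
    using Cons.prems by auto
  have Ys: "diff_field Z" if "Z \<in> set Ys" for Z using Cons.prems(2) that by simp
  have L: "set ?L \<subseteq> E"
    using Ys diff_fieldD(1) assms(4) by auto
  have mapL: "map (\<lambda>Y _. Y x) Ys = map (\<lambda>u _. u) ?L" by simp
  have sym: "dir_deriv V (vs ! i) (Ys ! j) x = dir_deriv V (vs ! j) (Ys ! i) x"
    if "i < length vs" "j < length vs" for i j
    using Cons.prems(4)[of "Suc i" "Suc j"] that by simp
  have sym0: "dir_deriv V v (Ys ! j) x = dir_deriv V (vs ! j) Y x" if "j < length vs" for j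
    using Cons.prems(4)[of 0 "Suc j"] that by simp
  have in_E: "dir_deriv V v (Ys ! j) x \<in> E" if "j < length Ys" for j
    using Ys[OF nth_mem[OF that]] assms(4) v by (intro dir_deriv_in_subspace) (auto simp: diff_field_def)
  \<comment> \<open>The induction hypothesis freezes the later fields while the first one still
    varies inside the coefficients.\<close>
  have "dloc_fields (\<lambda>y. contr (Y y) (\<xi> y)) vs Ys x = dloc_fields (\<lambda>y. contr (Y y) (\<xi> y)) vs (map (\<lambda>u _. u) ?L) x"
    unfolding mapL[symmetric] by (intro Cons.IH diff_coeffs_contr_field Cons.prems(1) Y Ys vs sym)
  also have "\<dots> = dloc_fields (\<lambda>y. contr (Y x) (\<xi> y)) vs (map (\<lambda>u _. u) ?L) x +
      (\<Sum>j<length vs. (-1) ^ j * \<xi> x (dir_deriv V (vs ! j) Y x # take j ?L @ drop (Suc j) ?L))"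
    by (intro dloc_fields_contr Cons.prems(1) Y assms(4) vs L)
  \<comment> \<open>Here the two families of corrections are matched: symmetry replaces the vector,
    and moving it to slot \<open>j\<close> consumes the sign.\<close>
  also have "(\<Sum>j<length vs. (-1) ^ j * \<xi> x (dir_deriv V (vs ! j) Y x # take j ?L @ drop (Suc j) ?L)) =
      (\<Sum>j<length Ys. \<xi> x (?L[j := dir_deriv V v (Ys ! j) x]))"
  proof (rule sum.cong)
    show "{..<length vs} = {..<length Ys}" using Cons.hyps by simp
    fix j assume "j \<in> {..<length Ys}"
    then have j: "j < length Ys" by simp
    show "(-1) ^ j * \<xi> x (dir_deriv V (vs ! j) Y x # take j ?L @ drop (Suc j) ?L) =
        \<xi> x (?L[j := dir_deriv V v (Ys ! j) x])"
      using list_update_to_front[OF diff_coeffsD(2,3)[OF Cons.prems(1) assms(4)] subspace_E in_E[OF j] L, of j]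
        sym0[of j] j Cons.hyps by simp
  qed
  finally show ?case
    using dir_deriv_fields[OF Cons.prems(1) Ys assms(4) v]
    by (simp add: dloc_fields_Cons o_def)
qed (simp add: dloc_fields_def)

text \<open>The fields are the derivatives of \<tau> along the constant vectors, so their symmetry
  is that of the second derivatives of \<tau>. Once they are frozen, the chain rule turns each
  remaining derivative into one of \<phi> along a pushed-forward vector.\<close>

lemma dloc_pullback:
  assumes "open_in_subspace E W" and \<tau>: "smooth_on E V \<tau>" "\<tau> ` V \<subseteq> W"
    and \<phi>: "smooth_coeffs E W \<phi>" "\<And>z. z \<in> W \<Longrightarrow> multilinear E (\<phi> z)" "\<And>z. z \<in> W \<Longrightarrow> alt E (\<phi> z)"
    and x: "x \<in> V" and vs: "set vs \<subseteq> E"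
  shows "dloc V (\<lambda>y us. \<phi> (\<tau> y) (map (\<lambda>v. dir_deriv V v \<tau> y) us)) x vs =
    dloc W \<phi> (\<tau> x) (map (\<lambda>v. dir_deriv V v \<tau> x) vs)"
proof -
  interpret W: open_in_subspace E W by fact
  let ?Ys = "map (\<lambda>v. dir_deriv V v \<tau>) vs"
  have \<tau>E: "\<tau> ` V \<subseteq> E" using \<tau>(2) W.V_subset by blast
  have field: "diff_field (dir_deriv V v \<tau>)" if "v \<in> E" for v
    unfolding diff_field_def
  proof (intro conjI ballI image_subsetI)
    fix y assume y: "y \<in> V"
    show "dir_deriv V v \<tau> y \<in> E"
      by (rule dir_deriv_in_subspace[OF smooth_differentiable[OF \<tau>(1) y] \<tau>E y that])
    show "dir_deriv V v \<tau> differentiable at y within V"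
      by (rule smooth_differentiable[OF smooth_on_dir_deriv[OF \<tau>(1) that] y])
  qed
  have coef: "diff_coeffs (\<lambda>y. \<phi> (\<tau> y))"
    unfolding diff_coeffs_def
  proof (intro conjI allI impI ballI)
    fix us y assume us: "set us \<subseteq> E" and y: "y \<in> V"
    have "(\<lambda>z. \<phi> z us) differentiable (at (\<tau> y) within W)"
      using W.smooth_coeffs_differentiable[OF \<phi>(1) us] y \<tau>(2) by blast
    then have "(\<lambda>z. \<phi> z us) differentiable (at (\<tau> y) within \<tau> ` V)"
      using \<tau>(2) by (rule differentiable_within_subset)
    from differentiable_chain_within[OF smooth_differentiable[OF \<tau>(1) y] this]
    show "(\<lambda>y. \<phi> (\<tau> y) us) differentiable (at y within V)"
      by (simp add: o_def)
  qed (use \<phi> \<tau>(2) in auto)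
  have "dloc V (\<lambda>y us. \<phi> (\<tau> y) (map (\<lambda>v. dir_deriv V v \<tau> y) us)) x vs = dloc_fields (\<lambda>y. \<phi> (\<tau> y)) vs ?Ys x"
    by (simp add: dloc_def dloc_fields_def take_map drop_map o_def)
  also have "\<dots> = dloc_fields (\<lambda>y. \<phi> (\<tau> y)) vs (map (\<lambda>Y _. Y x) ?Ys) x"
  proof (rule dloc_fields_eq[OF _ coef _ x vs])
    fix i j assume "i < length vs" "j < length vs"
    moreover from this have "vs ! i \<in> E" "vs ! j \<in> E" using vs nth_mem by blast+
    ultimately show "dir_deriv V (vs ! i) (?Ys ! j) x = dir_deriv V (vs ! j) (?Ys ! i) x"
      using dir_deriv_commute[OF \<tau>(1) x] by simp
  qed (use vs field in auto)
  also have "\<dots> = dloc W \<phi> (\<tau> x) (map (\<lambda>v. dir_deriv V v \<tau> x) vs)"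
    unfolding dloc_def dloc_fields_def
  proof (rule sum.cong)
    fix i assume "i \<in> {..<length (map (\<lambda>v. dir_deriv V v \<tau> x) vs)}"
    then have i: "i < length vs" by simp
    then have v: "vs ! i \<in> E" using vs nth_mem by blast
    let ?us = "take i (map (\<lambda>v. dir_deriv V v \<tau> x) vs) @ drop (Suc i) (map (\<lambda>v. dir_deriv V v \<tau> x) vs)"
    have "set (map (\<lambda>v. dir_deriv V v \<tau> x) vs) \<subseteq> E"
      using vs field x by (auto dest!: diff_fieldD(1))
    then have "set ?us \<subseteq> E"
      using set_take_subset[of i "map (\<lambda>v. dir_deriv V v \<tau> x) vs"]
        set_drop_subset[of "Suc i" "map (\<lambda>v. dir_deriv V v \<tau> x) vs"] by auto
    moreover have "\<tau> x \<in> W" using x \<tau>(2) by blast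
    ultimately have "dir_deriv V (vs ! i) (\<lambda>y. \<phi> (\<tau> y) ?us) x =
        dir_deriv W (dir_deriv V (vs ! i) \<tau> x) (\<lambda>z. \<phi> z ?us) (\<tau> x)"
      by (intro dir_deriv_chain[OF assms(1) smooth_differentiable[OF \<tau>(1) x] _ \<tau>(2) x v]
          W.smooth_coeffs_differentiable[OF \<phi>(1)])
    then show "(-1) ^ i * dir_deriv V (vs ! i) (\<lambda>y. \<phi> (\<tau> y)
          (map (\<lambda>Y. Y y) (take i (map (\<lambda>Y _. Y x) ?Ys) @ drop (Suc i) (map (\<lambda>Y _. Y x) ?Ys)))) x =
        (-1) ^ i * dir_deriv W (map (\<lambda>v. dir_deriv V v \<tau> x) vs ! i) (\<lambda>y. \<phi> y ?us) (\<tau> x)"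
      using i by (simp add: take_map drop_map o_def)
  qed simp
  finally show ?thesis .
qed

end


section \<open>The de Rham complex of a manifold\<close>

definition in_chart :: "('a, 'e) chart \<Rightarrow> ('a, 'e) form \<Rightarrow> 'e \<Rightarrow> 'e list \<Rightarrow> real" where
  "in_chart c \<omega> = (\<lambda>x. \<omega> c (chart_inv c x))"

abbreviation chart_image :: "('a, 'e) chart \<Rightarrow> 'e set" where
  "chart_image c \<equiv> chart_map c ` chart_dom c"

lemma wedge_eq_shuffle: "wedge \<alpha> \<beta> c p = shuffle (\<alpha> c p) (\<beta> c p)"
  by (simp add: wedge_def shuffle_def fun_eq_iff)

lemma par_1: "par (Suc 0) \<omega> c p = alt_sign (\<omega> c p)"
  by (simp add: par_def alt_sign_def fun_eq_iff)

lemma par_0 [simp]: "par 0 \<omega> = \<omega>"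
  by (simp add: par_def)

lemma is_form_iff:
  "is_form E A \<omega> \<longleftrightarrow>
     (\<forall>c p vs. \<not> (c \<in> A \<and> p \<in> chart_dom c \<and> set vs \<subseteq> E) \<longrightarrow> \<omega> c p vs = 0) \<and>
     (\<forall>c\<in>A. \<forall>p\<in>chart_dom c. multilinear E (\<omega> c p)) \<and>
     (\<forall>c\<in>A. \<forall>p\<in>chart_dom c. alt E (\<omega> c p)) \<and>
     (\<forall>c\<in>A. \<forall>c'\<in>A. \<forall>p\<in>chart_dom c \<inter> chart_dom c'. \<forall>vs. set vs \<subseteq> E \<longrightarrow>
        \<omega> c p vs = \<omega> c' p
          (map (\<lambda>v. dir_deriv (overlap c c') v (transition c c') (chart_map c p)) vs)) \<and>
     (\<forall>c\<in>A. smooth_coeffs E (chart_image c) (in_chart c \<omega>))"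
  unfolding is_form_def multilinear_def alt_def smooth_coeffs_def in_chart_def dir_deriv_def ..

lemma shuffle_map: "shuffle \<alpha> \<beta> (map f vs) = shuffle (\<lambda>us. \<alpha> (map f us)) (\<lambda>us. \<beta> (map f us)) vs"
  by (simp add: shuffle_def nths_map)

lemma length_nths_compl:
  assumes "I \<subseteq> {..<length vs}"
  shows "length (nths vs I) + length (nths vs ({..<length vs} - I)) = length vs"
proof -
  have "{i. i < length vs \<and> i \<in> I} = I" "{i. i < length vs \<and> i \<in> {..<length vs} - I} = {..<length vs} - I"
    using assms by auto
  then show ?thesis
    using assms card_mono[OF _ assms] finite_subset[OF assms] by (simp add: length_nths card_Diff_subset)
qed

text \<open>A common vanishing test for supports and degrees: splitting a list preserves the union
  of the entries and the sum of the lengths.\<close>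

lemma shuffle_eq_0:
  assumes "\<And>us ws. set us \<subseteq> set vs \<Longrightarrow> set ws \<subseteq> set vs \<Longrightarrow> set vs \<subseteq> set us \<union> set ws \<Longrightarrow>
     length us + length ws = length vs \<Longrightarrow> \<alpha> us = 0 \<or> \<beta> ws = 0"
  shows "shuffle \<alpha> \<beta> vs = 0"
  unfolding shuffle_def
proof (rule sum.neutral, rule ballI)
  fix I assume "I \<in> Pow {..<length vs}"
  then have I: "I \<subseteq> {..<length vs}" by simp
  have "set vs \<subseteq> set (nths vs I) \<union> set (nths vs ({..<length vs} - I))"
  proof
    fix v assume "v \<in> set vs"
    then obtain i where "i < length vs" "v = vs ! i" by (metis in_set_conv_nth)
    then show "v \<in> set (nths vs I) \<union> set (nths vs ({..<length vs} - I))"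
      by (cases "i \<in> I") (auto simp: set_nths)
  qed
  then have "\<alpha> (nths vs I) = 0 \<or> \<beta> (nths vs ({..<length vs} - I)) = 0"
    by (intro assms set_nths_subset length_nths_compl I)
  then show "shuffle_sign I ({..<length vs} - I) * (\<alpha> (nths vs I) * \<beta> (nths vs ({..<length vs} - I))) = 0"
    by auto
qed

section \<open>Charts, overlaps and the operations on forms\<close>

locale manifold =
  fixes X :: "'a topology" and E :: "'e::euclidean_space set" and A :: "('a, 'e) chart set"
  assumes smooth_manifold: "smooth_manifold X E A"
begin

lemma subspace_E: "subspace E"
  using smooth_manifold by (simp add: smooth_manifold_def)

lemma chart: "c \<in> A \<Longrightarrow> is_chart X E c"
  using smooth_manifold by (simp add: smooth_manifold_def)

lemma open_chart_image: "c \<in> A \<Longrightarrow> open_in_subspace E (chart_image c)"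
  using chart subspace_E by (simp add: is_chart_def open_in_subspace_def)

lemma chart_dom_subset: "c \<in> A \<Longrightarrow> chart_dom c \<subseteq> topspace X"
  using chart by (simp add: is_chart_def openin_subset)

lemma chart_inj: "c \<in> A \<Longrightarrow> inj_on (chart_map c) (chart_dom c)"
  using chart[of c] chart_dom_subset[of c] homeomorphic_imp_injective_map
  unfolding is_chart_def by (metis topspace_subtopology_subset)

lemma chart_inv_chart_map [simp]: "c \<in> A \<Longrightarrow> p \<in> chart_dom c \<Longrightarrow> chart_inv c (chart_map c p) = p"
  by (simp add: chart_inj inv_into_f_f)

text \<open>The chart map is open onto its image, and relative openness is transitive.\<close>

lemma open_overlap:
  assumes "c \<in> A" "c' \<in> A"
  shows "open_in_subspace E (overlap c c')"
proof -
  have "openin (subtopology X (chart_dom c)) (chart_dom c \<inter> chart_dom c')"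
    using chart[OF assms(2)] chart[OF assms(1)]
    unfolding is_chart_def by (simp add: openin_subtopology_Int2)
  moreover have "open_map (subtopology X (chart_dom c)) (top_of_set (chart_image c)) (chart_map c)"
    using chart[OF assms(1)] unfolding is_chart_def by (simp add: homeomorphic_imp_open_map)
  ultimately have "openin (top_of_set (chart_image c)) (overlap c c')"
    unfolding open_map_def overlap_def by blast
  then have "openin (top_of_set E) (overlap c c')"
    using chart[OF assms(1)] unfolding is_chart_def by (meson openin_trans)
  then show ?thesis
    by (simp add: open_in_subspace_def subspace_E)
qed

lemma overlap_subset: "overlap c c' \<subseteq> chart_image c" for c c' :: "('a, 'e) chart"
  by (auto simp: overlap_def)

lemma transition_chart_map:
  "c \<in> A \<Longrightarrow> p \<in> chart_dom c \<Longrightarrow> transition c c' (chart_map c p) = chart_map c' p"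
  by (simp add: transition_def)

lemma smooth_transition: "c \<in> A \<Longrightarrow> c' \<in> A \<Longrightarrow> smooth_on E (overlap c c') (transition c c')"
  using smooth_manifold by (simp add: smooth_manifold_def)

lemma transition_image: "c \<in> A \<Longrightarrow> transition c c' ` overlap c c' \<subseteq> chart_image c'"
  by (auto simp: overlap_def transition_chart_map)

lemma form_support: "is_form E A \<omega> \<Longrightarrow> \<not> (c \<in> A \<and> p \<in> chart_dom c \<and> set vs \<subseteq> E) \<Longrightarrow> \<omega> c p vs = 0"
  unfolding is_form_iff by blast

lemma form_multilinear: "is_form E A \<omega> \<Longrightarrow> c \<in> A \<Longrightarrow> p \<in> chart_dom c \<Longrightarrow> multilinear E (\<omega> c p)"
  unfolding is_form_iff by blast

lemma form_alt: "is_form E A \<omega> \<Longrightarrow> c \<in> A \<Longrightarrow> p \<in> chart_dom c \<Longrightarrow> alt E (\<omega> c p)"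
  unfolding is_form_iff by blast

lemma form_change:
  "is_form E A \<omega> \<Longrightarrow> c \<in> A \<Longrightarrow> c' \<in> A \<Longrightarrow> p \<in> chart_dom c \<Longrightarrow> p \<in> chart_dom c' \<Longrightarrow> set vs \<subseteq> E \<Longrightarrow>
     \<omega> c p vs = \<omega> c' p (map (\<lambda>v. dir_deriv (overlap c c') v (transition c c') (chart_map c p)) vs)"
  unfolding is_form_iff by blast

lemma form_smooth_coeffs: "is_form E A \<omega> \<Longrightarrow> c \<in> A \<Longrightarrow> smooth_coeffs E (chart_image c) (in_chart c \<omega>)"
  unfolding is_form_iff by blast

lemma is_formI:
  assumes "\<And>c p vs. \<not> (c \<in> A \<and> p \<in> chart_dom c \<and> set vs \<subseteq> E) \<Longrightarrow> \<omega> c p vs = 0"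
    "\<And>c p. c \<in> A \<Longrightarrow> p \<in> chart_dom c \<Longrightarrow> multilinear E (\<omega> c p)"
    "\<And>c p. c \<in> A \<Longrightarrow> p \<in> chart_dom c \<Longrightarrow> alt E (\<omega> c p)"
    "\<And>c c' p vs. c \<in> A \<Longrightarrow> c' \<in> A \<Longrightarrow> p \<in> chart_dom c \<Longrightarrow> p \<in> chart_dom c' \<Longrightarrow> set vs \<subseteq> E \<Longrightarrow>
      \<omega> c p vs = \<omega> c' p (map (\<lambda>v. dir_deriv (overlap c c') v (transition c c') (chart_map c p)) vs)"
    "\<And>c. c \<in> A \<Longrightarrow> smooth_coeffs E (chart_image c) (in_chart c \<omega>)"
  shows "is_form E A \<omega>"
  unfolding is_form_iff using assms by blast

lemma is_form_zero: "is_form E A 0"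
proof (rule is_formI)
  fix c assume "c \<in> A"
  then interpret open_in_subspace E "chart_image c" by (rule open_chart_image)
  show "smooth_coeffs E (chart_image c) (in_chart c 0)" by (simp add: smooth_coeffs_def in_chart_def)
qed (simp_all add: multilinear_def alt_def)

lemma is_form_add:
  assumes "is_form E A \<alpha>" "is_form E A \<beta>"
  shows "is_form E A (\<alpha> + \<beta>)"
proof (rule is_formI)
  fix c assume c: "c \<in> A"
  then interpret open_in_subspace E "chart_image c" by (rule open_chart_image)
  show "smooth_coeffs E (chart_image c) (in_chart c (\<alpha> + \<beta>))"
    using smooth_coeffs_add[OF form_smooth_coeffs[OF assms(1) c] form_smooth_coeffs[OF assms(2) c]] by (simp add: in_chart_def plus_fun_def)
next
  fix c p assume c: "c \<in> A" "p \<in> chart_dom c"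
  show "multilinear E ((\<alpha> + \<beta>) c p)"
    by (rule multilinearI) (simp add: multilinearD[OF form_multilinear[OF assms(1) c]] multilinearD[OF form_multilinear[OF assms(2) c]] algebra_simps)
  show "alt E ((\<alpha> + \<beta>) c p)"
    using form_alt[OF assms(1) c] form_alt[OF assms(2) c] by (simp add: alt_def)
next
  fix c c' p vs assume *: "c \<in> A" "c' \<in> A" "p \<in> chart_dom c" "p \<in> chart_dom c'" "set vs \<subseteq> E"
  show "(\<alpha> + \<beta>) c p vs = (\<alpha> + \<beta>) c' p (map (\<lambda>v. dir_deriv (overlap c c') v (transition c c') (chart_map c p)) vs)"
    using form_change[OF assms(1) *] form_change[OF assms(2) *] by simp
next
  fix c p vs assume "\<not> (c \<in> A \<and> p \<in> chart_dom c \<and> set vs \<subseteq> E)"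
  from form_support[OF assms(1) this] form_support[OF assms(2) this]
  show "(\<alpha> + \<beta>) c p vs = 0" by simp
qed

lemma is_form_scale:
  assumes "is_form E A \<alpha>"
  shows "is_form E A (fscale r \<alpha>)"
proof (rule is_formI)
  fix c assume c: "c \<in> A"
  then interpret open_in_subspace E "chart_image c" by (rule open_chart_image)
  show "smooth_coeffs E (chart_image c) (in_chart c (fscale r \<alpha>))"
    using smooth_coeffs_scale[OF form_smooth_coeffs[OF assms(1) c]] by (simp add: in_chart_def fscale_def)
next
  fix c p assume c: "c \<in> A" "p \<in> chart_dom c"
  show "multilinear E (fscale r \<alpha> c p)"
    by (rule multilinearI) (simp add: fscale_def multilinearD[OF form_multilinear[OF assms(1) c]] algebra_simps)
  show "alt E (fscale r \<alpha> c p)"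
    using form_alt[OF assms(1) c] by (simp add: alt_def fscale_def)
next
  fix c c' p vs assume *: "c \<in> A" "c' \<in> A" "p \<in> chart_dom c" "p \<in> chart_dom c'" "set vs \<subseteq> E"
  show "fscale r \<alpha> c p vs = fscale r \<alpha> c' p (map (\<lambda>v. dir_deriv (overlap c c') v (transition c c') (chart_map c p)) vs)"
    using form_change[OF assms(1) *] by (simp add: fscale_def)
next
  fix c p vs assume "\<not> (c \<in> A \<and> p \<in> chart_dom c \<and> set vs \<subseteq> E)"
  from form_support[OF assms this] show "fscale r \<alpha> c p vs = 0" by (simp add: fscale_def)
qed

lemma is_form_par_1:
  assumes "is_form E A \<alpha>"
  shows "is_form E A (par (Suc 0) \<alpha>)"
proof (rule is_formI)
  fix c assume c: "c \<in> A"
  then interpret open_in_subspace E "chart_image c" by (rule open_chart_image)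
  show "smooth_coeffs E (chart_image c) (in_chart c (par (Suc 0) \<alpha>))"
    using smooth_coeffs_alt_sign[OF form_smooth_coeffs[OF assms(1) c]] by (simp add: in_chart_def par_1)
next
  fix c p assume c: "c \<in> A" "p \<in> chart_dom c"
  show "multilinear E (par (Suc 0) \<alpha> c p)"
    unfolding par_1 by (rule multilinear_alt_sign[OF form_multilinear[OF assms c]])
  show "alt E (par (Suc 0) \<alpha> c p)"
    using form_alt[OF assms(1) c] by (simp add: alt_def par_def)
next
  fix c c' p vs assume *: "c \<in> A" "c' \<in> A" "p \<in> chart_dom c" "p \<in> chart_dom c'" "set vs \<subseteq> E"
  show "par (Suc 0) \<alpha> c p vs =
      par (Suc 0) \<alpha> c' p (map (\<lambda>v. dir_deriv (overlap c c') v (transition c c') (chart_map c p)) vs)"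
    using form_change[OF assms(1) *] by (simp add: par_def)
next
  fix c p vs assume "\<not> (c \<in> A \<and> p \<in> chart_dom c \<and> set vs \<subseteq> E)"
  from form_support[OF assms this] show "par (Suc 0) \<alpha> c p vs = 0" by (simp add: par_def)
qed

lemma is_form_wedge:
  assumes \<alpha>: "is_form E A \<alpha>" and \<beta>: "is_form E A \<beta>"
  shows "is_form E A (wedge \<alpha> \<beta>)"
proof (rule is_formI)
  fix c p vs assume *: "\<not> (c \<in> A \<and> p \<in> chart_dom c \<and> set vs \<subseteq> E)"
  show "wedge \<alpha> \<beta> c p vs = 0"
    unfolding wedge_eq_shuffle
  proof (rule shuffle_eq_0)
    \<comment> \<open>If \<open>vs\<close> leaves \<open>E\<close>, then so does one of its two
      parts.\<close>
    fix us ws assume "set vs \<subseteq> set us \<union> set ws"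
    with * have "\<not> (c \<in> A \<and> p \<in> chart_dom c \<and> set us \<subseteq> E) \<or> \<not> (c \<in> A \<and> p \<in> chart_dom c \<and> set ws \<subseteq> E)"
      by blast
    then show "\<alpha> c p us = 0 \<or> \<beta> c p ws = 0"
      using form_support[OF \<alpha>] form_support[OF \<beta>] by blast
  qed
next
  fix c assume c: "c \<in> A"
  then interpret open_in_subspace E "chart_image c" by (rule open_chart_image)
  show "smooth_coeffs E (chart_image c) (in_chart c (wedge \<alpha> \<beta>))"
    using smooth_coeffs_shuffle[OF form_smooth_coeffs[OF \<alpha> c] form_smooth_coeffs[OF \<beta> c]] by (simp add: in_chart_def wedge_eq_shuffle)
next
  fix c p assume c: "c \<in> A" "p \<in> chart_dom c"
  show "multilinear E (wedge \<alpha> \<beta> c p)" "alt E (wedge \<alpha> \<beta> c p)"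
    unfolding wedge_eq_shuffle
    by (rule multilinear_shuffle[OF form_multilinear[OF \<alpha> c] form_multilinear[OF \<beta> c]],
        rule alt_shuffle[OF form_multilinear[OF \<alpha> c] form_multilinear[OF \<beta> c] form_alt[OF \<alpha> c] form_alt[OF \<beta> c] subspace_E])
next
  fix c c' p vs assume *: "c \<in> A" "c' \<in> A" "p \<in> chart_dom c" "p \<in> chart_dom c'" "set vs \<subseteq> E"
  show "wedge \<alpha> \<beta> c p vs =
      wedge \<alpha> \<beta> c' p (map (\<lambda>v. dir_deriv (overlap c c') v (transition c c') (chart_map c p)) vs)"
    \<comment> \<open>Splitting a list commutes with mapping the derivative of the transition over
      it.\<close>
    unfolding wedge_eq_shuffle shuffle_map
    by (rule shuffle_cong[OF *(5) form_change[OF \<alpha> *(1-4)] form_change[OF \<beta> *(1-4)]])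
qed

lemma deRham_eq_dloc:
  assumes "c \<in> A" "p \<in> chart_dom c" "set vs \<subseteq> E"
  shows "deRham E A \<omega> c p vs = dloc (chart_image c) (in_chart c \<omega>) (chart_map c p) vs"
  using assms by (simp add: deRham_def dloc_def in_chart_def dir_deriv_def)

lemma in_chart_deRham:
  assumes "c \<in> A" "x \<in> chart_image c" "set vs \<subseteq> E"
  shows "in_chart c (deRham E A \<omega>) x vs = dloc (chart_image c) (in_chart c \<omega>) x vs"
  using assms by (auto simp: in_chart_def deRham_eq_dloc)

text \<open>The transition map is smooth on the overlap only, so chart changes are compared there;
  locality of the differential allows the restriction.\<close>

lemma dloc_overlap:
  assumes "is_form E A \<omega>" "c \<in> A" "c' \<in> A" "x \<in> overlap c c'" "set vs \<subseteq> E"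
  shows "dloc (chart_image c) (in_chart c \<omega>) x vs = dloc (overlap c c') (in_chart c \<omega>) x vs"
proof -
  interpret open_in_subspace E "chart_image c" by (rule open_chart_image) fact
  interpret W: open_in_subspace E "overlap c c'" by (rule open_overlap) fact+
  have x: "x \<in> chart_image c" using assms(4) overlap_subset by blast
  show ?thesis
    unfolding dloc_def
  proof (rule sum.cong[OF refl])
    fix i assume "i \<in> {..<length vs}"
    then have "vs ! i \<in> E" using assms(5) nth_mem by fastforce
    moreover have "set (take i vs @ drop (Suc i) vs) \<subseteq> E"
      using assms(5) set_take_subset[of i vs] set_drop_subset[of "Suc i" vs] by auto
    ultimately show "(-1) ^ i * dir_deriv (chart_image c) (vs ! i) (\<lambda>y. in_chart c \<omega> y (take i vs @ drop (Suc i) vs)) x =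
        (-1) ^ i * dir_deriv (overlap c c') (vs ! i) (\<lambda>y. in_chart c \<omega> y (take i vs @ drop (Suc i) vs)) x"
      using dir_deriv_subset[OF overlap_subset W.openin_V
          smooth_coeffs_differentiable[OF form_smooth_coeffs[OF assms(1,2)] _ x] assms(4)] by simp
  qed
qed

text \<open>Independence of the chart is the clause with content: it is naturality of the
  differential under the transition map. The other clauses are transported from \<open>dloc\<close>,
  with which \<open>deRham\<close> agrees on lists from \<open>E\<close>.\<close>

lemma is_form_deRham:
  assumes "is_form E A \<omega>"
  shows "is_form E A (deRham E A \<omega>)"
proof (rule is_formI)
  fix c p vs assume "\<not> (c \<in> A \<and> p \<in> chart_dom c \<and> set vs \<subseteq> E)"
  then show "deRham E A \<omega> c p vs = 0" by (auto simp: deRham_def)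
next
  fix c assume c: "c \<in> A"
  interpret open_in_subspace E "chart_image c" by (rule open_chart_image) fact
  show "smooth_coeffs E (chart_image c) (in_chart c (deRham E A \<omega>))"
    unfolding smooth_coeffs_def
  proof (intro allI impI)
    fix vs :: "'e list" assume vs: "set vs \<subseteq> E"
    have "smooth_on E (chart_image c) (\<lambda>x. in_chart c (deRham E A \<omega>) x vs) \<longleftrightarrow>
        smooth_on E (chart_image c) (\<lambda>x. dloc (chart_image c) (in_chart c \<omega>) x vs)"
      by (rule smooth_on_cong) (rule in_chart_deRham[OF c _ vs])
    with smooth_coeffsD[OF smooth_coeffs_dloc[OF form_smooth_coeffs[OF assms c]] vs]
    show "smooth_on E (chart_image c) (\<lambda>x. in_chart c (deRham E A \<omega>) x vs)"
      by (simp only:)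
  qed
next
  fix c p assume c: "c \<in> A" "p \<in> chart_dom c"
  interpret open_in_subspace E "chart_image c" by (rule open_chart_image) fact
  note p = imageI[OF c(2), of "chart_map c"]
  have ml: "multilinear E (in_chart c \<omega> x)" and al: "alt E (in_chart c \<omega> x)" if "x \<in> chart_image c" for x
    using that form_multilinear[OF assms c(1)] form_alt[OF assms c(1)] c(1) by (auto simp: in_chart_def)
  have m: "multilinear E (dloc (chart_image c) (in_chart c \<omega>) (chart_map c p))"
    by (rule multilinear_dloc[OF form_smooth_coeffs[OF assms c(1)] ml p])
  show "multilinear E (deRham E A \<omega> c p)"
  proof (rule multilinearI)
    fix us ws u v r s
    assume us: "set us \<subseteq> E" and ws: "set ws \<subseteq> E" and u: "u \<in> E" and v: "v \<in> E"
    \<comment> \<open>The combination must lie in \<open>E\<close> before \<open>deRham\<close> may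
      be replaced by \<open>dloc\<close> on this list.\<close>
    moreover have "r *\<^sub>R u + s *\<^sub>R v \<in> E"
      using u v by (intro subspace_add subspace_scale subspace_E)
    ultimately show "deRham E A \<omega> c p (us @ (r *\<^sub>R u + s *\<^sub>R v) # ws) =
        r * deRham E A \<omega> c p (us @ u # ws) + s * deRham E A \<omega> c p (us @ v # ws)"
      using multilinearD[OF m u v us ws] c by (simp add: deRham_eq_dloc)
  qed
  have "alt E (dloc (chart_image c) (in_chart c \<omega>) (chart_map c p))"
    by (rule alt_dloc[OF form_smooth_coeffs[OF assms c(1)] ml al p])
  then show "alt E (deRham E A \<omega> c p)"
    using c by (simp add: alt_def deRham_eq_dloc)
next
  fix c c' p vs assume *: "c \<in> A" "c' \<in> A" "p \<in> chart_dom c" "p \<in> chart_dom c'" "set vs \<subseteq> E"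
  interpret W: open_in_subspace E "overlap c c'" by (rule open_overlap) fact+
  let ?D = "\<lambda>y v. dir_deriv (overlap c c') v (transition c c') y"
  have x: "chart_map c p \<in> overlap c c'" using * by (auto simp: overlap_def)
  have ml: "multilinear E (in_chart c' \<omega> x)" and al: "alt E (in_chart c' \<omega> x)" if "x \<in> chart_image c'" for x
    using that form_multilinear[OF assms *(2)] form_alt[OF assms *(2)] *(2) by (auto simp: in_chart_def)
  have "transition c c' ` overlap c c' \<subseteq> E"
    using transition_image[OF *(1)] open_in_subspace.V_subset[OF open_chart_image[OF *(2)]] by blast
  then have E: "set (map (?D (chart_map c p)) vs) \<subseteq> E"
    using W.dir_deriv_in_subspace[OF W.smooth_differentiable[OF smooth_transition[OF *(1,2)] x] _ x] *(5) by auto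
  have "deRham E A \<omega> c p vs = dloc (overlap c c') (in_chart c \<omega>) (chart_map c p) vs"
    using * by (simp add: deRham_eq_dloc dloc_overlap[OF assms *(1,2) x])
  \<comment> \<open>Chart independence of the given form says that its expression in
    \<open>c\<close> is the pullback of its expression in \<open>c'\<close>.\<close>
  also have "\<dots> = dloc (overlap c c') (\<lambda>y us. in_chart c' \<omega> (transition c c' y) (map (?D y) us)) (chart_map c p) vs"
  proof (rule W.dloc_cong[OF _ x *(5)])
    fix y us assume "y \<in> overlap c c'" and us: "set us \<subseteq> E"
    then obtain r where r: "r \<in> chart_dom c" "r \<in> chart_dom c'" "y = chart_map c r"
      by (auto simp: overlap_def)
    then show "in_chart c \<omega> y us = in_chart c' \<omega> (transition c c' y) (map (?D y) us)"
      using form_change[OF assms *(1,2) r(1,2) us] * by (simp add: in_chart_def transition_chart_map)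
  qed
  also have "\<dots> = dloc (chart_image c') (in_chart c' \<omega>) (transition c c' (chart_map c p)) (map (?D (chart_map c p)) vs)"
    by (rule W.dloc_pullback[OF open_chart_image[OF *(2)] smooth_transition[OF *(1,2)] transition_image[OF *(1)]
          form_smooth_coeffs[OF assms *(2)] ml al x *(5)])
  also have "\<dots> = deRham E A \<omega> c' p (map (?D (chart_map c p)) vs)"
    unfolding deRham_eq_dloc[OF *(2,4) E] transition_chart_map[OF *(1,3)] ..
  finally show "deRham E A \<omega> c p vs = deRham E A \<omega> c' p (map (?D (chart_map c p)) vs)" .
qed

lemma form_eqI:
  assumes "is_form E A \<alpha>" "is_form E A \<beta>"
    "\<And>c p vs. c \<in> A \<Longrightarrow> p \<in> chart_dom c \<Longrightarrow> set vs \<subseteq> E \<Longrightarrow> \<alpha> c p vs = \<beta> c p vs"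
  shows "\<alpha> = \<beta>"
proof (intro ext)
  fix c p vs
  show "\<alpha> c p vs = \<beta> c p vs"
    using assms(3)[of c p vs] form_support[OF assms(1), of c p vs] form_support[OF assms(2), of c p vs]
    by metis
qed

lemma deRham_add:
  assumes "is_form E A \<alpha>" "is_form E A \<beta>"
  shows "deRham E A (\<alpha> + \<beta>) = deRham E A \<alpha> + deRham E A \<beta>"
proof (rule form_eqI)
  fix c p vs assume *: "c \<in> A" "p \<in> chart_dom c" "set vs \<subseteq> E"
  interpret open_in_subspace E "chart_image c" by (rule open_chart_image) fact
  have "in_chart c (\<alpha> + \<beta>) = (\<lambda>x vs. in_chart c \<alpha> x vs + in_chart c \<beta> x vs)"
    by (simp add: in_chart_def plus_fun_def)
  then have "deRham E A (\<alpha> + \<beta>) c p vs =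
      dloc (chart_image c) (\<lambda>x vs. in_chart c \<alpha> x vs + in_chart c \<beta> x vs) (chart_map c p) vs"
    using deRham_eq_dloc[OF *] by simp
  also have "\<dots> = dloc (chart_image c) (in_chart c \<alpha>) (chart_map c p) vs + dloc (chart_image c) (in_chart c \<beta>) (chart_map c p) vs"
    by (rule dloc_add[OF form_smooth_coeffs[OF assms(1) *(1)] form_smooth_coeffs[OF assms(2) *(1)] imageI[OF *(2)] *(3)])
  finally show "deRham E A (\<alpha> + \<beta>) c p vs = (deRham E A \<alpha> + deRham E A \<beta>) c p vs"
    using deRham_eq_dloc[OF *] by simp
qed (simp_all add: is_form_deRham is_form_add assms)

lemma deRham_scale:
  assumes "is_form E A \<alpha>"
  shows "deRham E A (fscale r \<alpha>) = fscale r (deRham E A \<alpha>)"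
proof (rule form_eqI)
  fix c p vs assume *: "c \<in> A" "p \<in> chart_dom c" "set vs \<subseteq> E"
  interpret open_in_subspace E "chart_image c" by (rule open_chart_image) fact
  have "in_chart c (fscale r \<alpha>) = (\<lambda>x vs. r * in_chart c \<alpha> x vs)"
    by (simp add: in_chart_def fscale_def)
  then have "deRham E A (fscale r \<alpha>) c p vs = dloc (chart_image c) (\<lambda>x vs. r * in_chart c \<alpha> x vs) (chart_map c p) vs"
    using deRham_eq_dloc[OF *] by simp
  also have "\<dots> = r * dloc (chart_image c) (in_chart c \<alpha>) (chart_map c p) vs"
    by (rule dloc_scale[OF form_smooth_coeffs[OF assms(1) *(1)] imageI[OF *(2)] *(3)])
  finally show "deRham E A (fscale r \<alpha>) c p vs = fscale r (deRham E A \<alpha>) c p vs"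
    using deRham_eq_dloc[OF *] by (simp add: fscale_def)
qed (simp_all add: is_form_deRham is_form_scale assms)

lemma deRham_par_1:
  assumes "is_form E A \<alpha>"
  shows "deRham E A (par (Suc 0) \<alpha>) = fscale (-1) (par (Suc 0) (deRham E A \<alpha>))"
proof (rule form_eqI)
  fix c p vs assume *: "c \<in> A" "p \<in> chart_dom c" "set vs \<subseteq> E"
  interpret open_in_subspace E "chart_image c" by (rule open_chart_image) fact
  have "in_chart c (par (Suc 0) \<alpha>) = (\<lambda>x. alt_sign (in_chart c \<alpha> x))"
    by (simp add: in_chart_def par_1)
  then have "deRham E A (par (Suc 0) \<alpha>) c p vs =
      dloc (chart_image c) (\<lambda>x. alt_sign (in_chart c \<alpha> x)) (chart_map c p) vs"
    using deRham_eq_dloc[OF *] by simp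
  also have "\<dots> = - alt_sign (dloc (chart_image c) (in_chart c \<alpha>) (chart_map c p)) vs"
    by (rule dloc_alt_sign[OF form_smooth_coeffs[OF assms(1) *(1)] imageI[OF *(2)] *(3)])
  finally show "deRham E A (par (Suc 0) \<alpha>) c p vs = fscale (-1) (par (Suc 0) (deRham E A \<alpha>)) c p vs"
    using deRham_eq_dloc[OF *] by (simp add: fscale_def par_def alt_sign_def)
qed (simp_all add: is_form_deRham is_form_scale is_form_par_1 assms)

lemma deRham_deRham:
  assumes "is_form E A \<omega>"
  shows "deRham E A (deRham E A \<omega>) = 0"
proof (rule form_eqI)
  fix c p vs assume *: "c \<in> A" "p \<in> chart_dom c" "set vs \<subseteq> E"
  interpret open_in_subspace E "chart_image c" by (rule open_chart_image) fact
  note p = imageI[OF *(2), of "chart_map c"]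
  have "deRham E A (deRham E A \<omega>) c p vs = dloc (chart_image c) (dloc (chart_image c) (in_chart c \<omega>)) (chart_map c p) vs"
    unfolding deRham_eq_dloc[OF *] by (rule dloc_cong[OF in_chart_deRham[OF *(1)] p *(3)])
  also have "\<dots> = 0"
    by (rule dloc_dloc[OF form_smooth_coeffs[OF assms *(1)] p *(3)])
  finally show "deRham E A (deRham E A \<omega>) c p vs = 0 c p vs" by simp
qed (simp_all add: is_form_deRham is_form_zero assms)

lemma deRham_wedge:
  assumes "is_form E A \<alpha>" "is_form E A \<beta>"
  shows "deRham E A (wedge \<alpha> \<beta>) = wedge (deRham E A \<alpha>) \<beta> + wedge (par (Suc 0) \<alpha>) (deRham E A \<beta>)"
proof (rule form_eqI)
  fix c p vs assume *: "c \<in> A" "p \<in> chart_dom c" "set vs \<subseteq> E"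
  interpret open_in_subspace E "chart_image c" by (rule open_chart_image) fact
  note p = imageI[OF *(2), of "chart_map c"]
  have in_chart: "in_chart c \<omega> (chart_map c p) = \<omega> c p" for \<omega> :: "('a, 'e) form"
    using * by (simp add: in_chart_def)
  have "in_chart c (wedge \<alpha> \<beta>) = (\<lambda>x. shuffle (in_chart c \<alpha> x) (in_chart c \<beta> x))"
    by (simp add: in_chart_def wedge_eq_shuffle)
  then have "deRham E A (wedge \<alpha> \<beta>) c p vs =
      shuffle (dloc (chart_image c) (in_chart c \<alpha>) (chart_map c p)) (\<beta> c p) vs +
      shuffle (alt_sign (\<alpha> c p)) (dloc (chart_image c) (in_chart c \<beta>) (chart_map c p)) vs"
    unfolding deRham_eq_dloc[OF *]
    using dloc_shuffle[OF form_smooth_coeffs[OF assms(1) *(1)] form_smooth_coeffs[OF assms(2) *(1)] p *(3)] by (simp add: in_chart)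
  also have "shuffle (dloc (chart_image c) (in_chart c \<alpha>) (chart_map c p)) (\<beta> c p) vs = wedge (deRham E A \<alpha>) \<beta> c p vs"
    unfolding wedge_eq_shuffle by (rule shuffle_cong[OF *(3) deRham_eq_dloc[OF *(1,2), symmetric] refl])
  also have "shuffle (alt_sign (\<alpha> c p)) (dloc (chart_image c) (in_chart c \<beta>) (chart_map c p)) vs =
      wedge (par (Suc 0) \<alpha>) (deRham E A \<beta>) c p vs"
    unfolding wedge_eq_shuffle par_1 by (rule shuffle_cong[OF *(3) refl deRham_eq_dloc[OF *(1,2), symmetric]])
  finally show "deRham E A (wedge \<alpha> \<beta>) c p vs =
      (wedge (deRham E A \<alpha>) \<beta> + wedge (par (Suc 0) \<alpha>) (deRham E A \<beta>)) c p vs"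
    by simp
qed (simp_all add: is_form_deRham is_form_wedge is_form_add is_form_par_1 assms)

end

section \<open>Algebra of the wedge product and homogeneous forms\<close>

lemma wedge_assoc: "wedge (wedge \<alpha> \<beta>) \<gamma> = wedge \<alpha> (wedge \<beta> \<gamma>)"
proof (intro ext)
  fix c p vs
  have *: "wedge \<alpha> \<beta> c p = shuffle (\<alpha> c p) (\<beta> c p)" for \<alpha> \<beta> :: "('a, 'b) form"
    by (rule wedge_eq_shuffle)
  show "wedge (wedge \<alpha> \<beta>) \<gamma> c p vs = wedge \<alpha> (wedge \<beta> \<gamma>) c p vs"
    unfolding * by (rule shuffle_assoc)
qed

lemma wedge_add_left: "wedge (\<alpha> + \<alpha>') \<beta> = wedge \<alpha> \<beta> + wedge \<alpha>' \<beta>"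
  and wedge_add_right: "wedge \<alpha> (\<beta> + \<beta>') = wedge \<alpha> \<beta> + wedge \<alpha> \<beta>'"
  by (simp_all add: wedge_def fun_eq_iff sum.distrib distrib_left distrib_right)

lemma wedge_scale_left: "wedge (fscale r \<alpha>) \<beta> = fscale r (wedge \<alpha> \<beta>)"
  and wedge_scale_right: "wedge \<alpha> (fscale r \<beta>) = fscale r (wedge \<alpha> \<beta>)"
  by (simp_all add: wedge_def fscale_def fun_eq_iff sum_distrib_left mult_ac)

lemma wedge_zero_left [simp]: "wedge 0 \<beta> = 0"
  and wedge_zero_right [simp]: "wedge \<alpha> 0 = 0"
  by (simp_all add: wedge_def fun_eq_iff)

lemma par_add: "par r (\<alpha> + \<beta>) = par r \<alpha> + par r \<beta>"
  by (simp add: par_def fun_eq_iff distrib_left)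

lemma par_scale: "par r (fscale s \<alpha>) = fscale s (par r \<alpha>)"
  by (simp add: par_def fscale_def fun_eq_iff)

lemma par_zero [simp]: "par r 0 = 0"
  by (simp add: par_def fun_eq_iff)

lemma par_par [simp]: "par r (par r \<alpha>) = \<alpha>"
  by (simp add: par_def fun_eq_iff flip: mult.assoc power_add)

lemma par_wedge: "par (Suc 0) (wedge \<alpha> \<beta>) = wedge (par (Suc 0) \<alpha>) (par (Suc 0) \<beta>)"
  by (simp add: fun_eq_iff par_1 wedge_eq_shuffle[abs_def] alt_sign_shuffle)

lemma wedge_commute_even:
  assumes "par (Suc 0) \<alpha> = \<alpha>"
  shows "wedge \<alpha> \<beta> = wedge \<beta> \<alpha>"
proof (intro ext)
  fix c p vs
  have "alt_sign (\<alpha> c p) = \<alpha> c p" using assms by (metis par_1)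
  then show "wedge \<alpha> \<beta> c p vs = wedge \<beta> \<alpha> c p vs"
    unfolding wedge_eq_shuffle by (rule shuffle_commute(1))
qed

text \<open>Graded commutativity equates the square with its own negative, which over the reals
  forces 0.\<close>

lemma wedge_odd_self:
  assumes "par (Suc 0) \<alpha> = fscale (-1) \<alpha>"
  shows "wedge \<alpha> \<alpha> = 0"
proof (intro ext)
  fix c p vs
  have "par (Suc 0) \<alpha> c p = fscale (-1) \<alpha> c p" by (simp add: assms)
  then have *: "alt_sign (\<alpha> c p) = (\<lambda>vs. - \<alpha> c p vs)"
    unfolding par_1 by (simp add: fscale_def)
  have "shuffle (\<alpha> c p) (\<alpha> c p) vs = - shuffle (\<alpha> c p) (\<alpha> c p) vs"
    using shuffle_commute(2)[OF *, of "\<alpha> c p" vs] unfolding * shuffle_minus_left .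
  then show "wedge \<alpha> \<alpha> c p vs = 0 c p vs"
    by (simp add: wedge_eq_shuffle)
qed

lemma fscale_fscale [simp]: "fscale r (fscale s \<alpha>) = fscale (r * s) \<alpha>"
  by (simp add: fscale_def mult.assoc)

lemma fscale_one [simp]: "fscale 1 \<alpha> = \<alpha>"
  by (simp add: fscale_def)

lemma fscale_zero [simp]: "fscale r 0 = 0"
  by (simp add: fscale_def fun_eq_iff)

lemma fscale_add_right: "fscale r (\<alpha> + \<beta>) = fscale r \<alpha> + fscale r \<beta>"
  by (simp_all add: fscale_def fun_eq_iff algebra_simps)

text \<open>The carrier as a plain set, so that the calculations use pointwise addition of functions
  rather than the operations of a record.\<close>

definition Forms :: "'e::euclidean_space set \<Rightarrow> ('a, 'e) chart set \<Rightarrow> int \<Rightarrow> ('a, 'e) form set" where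
  "Forms E A k = {\<omega>. is_form E A \<omega> \<and> (\<forall>c p vs. int (length vs) \<noteq> k \<longrightarrow> \<omega> c p vs = 0)}"

lemma carrier_Omega: "carrier (Omega E A k) = Forms E A k"
  by (simp add: Omega_def Forms_def)

lemma FormsD: "\<omega> \<in> Forms E A k \<Longrightarrow> is_form E A \<omega>"
  by (simp add: Forms_def)

lemma Forms_eq_0: "\<omega> \<in> Forms E A k \<Longrightarrow> int (length vs) \<noteq> k \<Longrightarrow> \<omega> c p vs = 0"
  unfolding Forms_def by blast

lemma FormsI:
  assumes "is_form E A \<omega>" "\<And>c p vs. int (length vs) \<noteq> k \<Longrightarrow> \<omega> c p vs = 0"
  shows "\<omega> \<in> Forms E A k"
  using assms unfolding Forms_def by blast

lemma par_even_form: "\<omega> \<in> Forms E A k \<Longrightarrow> even k \<Longrightarrow> par (Suc 0) \<omega> = \<omega>"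
  and par_odd_form: "\<omega> \<in> Forms E A k \<Longrightarrow> odd k \<Longrightarrow> par (Suc 0) \<omega> = fscale (-1) \<omega>"
proof -
  have "par (Suc 0) \<omega> c p vs = fscale (if even k then 1 else -1) \<omega> c p vs" if "\<omega> \<in> Forms E A k" for c p vs
  proof (cases "int (length vs) = k")
    case True
    then have "even (length vs) \<longleftrightarrow> even k" by auto
    then show ?thesis by (simp add: par_def fscale_def)
  next
    case False
    then show ?thesis using Forms_eq_0[OF that] by (simp add: par_def fscale_def)
  qed
  then show "\<omega> \<in> Forms E A k \<Longrightarrow> even k \<Longrightarrow> par (Suc 0) \<omega> = \<omega>"
    "\<omega> \<in> Forms E A k \<Longrightarrow> odd k \<Longrightarrow> par (Suc 0) \<omega> = fscale (-1) \<omega>"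
    by (simp_all add: fun_eq_iff)
qed

context manifold
begin

lemma Forms_zero: "0 \<in> Forms E A k"
  by (rule FormsI) (simp_all add: is_form_zero)

lemma Forms_add: "\<alpha> \<in> Forms E A k \<Longrightarrow> \<beta> \<in> Forms E A k \<Longrightarrow> \<alpha> + \<beta> \<in> Forms E A k"
  by (rule FormsI) (simp_all add: is_form_add FormsD Forms_eq_0)

lemma Forms_scale: "\<alpha> \<in> Forms E A k \<Longrightarrow> fscale r \<alpha> \<in> Forms E A k"
  by (rule FormsI) (simp_all add: is_form_scale FormsD, simp add: fscale_def Forms_eq_0)

lemma Forms_par_1: "\<alpha> \<in> Forms E A k \<Longrightarrow> par (Suc 0) \<alpha> \<in> Forms E A k"
  by (rule FormsI) (simp_all add: is_form_par_1 FormsD, simp add: par_def Forms_eq_0)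

lemma Forms_wedge:
  assumes "\<alpha> \<in> Forms E A k" "\<beta> \<in> Forms E A l"
  shows "wedge \<alpha> \<beta> \<in> Forms E A (k + l)"
proof (rule FormsI)
  show "is_form E A (wedge \<alpha> \<beta>)"
    using assms by (intro is_form_wedge FormsD)
  fix c p and vs :: "'e list" assume *: "int (length vs) \<noteq> k + l"
  show "wedge \<alpha> \<beta> c p vs = 0"
    unfolding wedge_eq_shuffle
  proof (rule shuffle_eq_0)
    fix us ws :: "'e list" assume "length us + length ws = length vs"
    then have "int (length us) \<noteq> k \<or> int (length ws) \<noteq> l" using * by linarith
    then show "\<alpha> c p us = 0 \<or> \<beta> c p ws = 0"
      using Forms_eq_0[OF assms(1)] Forms_eq_0[OF assms(2)] by blast
  qed
qed

lemma Forms_deRham: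
  assumes "\<omega> \<in> Forms E A k"
  shows "deRham E A \<omega> \<in> Forms E A (k + 1)"
proof (rule FormsI)
  show f: "is_form E A (deRham E A \<omega>)"
    using assms by (intro is_form_deRham FormsD)
  fix c p and vs :: "'e list" assume l: "int (length vs) \<noteq> k + 1"
  show "deRham E A \<omega> c p vs = 0"
  proof (cases "c \<in> A \<and> p \<in> chart_dom c \<and> set vs \<subseteq> E")
    case True
    then have *: "c \<in> A" "p \<in> chart_dom c" "set vs \<subseteq> E" by auto
    interpret open_in_subspace E "chart_image c" by (rule open_chart_image) fact
    show ?thesis
      unfolding deRham_eq_dloc[OF *] dloc_def
    proof (rule sum.neutral, rule ballI)
      fix i assume "i \<in> {..<length vs}"
      then have i: "i < length vs" by simp
      then have v: "vs ! i \<in> E" using *(3) nth_mem by blast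
      have "int (length (take i vs @ drop (Suc i) vs)) \<noteq> k" using i l by simp
      then have "\<omega> c r (take i vs @ drop (Suc i) vs) = 0" for r
        by (rule Forms_eq_0[OF assms])
      then have "(\<lambda>y. in_chart c \<omega> y (take i vs @ drop (Suc i) vs)) = (\<lambda>y. 0)"
        by (simp add: in_chart_def)
      then show "(-1) ^ i * dir_deriv (chart_image c) (vs ! i)
          (\<lambda>y. in_chart c \<omega> y (take i vs @ drop (Suc i) vs)) (chart_map c p) = 0"
        using * v by simp
    qed
  qed (rule form_support[OF f])
qed

lemma Forms_above_dim:
  assumes "\<omega> \<in> Forms E A k" "int (dim E) < k"
  shows "\<omega> = 0"
proof (rule form_eqI[OF FormsD[OF assms(1)] is_form_zero])
  fix c p vs assume *: "c \<in> A" "p \<in> chart_dom c" "set vs \<subseteq> E"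
  show "\<omega> c p vs = 0 c p vs"
  proof (cases "int (length vs) = k")
    case True
    then show ?thesis
      using assms(2) alt_vanish_above_dim[OF form_multilinear[OF FormsD[OF assms(1)] *(1,2)]
          form_alt[OF FormsD[OF assms(1)] *(1,2)] subspace_E *(3)] by simp
  qed (use Forms_eq_0[OF assms(1)] in simp)
qed

end


section \<open>The long exact cohomology sequence\<close>

text \<open>A module on a subset of an additive group type, which gives access to the ordinary rules
  for subtraction. The \<open>undefined\<close> fields mirror \<open>Omega\<close> and
  \<open>Cochains\<close>, so the records are literally equal.\<close>

definition real_mod :: "(real \<Rightarrow> 'u \<Rightarrow> 'u) \<Rightarrow> 'u set \<Rightarrow> (real, 'u::ab_group_add) module" where
  "real_mod sc S = \<lparr>carrier = S, mult = undefined, one = undefined, zero = 0, add = (+), smult = sc\<rparr>"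

lemma real_mod_simps [simp]:
  "carrier (real_mod sc S) = S" "zero (real_mod sc S) = 0" "add (real_mod sc S) = (+)" "smult (real_mod sc S) = sc"
  by (simp_all add: real_mod_def)

lemma cring_real_ring: "cring real_ring"
proof (rule cringI)
  show "abelian_group real_ring"
  proof (rule abelian_groupI)
    fix x :: real
    show "\<exists>y\<in>carrier real_ring. y \<oplus>\<^bsub>real_ring\<^esub> x = \<zero>\<^bsub>real_ring\<^esub>"
      by (rule bexI[of _ "- x"]) (simp_all add: real_ring_def)
  qed (simp_all add: real_ring_def)
  show "Group.comm_monoid real_ring"
    by (rule comm_monoidI) (simp_all add: real_ring_def)
qed (simp add: real_ring_def distrib_right)

section \<open>Complexes on subsets of additive groups and their cohomology\<close>

locale scaling =
  fixes sc :: "real \<Rightarrow> 'u::ab_group_add \<Rightarrow> 'u"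
  assumes sc_add_right: "sc r (x + y) = sc r x + sc r y"
    and sc_add_left: "sc (r + s) x = sc r x + sc s x"
    and sc_sc: "sc r (sc s x) = sc (r * s) x"
    and sc_one: "sc 1 x = x"
begin

lemma sc_zero_left: "sc 0 x = 0"
  using sc_add_left[of 0 0 x] by simp

lemma sc_minus_one: "sc (-1) x = - x"
proof -
  have "sc (-1) x + x = 0"
    using sc_add_left[of "-1" 1 x] by (simp add: sc_one sc_zero_left)
  then show ?thesis by (rule eq_neg_iff_add_eq_0[THEN iffD2])
qed

definition linsub :: "'u set \<Rightarrow> bool" where
  "linsub S \<longleftrightarrow> 0 \<in> S \<and> (\<forall>x\<in>S. \<forall>y\<in>S. x + y \<in> S) \<and> (\<forall>r. \<forall>x\<in>S. sc r x \<in> S)"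

lemma module_real_mod:
  assumes "linsub S"
  shows "Module.module real_ring (real_mod sc S)"
proof (rule moduleI[OF cring_real_ring])
  show "abelian_group (real_mod sc S)"
  proof (rule abelian_groupI)
    fix x assume "x \<in> carrier (real_mod sc S)"
    then have "sc (-1) x \<in> S" using assms by (simp add: linsub_def)
    then show "\<exists>y\<in>carrier (real_mod sc S). y \<oplus>\<^bsub>real_mod sc S\<^esub> x = \<zero>\<^bsub>real_mod sc S\<^esub>"
      by (intro bexI[of _ "- x"]) (simp_all add: sc_minus_one)
  qed (use assms in \<open>simp_all add: linsub_def add_ac\<close>)
qed (use assms in \<open>simp_all add: linsub_def real_ring_def sc_add_right sc_add_left sc_sc sc_one\<close>)

end

text \<open>Linearity of \<open>D\<close> is asked for on each \<open>S k\<close> only: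
  \<open>deRham\<close> contains a chosen derivative, which obeys the sum rule for differentiable
  coefficients.\<close>

locale fcomplex = scaling sc for sc :: "real \<Rightarrow> 'u::ab_group_add \<Rightarrow> 'u" +
  fixes S :: "int \<Rightarrow> 'u set" and D :: "'u \<Rightarrow> 'u"
  assumes linsub_S: "linsub (S k)"
    and D_in: "x \<in> S k \<Longrightarrow> D x \<in> S (k + 1)"
    and D_add: "x \<in> S k \<Longrightarrow> y \<in> S k \<Longrightarrow> D (x + y) = D x + D y"
    and D_sc: "x \<in> S k \<Longrightarrow> D (sc r x) = sc r (D x)"
    and D_D: "x \<in> S k \<Longrightarrow> D (D x) = 0"
begin

abbreviation C :: "int \<Rightarrow> (real, 'u) module" where
  "C k \<equiv> real_mod sc (S k)"

definition Z :: "int \<Rightarrow> 'u set" where "Z k = {x \<in> S k. D x = 0}"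

definition B :: "int \<Rightarrow> 'u set" where "B k = D ` S (k - 1)"

definition cl :: "int \<Rightarrow> 'u \<Rightarrow> 'u set" where "cl k x = (\<lambda>b. b + x) ` B k"

lemma S_zero: "0 \<in> S k"
  and S_add: "x \<in> S k \<Longrightarrow> y \<in> S k \<Longrightarrow> x + y \<in> S k"
  and S_sc: "x \<in> S k \<Longrightarrow> sc r x \<in> S k"
  using linsub_S[of k] by (simp_all add: linsub_def)

lemma S_minus: "x \<in> S k \<Longrightarrow> - x \<in> S k"
  using S_sc[of x k "-1"] by (simp add: sc_minus_one)

lemma S_diff: "x \<in> S k \<Longrightarrow> y \<in> S k \<Longrightarrow> x - y \<in> S k"
  using S_add[of x k "- y"] S_minus[of y k] by simp

lemma D_zero: "D 0 = 0"
  using D_add[OF S_zero S_zero] by simp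

lemma D_minus: "x \<in> S k \<Longrightarrow> D (- x) = - D x"
  using D_sc[of x k "-1"] by (simp add: sc_minus_one)

lemma D_diff: "x \<in> S k \<Longrightarrow> y \<in> S k \<Longrightarrow> D (x - y) = D x - D y"
  using D_add[of x k "- y"] S_minus[of y k] D_minus[of y k] by simp

lemma Z_S: "x \<in> Z k \<Longrightarrow> x \<in> S k" and Z_D: "x \<in> Z k \<Longrightarrow> D x = 0"
  by (simp_all add: Z_def)

lemma B_iff: "b \<in> B k \<longleftrightarrow> (\<exists>x\<in>S (k - 1). b = D x)"
  by (auto simp: B_def)

lemma B_zero: "0 \<in> B k"
  unfolding B_iff using S_zero D_zero by (intro bexI[of _ 0]) simp_all

lemma B_add: "x \<in> B k \<Longrightarrow> y \<in> B k \<Longrightarrow> x + y \<in> B k"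
  unfolding B_iff using D_add S_add by metis

lemma B_sc: "x \<in> B k \<Longrightarrow> sc r x \<in> B k"
  unfolding B_iff using D_sc S_sc by metis

lemma B_minus: "x \<in> B k \<Longrightarrow> - x \<in> B k"
  using B_sc[of x k "-1"] by (simp add: sc_minus_one)

lemma B_diff: "x \<in> B k \<Longrightarrow> y \<in> B k \<Longrightarrow> x - y \<in> B k"
  using B_add[of x k "- y"] B_minus[of y k] by simp

lemma B_S: "b \<in> B k \<Longrightarrow> b \<in> S k"
  using D_in[of _ "k - 1"] by (auto simp: B_iff)

lemma mem_cl: "y \<in> cl k x \<longleftrightarrow> y - x \<in> B k"
  by (force simp: cl_def image_iff algebra_simps)

lemma cl_eq_iff: "cl k x = cl k y \<longleftrightarrow> x - y \<in> B k"
proof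
  assume "cl k x = cl k y"
  then show "x - y \<in> B k"
    using mem_cl[of x k x] mem_cl[of x k y] B_zero[of k] by simp
next
  assume *: "x - y \<in> B k"
  show "cl k x = cl k y"
  proof (rule Set.set_eqI)
    fix z
    have "z - x + (x - y) = z - y" "z - y - (x - y) = z - x" by simp_all
    with * show "z \<in> cl k x \<longleftrightarrow> z \<in> cl k y"
      unfolding mem_cl using B_add[of "z - x" k "x - y"] B_diff[of "z - y" k "x - y"] by auto
  qed
qed

lemma cl_0: "cl k 0 = B k"
  by (simp add: cl_def)

lemma cl_eq_B_iff: "cl k x = B k \<longleftrightarrow> x \<in> B k"
  using cl_eq_iff[of k x 0] by (simp add: cl_0)

lemma cocycles_eq: "cocycles C D k = Z k"
  by (simp add: cocycles_def Z_def)

lemma coboundaries_eq: "coboundaries C D k = B k"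
  by (simp add: coboundaries_def B_def)

lemma coset_eq: "B k +>\<^bsub>M\<^esub> x = cl k x" if "add M = (+)" for M :: "(real, 'u) module"
  using that by (auto simp: a_r_coset_def r_coset_def cl_def)

text \<open>Unfolding \<open>a_rcosets\<close> leads to cosets in the underlying monoid record,
  hence this second form next to \<open>coset_eq\<close>.\<close>

lemma r_coset_eq: "B k #>\<^bsub>N\<^esub> x = cl k x" if "monoid.mult N = (+)" for N :: "('u, 'm) monoid_scheme"
  using that by (auto simp: r_coset_def cl_def)

lemma coh_class_eq: "coh_class C D k x = cl k x"
  by (simp add: coh_class_def coboundaries_eq coset_eq)

lemma carrier_cohomology: "carrier (cohomology C D k) = cl k ` Z k"
  by (auto simp: cohomology_def quot_module_def cocycles_eq coboundaries_eq A_RCOSETS_def RCOSETS_def r_coset_eq)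

lemma zero_cohomology: "zero (cohomology C D k) = B k"
  by (simp add: cohomology_def quot_module_def coboundaries_eq)

lemma cl_add: "cl k x \<oplus>\<^bsub>cohomology C D k\<^esub> cl k y = cl k (x + y)"
proof -
  have "cl k x \<oplus>\<^bsub>cohomology C D k\<^esub> cl k y = {u + v | u v. u \<in> cl k x \<and> v \<in> cl k y}"
    by (auto simp: cohomology_def quot_module_def set_add_def set_mult_def)
  also have "\<dots> = cl k (x + y)"
  proof (intro Set.set_eqI iffI)
    fix z assume "z \<in> {u + v | u v. u \<in> cl k x \<and> v \<in> cl k y}"
    then obtain u v where "z = u + v" "u - x \<in> B k" "v - y \<in> B k"
      by (auto simp: mem_cl)
    then show "z \<in> cl k (x + y)"
      using B_add[of "u - x" k "v - y"] by (simp add: mem_cl algebra_simps)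
  next
    fix z assume "z \<in> cl k (x + y)"
    then have "z = (z - y) + y" "z - y \<in> cl k x" "y \<in> cl k y"
      by (simp_all add: mem_cl B_zero algebra_simps)
    then show "z \<in> {u + v | u v. u \<in> cl k x \<and> v \<in> cl k y}" by blast
  qed
  finally show ?thesis .
qed

lemma cl_sc: "r \<odot>\<^bsub>cohomology C D k\<^esub> cl k x = cl k (sc r x)"
proof -
  have "r \<odot>\<^bsub>cohomology C D k\<^esub> cl k x = (\<Union>y\<in>cl k x. cl k (sc r y))"
    by (simp add: cohomology_def quot_module_def coboundaries_eq coset_eq)
  also have "\<dots> = (\<Union>y\<in>cl k x. cl k (sc r x))"
  proof (rule SUP_cong[OF refl])
    fix y assume "y \<in> cl k x"
    then have "sc r (y - x) \<in> B k" by (simp add: mem_cl B_sc)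
    moreover have "sc r (y - x) + sc r x = sc r y"
      by (simp flip: sc_add_right)
    ultimately show "cl k (sc r y) = cl k (sc r x)"
      by (simp add: cl_eq_iff eq_diff_eq[symmetric])
  qed
  \<comment> \<open>The union of equal sets collapses because \<open>x\<close> lies in its own
    class, so the index set is nonempty.\<close>
  also have "\<dots> = cl k (sc r x)"
    using mem_cl[of x k x] B_zero by auto
  finally show ?thesis .
qed

lemma linear_map_D: "linear_map (C k) (C (k + 1)) D"
  by (auto simp: linear_map_def D_in D_add D_sc)

lemma cochain_complex: "cochain_complex C D"
  using linear_map_D by (auto simp: cochain_complex_def module_real_mod linsub_S D_D)

end

locale fcomplex_map =
  src: fcomplex sc S D + tgt: fcomplex sc' S' D'
  for sc :: "real \<Rightarrow> 'u::ab_group_add \<Rightarrow> 'u" and S D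
    and sc' :: "real \<Rightarrow> 'v::ab_group_add \<Rightarrow> 'v" and S' D' +
  fixes f :: "'u \<Rightarrow> 'v"
  assumes f_in: "x \<in> S k \<Longrightarrow> f x \<in> S' k"
    and f_add: "x \<in> S k \<Longrightarrow> y \<in> S k \<Longrightarrow> f (x + y) = f x + f y"
    and f_sc: "x \<in> S k \<Longrightarrow> f (sc r x) = sc' r (f x)"
    and f_D: "x \<in> S k \<Longrightarrow> f (D x) = D' (f x)"
begin

lemma f_minus: "x \<in> S k \<Longrightarrow> f (- x) = - f x"
  using f_sc[of x k "-1"] by (simp add: src.sc_minus_one tgt.sc_minus_one)

lemma f_diff: "x \<in> S k \<Longrightarrow> y \<in> S k \<Longrightarrow> f (x - y) = f x - f y"
  using f_add[of x k "- y"] src.S_minus[of y k] f_minus[of y k] by simp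

lemma f_zero: "f 0 = 0"
  using f_add[OF src.S_zero src.S_zero] by simp

lemma f_Z: "x \<in> src.Z k \<Longrightarrow> f x \<in> tgt.Z k"
  using f_D[of x k] by (simp add: src.Z_def tgt.Z_def f_in f_zero)

lemma f_B: "b \<in> src.B k \<Longrightarrow> f b \<in> tgt.B k"
  using f_D f_in unfolding src.B_iff tgt.B_iff by metis

lemma cochain_map: "cochain_map src.C D tgt.C D' f"
  by (auto simp: cochain_map_def linear_map_def f_in f_add f_sc f_D)

text \<open>Representatives differ by a coboundary, which \<open>f\<close> sends to a coboundary, so
  the union in \<open>coh_map\<close> runs over copies of one class.\<close>

lemma coh_map_cl:
  assumes "x \<in> S k"
  shows "coh_map f tgt.C D' k (src.cl k x) = tgt.cl k (f x)"
proof -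
  have "coh_map f tgt.C D' k (src.cl k x) = (\<Union>y\<in>src.cl k x. tgt.cl k (f y))"
    by (simp add: coh_map_def tgt.coh_class_eq)
  also have "\<dots> = (\<Union>y\<in>src.cl k x. tgt.cl k (f x))"
  proof (rule SUP_cong[OF refl])
    fix y assume "y \<in> src.cl k x"
    then have y: "y - x \<in> src.B k" by (simp add: src.mem_cl)
    then have "y \<in> S k" using src.S_add[OF src.B_S[OF y] assms] by simp
    then show "tgt.cl k (f y) = tgt.cl k (f x)"
      using f_B[OF y] f_diff[of y k x] assms by (simp add: tgt.cl_eq_iff)
  qed
  also have "\<dots> = tgt.cl k (f x)"
    using src.mem_cl[of x k x] src.B_zero by auto
  finally show ?thesis .
qed

lemma linear_map_coh:
  "linear_map (cohomology src.C D k) (cohomology tgt.C D' k) (coh_map f tgt.C D' k)"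
  unfolding linear_map_def
proof (intro conjI ballI allI)
  show "coh_map f tgt.C D' k \<in> carrier (cohomology src.C D k) \<rightarrow> carrier (cohomology tgt.C D' k)"
    unfolding src.carrier_cohomology tgt.carrier_cohomology
    using coh_map_cl src.Z_S f_Z by auto
next
  fix X Y assume "X \<in> carrier (cohomology src.C D k)" "Y \<in> carrier (cohomology src.C D k)"
  then obtain x y where *: "x \<in> S k" "y \<in> S k" "X = src.cl k x" "Y = src.cl k y"
    unfolding src.carrier_cohomology using src.Z_S by blast
  then show "coh_map f tgt.C D' k (X \<oplus>\<^bsub>cohomology src.C D k\<^esub> Y) =
      coh_map f tgt.C D' k X \<oplus>\<^bsub>cohomology tgt.C D' k\<^esub> coh_map f tgt.C D' k Y"
    using src.S_add[of x k y] by (simp add: src.cl_add tgt.cl_add coh_map_cl f_add)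
next
  fix r X assume "X \<in> carrier (cohomology src.C D k)"
  then obtain x where *: "x \<in> S k" "X = src.cl k x"
    unfolding src.carrier_cohomology using src.Z_S by blast
  then show "coh_map f tgt.C D' k (r \<odot>\<^bsub>cohomology src.C D k\<^esub> X) =
      r \<odot>\<^bsub>cohomology tgt.C D' k\<^esub> coh_map f tgt.C D' k X"
    using src.S_sc[of x k r] by (simp add: src.cl_sc tgt.cl_sc coh_map_cl f_sc)
qed

end

section \<open>The zigzag construction\<close>

locale short_exact =
  f: fcomplex_map sc S D sc' S' D' f + g: fcomplex_map sc' S' D' sc'' S'' D'' g
  for sc :: "real \<Rightarrow> 'u::ab_group_add \<Rightarrow> 'u" and S D
    and sc' :: "real \<Rightarrow> 'v::ab_group_add \<Rightarrow> 'v" and S' D'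
    and sc'' :: "real \<Rightarrow> 'w::ab_group_add \<Rightarrow> 'w" and S'' D'' and f g +
  assumes inj: "inj_on f (S k)"
    and exact: "f ` S k = {y \<in> S' k. g y = 0}"
    and surj: "g ` S' k = S'' k"
begin

lemma short_exact_complexes: "short_exact_complexes f.src.C D f f.tgt.C D' g g.tgt.C D''"
  unfolding short_exact_complexes_def exact_at_def
  using f.src.cochain_complex f.tgt.cochain_complex g.tgt.cochain_complex f.cochain_map g.cochain_map
    inj exact surj
  by simp

lemma f_eq_0D: "x \<in> S k \<Longrightarrow> f x = 0 \<Longrightarrow> x = 0"
  using inj_onD[OF inj _ _ f.src.S_zero] f.f_zero by metis

lemma g_f: "x \<in> S k \<Longrightarrow> g (f x) = 0"
  using exact by blast

lemma lift_f: "y \<in> S' k \<Longrightarrow> g y = 0 \<Longrightarrow> \<exists>x\<in>S k. y = f x"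
  using exact by blast

lemma lift_g: "z \<in> S'' k \<Longrightarrow> \<exists>y\<in>S' k. z = g y"
  using surj by blast

text \<open>Lift the primitive of \<open>g y\<close> to \<open>w\<close>; subtracting
  \<open>D' w\<close> moves \<open>y\<close> into the kernel of \<open>g\<close>, which is the image
  of \<open>f\<close>. This correction serves uniqueness of the connecting map, exactness in the
  middle and injectivity in \<open>linear_iso_coh\<close>.\<close>

lemma lift_B:
  assumes y: "y \<in> S' k" and "g y \<in> g.tgt.B k"
  shows "\<exists>w\<in>S' (k - 1). \<exists>u\<in>S k. y - D' w = f u"
proof -
  obtain z where z: "z \<in> S'' (k - 1)" "g y = D'' z"
    using assms(2) by (auto simp: g.tgt.B_iff)
  obtain w where w: "w \<in> S' (k - 1)" "z = g w" using lift_g[OF z(1)] by blast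
  have Dw: "D' w \<in> S' k" using f.tgt.D_in[OF w(1)] by simp
  have "g (y - D' w) = 0"
    using g.f_diff[OF y Dw] g.f_D[OF w(1)] z(2) w(2) by simp
  then obtain u where "u \<in> S k" "y - D' w = f u"
    using lift_f[OF f.tgt.S_diff[OF y Dw]] by blast
  with w show ?thesis by blast
qed

text \<open>The union over all zigzags avoids choosing lifts; \<open>connecting_cl\<close> shows
  that all of them yield one class.\<close>

definition connecting :: "int \<Rightarrow> 'w set \<Rightarrow> 'u set" where
  "connecting k X = \<Union>{f.src.cl (k + 1) \<omega> | \<omega> x. \<omega> \<in> S (k + 1) \<and> x \<in> S' k \<and> D' x = f \<omega> \<and> g x \<in> X}"

text \<open>The lifts differ by \<open>D' w + f u\<close>. Applying \<open>D'\<close> kills the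
  first summand, and injectivity of \<open>f\<close> exhibits \<omega> - \<omega>' as the coboundary
  of \<open>u\<close>.\<close>

lemma connecting_unique:
  assumes x: "x \<in> S' k" "x' \<in> S' k" and \<omega>: "\<omega> \<in> S (k + 1)" "\<omega>' \<in> S (k + 1)"
    and eq: "D' x = f \<omega>" "D' x' = f \<omega>'" and B: "g x - g x' \<in> g.tgt.B k"
  shows "f.src.cl (k + 1) \<omega> = f.src.cl (k + 1) \<omega>'"
proof -
  have d: "x - x' \<in> S' k" by (rule f.tgt.S_diff[OF x])
  obtain w u where wu: "w \<in> S' (k - 1)" "u \<in> S k" "x - x' - D' w = f u"
    using lift_B[OF d] B g.f_diff[OF x] by auto
  have Dw: "D' w \<in> S' k" using f.tgt.D_in[OF wu(1)] by simp
  have "f (D u) = D' (x - x' - D' w)" using f.f_D[OF wu(2)] wu(3) by simp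
  also have "\<dots> = D' x - D' x'"
    using f.tgt.D_diff[OF d Dw] f.tgt.D_diff[OF x] f.tgt.D_D[OF wu(1)] by simp
  also have "\<dots> = f (\<omega> - \<omega>')"
    using eq f.f_diff[OF \<omega>] by simp
  finally have "D u = \<omega> - \<omega>'"
    using inj_onD[OF inj _ f.src.D_in[OF wu(2)] f.src.S_diff[OF \<omega>]] by blast
  then show ?thesis
    using wu(2) unfolding f.src.cl_eq_iff f.src.B_iff by (intro bexI[of _ u]) simp_all
qed

lemma connecting_cl:
  assumes "x \<in> S' k" "\<omega> \<in> S (k + 1)" "D' x = f \<omega>"
  shows "connecting k (g.tgt.cl k (g x)) = f.src.cl (k + 1) \<omega>"
proof -
  have "f.src.cl (k + 1) \<omega>' = f.src.cl (k + 1) \<omega>"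
    if "\<omega>' \<in> S (k + 1)" "x' \<in> S' k" "D' x' = f \<omega>'" "g x' \<in> g.tgt.cl k (g x)" for \<omega>' x'
    using connecting_unique[OF that(2) assms(1) that(1) assms(2) that(3) assms(3)] that(4)
    by (simp add: g.tgt.mem_cl)
  moreover have "g x \<in> g.tgt.cl k (g x)"
    by (simp add: g.tgt.mem_cl g.tgt.B_zero)
  ultimately have "{f.src.cl (k + 1) \<omega>' | \<omega>' x'. \<omega>' \<in> S (k + 1) \<and> x' \<in> S' k \<and> D' x' = f \<omega>' \<and>
      g x' \<in> g.tgt.cl k (g x)} = {f.src.cl (k + 1) \<omega>}"
    using assms by blast
  then show ?thesis by (simp add: connecting_def)
qed

lemma lift_cocycle:
  assumes "z \<in> g.tgt.Z k"
  shows "\<exists>x\<in>S' k. \<exists>\<omega>\<in>f.src.Z (k + 1). z = g x \<and> D' x = f \<omega>"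
proof -
  obtain x where x: "x \<in> S' k" "z = g x" using lift_g[OF g.tgt.Z_S[OF assms]] by blast
  have "g (D' x) = 0" using g.f_D[OF x(1)] g.tgt.Z_D[OF assms] x(2) by simp
  then obtain \<omega> where \<omega>: "\<omega> \<in> S (k + 1)" "D' x = f \<omega>"
    using lift_f[OF f.tgt.D_in[OF x(1)]] by blast
  have "f (D \<omega>) = 0" using f.f_D[OF \<omega>(1)] f.tgt.D_D[OF x(1)] \<omega>(2) by simp
  then have "D \<omega> = 0" by (rule f_eq_0D[OF f.src.D_in[OF \<omega>(1)]])
  with x \<omega> show ?thesis unfolding f.src.Z_def by blast
qed

lemma linear_map_connecting:
  "linear_map (cohomology g.tgt.C D'' k) (cohomology f.src.C D (k + 1)) (connecting k)"
  unfolding linear_map_def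
proof (intro conjI ballI allI funcsetI)
  have *: "\<exists>x\<in>S' k. \<exists>\<omega>\<in>f.src.Z (k + 1). X = g.tgt.cl k (g x) \<and> D' x = f \<omega>"
    if "X \<in> carrier (cohomology g.tgt.C D'' k)" for X
    using that lift_cocycle unfolding g.tgt.carrier_cohomology by blast
  fix X assume "X \<in> carrier (cohomology g.tgt.C D'' k)"
  then obtain x \<omega> where x: "x \<in> S' k" "\<omega> \<in> f.src.Z (k + 1)" "X = g.tgt.cl k (g x)" "D' x = f \<omega>"
    using * by blast
  note \<omega> = f.src.Z_S[OF x(2)]
  show "connecting k X \<in> carrier (cohomology f.src.C D (k + 1))"
    unfolding x(3) connecting_cl[OF x(1) \<omega> x(4)] f.src.carrier_cohomology using x(2) by blast
  {
    fix Y assume "Y \<in> carrier (cohomology g.tgt.C D'' k)"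
    then obtain y \<eta> where y: "y \<in> S' k" "\<eta> \<in> f.src.Z (k + 1)" "Y = g.tgt.cl k (g y)" "D' y = f \<eta>"
      using * by blast
    note \<eta> = f.src.Z_S[OF y(2)]
    have "D' (x + y) = f (\<omega> + \<eta>)"
      using f.tgt.D_add[OF x(1) y(1)] f.f_add[OF \<omega> \<eta>] x(4) y(4) by simp
    from connecting_cl[OF f.tgt.S_add[OF x(1) y(1)] f.src.S_add[OF \<omega> \<eta>] this]
    show "connecting k (X \<oplus>\<^bsub>cohomology g.tgt.C D'' k\<^esub> Y) =
        connecting k X \<oplus>\<^bsub>cohomology f.src.C D (k + 1)\<^esub> connecting k Y"
      unfolding x(3) y(3) connecting_cl[OF x(1) \<omega> x(4)] connecting_cl[OF y(1) \<eta> y(4)]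
        g.tgt.cl_add f.src.cl_add g.f_add[OF x(1) y(1)] .
  }
  fix r
  have "D' (sc' r x) = f (sc r \<omega>)"
    using f.tgt.D_sc[OF x(1)] f.f_sc[OF \<omega>] x(4) by simp
  from connecting_cl[OF f.tgt.S_sc[OF x(1)] f.src.S_sc[OF \<omega>] this]
  show "connecting k (r \<odot>\<^bsub>cohomology g.tgt.C D'' k\<^esub> X) =
      r \<odot>\<^bsub>cohomology f.src.C D (k + 1)\<^esub> connecting k X"
    unfolding x(3) connecting_cl[OF x(1) \<omega> x(4)] g.tgt.cl_sc f.src.cl_sc g.f_sc[OF x(1)] .
qed

text \<open>In the hard direction \<open>lift_B\<close> replaces the cocycle by a cohomologous one
  in the image of \<open>f\<close>; its preimage is a cocycle since \<open>f\<close> is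
  injective.\<close>

lemma exact_middle:
  "exact_at (cohomology f.src.C D k) (coh_map f f.tgt.C D' k) (cohomology f.tgt.C D' k)
     (coh_map g g.tgt.C D'' k) (cohomology g.tgt.C D'' k)"
  unfolding exact_at_def f.src.carrier_cohomology f.tgt.carrier_cohomology g.tgt.zero_cohomology
proof (intro Set.set_eqI iffI)
  fix Y assume "Y \<in> coh_map f f.tgt.C D' k ` f.src.cl k ` f.src.Z k"
  then obtain x where x: "x \<in> f.src.Z k" "Y = coh_map f f.tgt.C D' k (f.src.cl k x)" by blast
  then have Y: "Y = f.tgt.cl k (f x)" by (simp add: f.coh_map_cl f.src.Z_S)
  have "coh_map g g.tgt.C D'' k Y = g.tgt.cl k (g (f x))"
    unfolding Y by (rule g.coh_map_cl[OF f.f_in[OF f.src.Z_S[OF x(1)]]])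
  also have "\<dots> = g.tgt.B k" by (simp add: g_f[OF f.src.Z_S[OF x(1)]] g.tgt.cl_0)
  finally show "Y \<in> {Y \<in> f.tgt.cl k ` f.tgt.Z k. coh_map g g.tgt.C D'' k Y = g.tgt.B k}"
    using Y f.f_Z[OF x(1)] by blast
next
  fix Y assume "Y \<in> {Y \<in> f.tgt.cl k ` f.tgt.Z k. coh_map g g.tgt.C D'' k Y = g.tgt.B k}"
  then obtain y where y: "y \<in> f.tgt.Z k" "Y = f.tgt.cl k y"
    and 0: "coh_map g g.tgt.C D'' k (f.tgt.cl k y) = g.tgt.B k" by blast
  note yS = f.tgt.Z_S[OF y(1)]
  have "g y \<in> g.tgt.B k"
    using 0 unfolding g.coh_map_cl[OF yS] g.tgt.cl_eq_B_iff .
  then obtain w u where wu: "w \<in> S' (k - 1)" "u \<in> S k" "y - D' w = f u"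
    using lift_B[OF yS] by blast
  have Dw: "D' w \<in> S' k" using f.tgt.D_in[OF wu(1)] by simp
  have "f (D u) = 0"
    using f.f_D[OF wu(2)] wu(3)[symmetric] f.tgt.D_diff[OF yS Dw] f.tgt.D_D[OF wu(1)] f.tgt.Z_D[OF y(1)] by simp
  then have "D u = 0" by (rule f_eq_0D[OF f.src.D_in[OF wu(2)]])
  then have u: "u \<in> f.src.Z k" using wu(2) by (simp add: f.src.Z_def)
  have "f.tgt.cl k y = f.tgt.cl k (f u)"
    unfolding f.tgt.cl_eq_iff f.tgt.B_iff wu(3)[symmetric] using wu(1) by (intro bexI[of _ w]) simp_all
  also have "\<dots> = coh_map f f.tgt.C D' k (f.src.cl k u)" by (simp add: f.coh_map_cl wu(2))
  finally show "Y \<in> coh_map f f.tgt.C D' k ` f.src.cl k ` f.src.Z k" using y(2) u by blast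
qed

lemma exact_right:
  "exact_at (cohomology f.tgt.C D' k) (coh_map g g.tgt.C D'' k) (cohomology g.tgt.C D'' k)
     (connecting k) (cohomology f.src.C D (k + 1))"
  unfolding exact_at_def f.tgt.carrier_cohomology g.tgt.carrier_cohomology f.src.zero_cohomology
proof (intro Set.set_eqI iffI)
  fix X assume "X \<in> coh_map g g.tgt.C D'' k ` f.tgt.cl k ` f.tgt.Z k"
  then obtain y where y: "y \<in> f.tgt.Z k" "X = coh_map g g.tgt.C D'' k (f.tgt.cl k y)" by blast
  then have X: "X = g.tgt.cl k (g y)" by (simp add: g.coh_map_cl f.tgt.Z_S)
  have "connecting k X = f.src.cl (k + 1) 0"
    unfolding X using f.tgt.Z_D[OF y(1)]
    by (intro connecting_cl f.tgt.Z_S[OF y(1)] f.src.S_zero) (simp add: f.f_zero)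
  then show "X \<in> {X \<in> g.tgt.cl k ` g.tgt.Z k. connecting k X = f.src.B (k + 1)}"
    using X g.f_Z[OF y(1)] by (simp add: f.src.cl_0)
next
  fix X assume "X \<in> {X \<in> g.tgt.cl k ` g.tgt.Z k. connecting k X = f.src.B (k + 1)}"
  then obtain z where z: "z \<in> g.tgt.Z k" "X = g.tgt.cl k z"
    and 0: "connecting k (g.tgt.cl k z) = f.src.B (k + 1)" by blast
  obtain x \<omega> where x: "x \<in> S' k" "\<omega> \<in> f.src.Z (k + 1)" "z = g x" "D' x = f \<omega>"
    using lift_cocycle[OF z(1)] by blast
  have "\<omega> \<in> f.src.B (k + 1)"
    using 0 unfolding x(3) connecting_cl[OF x(1) f.src.Z_S[OF x(2)] x(4)] f.src.cl_eq_B_iff .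
  then obtain u where u: "u \<in> S k" "\<omega> = D u" by (auto simp: f.src.B_iff)
  have fu: "f u \<in> S' k" by (rule f.f_in[OF u(1)])
  \<comment> \<open>Subtracting \<open>f u\<close> cancels the boundary of \<open>x\<close> without
    changing its image under \<open>g\<close>.\<close>
  have "x - f u \<in> f.tgt.Z k"
    using f.tgt.S_diff[OF x(1) fu] f.tgt.D_diff[OF x(1) fu] x(4) u(2) f.f_D[OF u(1)]
    by (simp add: f.tgt.Z_def)
  moreover have "coh_map g g.tgt.C D'' k (f.tgt.cl k (x - f u)) = X"
    using g.coh_map_cl[OF f.tgt.S_diff[OF x(1) fu]] g.f_diff[OF x(1) fu] g_f[OF u(1)] z(2) x(3) by simp
  ultimately show "X \<in> coh_map g g.tgt.C D'' k ` f.tgt.cl k ` f.tgt.Z k" by blast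
qed

text \<open>A primitive \<open>x\<close> of \<open>f \<omega>\<close> is precisely the middle term
  of a zigzag that ends in \<omega>.\<close>

lemma exact_left:
  "exact_at (cohomology g.tgt.C D'' k) (connecting k) (cohomology f.src.C D (k + 1))
     (coh_map f f.tgt.C D' (k + 1)) (cohomology f.tgt.C D' (k + 1))"
  unfolding exact_at_def f.src.carrier_cohomology g.tgt.carrier_cohomology f.tgt.zero_cohomology
proof (intro Set.set_eqI iffI)
  fix W assume "W \<in> connecting k ` g.tgt.cl k ` g.tgt.Z k"
  then obtain z where z: "z \<in> g.tgt.Z k" "W = connecting k (g.tgt.cl k z)" by blast
  obtain x \<omega> where x: "x \<in> S' k" "\<omega> \<in> f.src.Z (k + 1)" "z = g x" "D' x = f \<omega>"
    using lift_cocycle[OF z(1)] by blast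
  have W: "W = f.src.cl (k + 1) \<omega>"
    using z(2) x(3) connecting_cl[OF x(1) f.src.Z_S[OF x(2)] x(4)] by simp
  have "f \<omega> \<in> f.tgt.B (k + 1)"
    using x(1,4) unfolding f.tgt.B_iff by (intro bexI[of _ x]) simp_all
  then have "coh_map f f.tgt.C D' (k + 1) W = f.tgt.B (k + 1)"
    unfolding W f.coh_map_cl[OF f.src.Z_S[OF x(2)]] f.tgt.cl_eq_B_iff .
  then show "W \<in> {W \<in> f.src.cl (k + 1) ` f.src.Z (k + 1). coh_map f f.tgt.C D' (k + 1) W = f.tgt.B (k + 1)}"
    using W x(2) by blast
next
  fix W assume "W \<in> {W \<in> f.src.cl (k + 1) ` f.src.Z (k + 1). coh_map f f.tgt.C D' (k + 1) W = f.tgt.B (k + 1)}"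
  then obtain \<omega> where \<omega>: "\<omega> \<in> f.src.Z (k + 1)" "W = f.src.cl (k + 1) \<omega>"
    and 0: "coh_map f f.tgt.C D' (k + 1) (f.src.cl (k + 1) \<omega>) = f.tgt.B (k + 1)" by blast
  have "f \<omega> \<in> f.tgt.B (k + 1)"
    using 0 unfolding f.coh_map_cl[OF f.src.Z_S[OF \<omega>(1)]] f.tgt.cl_eq_B_iff .
  then obtain x where x: "x \<in> S' k" "f \<omega> = D' x" by (auto simp: f.tgt.B_iff)
  have "g x \<in> g.tgt.Z k"
    using g.f_in[OF x(1)] g.f_D[OF x(1)] x(2) g_f[OF f.src.Z_S[OF \<omega>(1)]] by (simp add: g.tgt.Z_def)
  moreover have "W = connecting k (g.tgt.cl k (g x))"
    using connecting_cl[OF x(1) f.src.Z_S[OF \<omega>(1)] x(2)[symmetric]] \<omega>(2) by simp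
  ultimately show "W \<in> connecting k ` g.tgt.cl k ` g.tgt.Z k" by blast
qed

text \<open>One vanishing group serves each half. With \<open>S k\<close> zero,
  \<open>lift_B\<close> writes the difference of two representatives as a coboundary; with
  \<open>S (k + 1)\<close> zero, every lift of a cocycle is itself a cocycle.\<close>

lemma linear_iso_coh:
  assumes "S k = {0}" "S (k + 1) = {0}"
  shows "linear_iso (cohomology f.tgt.C D' k) (cohomology g.tgt.C D'' k) (coh_map g g.tgt.C D'' k)"
  unfolding linear_iso_def bij_betw_def f.tgt.carrier_cohomology g.tgt.carrier_cohomology
proof (intro conjI g.linear_map_coh inj_onI)
  fix X Y assume "X \<in> f.tgt.cl k ` f.tgt.Z k" "Y \<in> f.tgt.cl k ` f.tgt.Z k"
    and eq: "coh_map g g.tgt.C D'' k X = coh_map g g.tgt.C D'' k Y"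
  then obtain x y where xy: "x \<in> S' k" "y \<in> S' k" "X = f.tgt.cl k x" "Y = f.tgt.cl k y"
    using f.tgt.Z_S by blast
  have "g (x - y) \<in> g.tgt.B k"
    using eq unfolding xy(3,4) g.coh_map_cl[OF xy(1)] g.coh_map_cl[OF xy(2)] g.tgt.cl_eq_iff g.f_diff[OF xy(1,2)] .
  then obtain w u where wu: "w \<in> S' (k - 1)" "u \<in> S k" "x - y - D' w = f u"
    using lift_B[OF f.tgt.S_diff[OF xy(1,2)]] by blast
  then have "x - y = D' w" using assms(1) f.f_zero by simp
  then show "X = Y" using wu(1) unfolding xy(3,4) f.tgt.cl_eq_iff f.tgt.B_iff by blast
next
  show "coh_map g g.tgt.C D'' k ` f.tgt.cl k ` f.tgt.Z k = g.tgt.cl k ` g.tgt.Z k"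
  proof (intro Set.set_eqI iffI)
    fix X assume "X \<in> coh_map g g.tgt.C D'' k ` f.tgt.cl k ` f.tgt.Z k"
    then show "X \<in> g.tgt.cl k ` g.tgt.Z k"
      using g.coh_map_cl[OF f.tgt.Z_S] g.f_Z by blast
  next
    fix X assume "X \<in> g.tgt.cl k ` g.tgt.Z k"
    then obtain z where z: "z \<in> g.tgt.Z k" "X = g.tgt.cl k z" by blast
    obtain x \<omega> where x: "x \<in> S' k" "\<omega> \<in> f.src.Z (k + 1)" "z = g x" "D' x = f \<omega>"
      using lift_cocycle[OF z(1)] by blast
    have "\<omega> = 0" using f.src.Z_S[OF x(2)] assms(2) by simp
    then have "x \<in> f.tgt.Z k" using x(1,4) f.f_zero by (simp add: f.tgt.Z_def)
    moreover have "X = coh_map g g.tgt.C D'' k (f.tgt.cl k x)"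
      using z(2) x(3) g.coh_map_cl[OF x(1)] by simp
    ultimately show "X \<in> coh_map g g.tgt.C D'' k ` f.tgt.cl k ` f.tgt.Z k" by blast
  qed
qed

end


section \<open>The complexes of the T-dual pair\<close>

definition Coch :: "'e::euclidean_space set \<Rightarrow> ('a, 'e) chart set \<Rightarrow> nat set \<Rightarrow> int \<Rightarrow> ('a, 'e) alg set" where
  "Coch E A S k = {x. (\<forall>I n. x I n \<in> Forms E A (k - int (card I) - 2 * int n)) \<and>
     (\<forall>I n. \<not> I \<subseteq> S \<longrightarrow> x I n = 0)}"

text \<open>The common shape of \<open>incl\<close> and \<open>odd_gen\<close>, and of their
  products, so that one multiplication rule covers every coefficient of the differentials.\<close>

definition mono_alg :: "nat set \<Rightarrow> ('a, 'e) form \<Rightarrow> ('a, 'e) alg" where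
  "mono_alg I \<alpha> = (\<lambda>J n. if J = I \<and> n = 0 then \<alpha> else 0)"

lemma Omega_eq: "Omega E A k = real_mod fscale (Forms E A k)"
  by (simp add: Omega_def real_mod_def Forms_def)

lemma Cochains_eq: "Cochains E A S k = real_mod alg_scale (Coch E A S k)"
  by (simp add: Cochains_def real_mod_def Coch_def carrier_Omega)

lemma scaling_fscale: "scaling fscale"
  by unfold_locales (simp_all add: fscale_def fun_eq_iff algebra_simps)

lemma scaling_alg_scale: "scaling alg_scale"
  by unfold_locales (simp_all add: alg_scale_def fscale_def fun_eq_iff algebra_simps)

lemma shuffle_sign_empty [simp]: "shuffle_sign {} J = 1" "shuffle_sign I {} = 1"
  by (simp_all add: shuffle_sign_def)

text \<open>In the double sum only the index set \<open>I\<close> and the power 0 of t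
  survive.\<close>

lemma mono_alg_mult:
  "(mono_alg I \<alpha> \<star> y) K n =
    (if finite K \<and> I \<subseteq> K then fscale (shuffle_sign I (K - I)) (wedge \<alpha> (par (card I) (y (K - I) n))) else 0)"
proof (cases "finite K")
  case True
  have inner: "(\<Sum>m\<le>n. fscale (shuffle_sign J (K - J)) (wedge (mono_alg I \<alpha> J m) (par (card J) (y (K - J) (n - m)))))
      = (if J = I then fscale (shuffle_sign I (K - I)) (wedge \<alpha> (par (card I) (y (K - I) n))) else 0)" for J
  proof (cases "J = I")
    case True
    have "(\<Sum>m\<le>n. fscale (shuffle_sign J (K - J)) (wedge (mono_alg I \<alpha> J m) (par (card J) (y (K - J) (n - m))))) =
        (\<Sum>m\<le>n. if m = 0 then fscale (shuffle_sign I (K - I)) (wedge \<alpha> (par (card I) (y (K - I) n))) else 0)"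
      by (rule sum.cong) (simp_all add: mono_alg_def True)
    then show ?thesis using True by simp
  qed (simp add: mono_alg_def)
  show ?thesis
    unfolding alg_mult_def inner using True by simp
next
  case False
  \<comment> \<open>The sum over the infinite set \<open>Pow K\<close> is 0 by convention.\<close>
  then show ?thesis by (simp add: alg_mult_def)
qed

lemma alg_mult_add_left: "(x + x') \<star> y = x \<star> y + x' \<star> y"
proof (rule ext, rule ext)
  show "((x + x') \<star> y) K n = (x \<star> y + x' \<star> y) K n" for K n
    by (simp add: alg_mult_def wedge_add_left fscale_add_right sum.distrib)
qed

lemma incl_eq: "incl \<omega> = mono_alg {} \<omega>"
  by (simp add: incl_def mono_alg_def fun_eq_iff)

lemma odd_gen_eq: "odd_gen A j = mono_alg {j} (unit_form A)"
  by (simp add: odd_gen_def mono_alg_def fun_eq_iff)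

text \<open>The unit is even and all its contractions vanish, so every argument passes to \<omega>.
  It is supported on the chart domains, whence the condition on \<omega>.\<close>

lemma wedge_unit:
  assumes "\<And>c p vs. \<not> (c \<in> A \<and> p \<in> chart_dom c) \<Longrightarrow> \<omega> c p vs = 0"
  shows "wedge (unit_form A) \<omega> = \<omega>"
proof (intro ext)
  fix c p vs
  show "wedge (unit_form A) \<omega> c p vs = \<omega> c p vs"
  proof (cases "c \<in> A \<and> p \<in> chart_dom c")
    case True
    let ?u = "\<lambda>vs :: 'b list. if vs = [] then 1 else 0 :: real"
    have "contr v ?u = (\<lambda>_. 0)" "alt_sign ?u = ?u" for v
      by (auto simp: contr_def alt_sign_def)
    then have "shuffle ?u \<beta> vs = \<beta> vs" for \<beta> vs
      by (induction vs arbitrary: \<beta>) (simp_all add: shuffle_Cons shuffle_zero_left, simp add: contr_def)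
    moreover have "unit_form A c p = ?u" using True by (simp add: unit_form_def fun_eq_iff)
    ultimately show ?thesis by (simp add: wedge_eq_shuffle)
  next
    case False
    then have "unit_form A c p = (\<lambda>_. 0)" by (auto simp: unit_form_def)
    then have "wedge (unit_form A) \<omega> c p vs = 0" by (simp add: wedge_eq_shuffle shuffle_zero_left)
    then show ?thesis using assms[OF False] by simp
  qed
qed

lemma par_even: "even r \<Longrightarrow> par r \<omega> = \<omega>"
  by (simp add: par_def)

lemma par_unit_form [simp]: "par r (unit_form A) = unit_form A"
  by (auto simp: par_def unit_form_def fun_eq_iff)

lemma mono_alg_mono_alg:
  assumes "finite I" "finite J" "I \<inter> J = {}"
  shows "mono_alg I \<alpha> \<star> mono_alg J \<beta> =
    mono_alg (I \<union> J) (fscale (shuffle_sign I J) (wedge \<alpha> (par (card I) \<beta>)))"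
proof (rule ext, rule ext)
  fix K n
  have "finite K \<and> I \<subseteq> K \<and> K - I = J \<longleftrightarrow> K = I \<union> J"
    using assms by auto
  moreover have "I \<union> J - I = J" using assms(3) by blast
  ultimately show "(mono_alg I \<alpha> \<star> mono_alg J \<beta>) K n =
      mono_alg (I \<union> J) (fscale (shuffle_sign I J) (wedge \<alpha> (par (card I) \<beta>))) K n"
    unfolding mono_alg_mult by (auto simp: mono_alg_def[of J] mono_alg_def[of "I \<union> J"])
qed

lemma CochD: "x \<in> Coch E A S k \<Longrightarrow> x I n \<in> Forms E A (k - int (card I) - 2 * int n)"
  and Coch_support: "x \<in> Coch E A S k \<Longrightarrow> \<not> I \<subseteq> S \<Longrightarrow> x I n = 0"
  by (simp_all add: Coch_def)

lemma Coch_empty: "x \<in> Coch E A S k \<Longrightarrow> x {} n \<in> Forms E A (k - 2 * int n)"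
  and Coch_single: "x \<in> Coch E A S k \<Longrightarrow> x {j} n \<in> Forms E A (k - 1 - 2 * int n)"
  using CochD[of x E A S k "{}" n] CochD[of x E A S k "{j}" n] by simp_all

context manifold
begin

lemma deRham_zero [simp]: "deRham E A 0 = 0"
  using deRham_scale[OF is_form_zero, of 0] by (simp add: fscale_def zero_fun_def)

lemma linsub_Forms: "scaling.linsub fscale (Forms E A k)"
  unfolding scaling.linsub_def[OF scaling_fscale] by (simp add: Forms_zero Forms_add Forms_scale)

lemma fcomplex_Forms: "fcomplex fscale (Forms E A) (deRham E A)"
proof -
  interpret scaling fscale by (rule scaling_fscale)
  show ?thesis
    by unfold_locales
      (simp_all add: linsub_Forms Forms_deRham deRham_add deRham_scale deRham_deRham FormsD)
qed

lemma Coch_zero: "0 \<in> Coch E A S k"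
  by (simp add: Coch_def Forms_zero)

lemma Coch_add: "x \<in> Coch E A S k \<Longrightarrow> y \<in> Coch E A S k \<Longrightarrow> x + y \<in> Coch E A S k"
  by (simp add: Coch_def Forms_add)

lemma Coch_scale: "x \<in> Coch E A S k \<Longrightarrow> alg_scale r x \<in> Coch E A S k"
  by (simp add: Coch_def alg_scale_def Forms_scale)

lemma linsub_Coch: "scaling.linsub alg_scale (Coch E A S k)"
  unfolding scaling.linsub_def[OF scaling_alg_scale] by (simp add: Coch_zero Coch_add Coch_scale)

lemma Coch_singleI:
  assumes "\<And>n. x {} n \<in> Forms E A (k - 2 * int n)" "\<And>n. x {j} n \<in> Forms E A (k - 1 - 2 * int n)"
    "\<And>I n. \<not> I \<subseteq> {j} \<Longrightarrow> x I n = 0"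
  shows "x \<in> Coch E A {j} k"
  unfolding Coch_def
proof (intro CollectI conjI allI impI)
  fix I n
  consider "I = {}" | "I = {j}" | "\<not> I \<subseteq> {j}" by blast
  then show "x I n \<in> Forms E A (k - int (card I) - 2 * int n)"
    using assms Forms_zero by cases auto
qed (rule assms(3))

end

text \<open>The two degrees may differ syntactically, as k + 1 - 1 and k - 1 + 1 do when
  \<open>T_dual\<close> meets the differentials.\<close>

lemma Coch_eqI:
  assumes "x \<in> Coch E A {j} k" "y \<in> Coch E A {j} l" "\<And>n. x {} n = y {} n" "\<And>n. x {j} n = y {j} n"
  shows "x = y"
proof (intro ext)
  fix I n
  consider "I = {}" | "I = {j}" | "\<not> I \<subseteq> {j}" by blast
  then have "x I n = y I n"
    using assms Coch_support[OF assms(1)] Coch_support[OF assms(2)] by cases auto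
  then show "x I n c p vs = y I n c p vs" for c p vs by simp
qed

text \<open>The generator \<open>j\<close> stays open in the lemmas on \<open>Qdiff\<close>, so both
  bundles are instances: one with \<open>j = q\<close>, the dual one with \<open>j = qbar\<close>
  and the curvatures exchanged.\<close>

locale twisted_pair = manifold X E A
  for X :: "'a topology" and E :: "'e::euclidean_space set" and A :: "('a, 'e) chart set" +
  fixes F G H :: "('a, 'e) form"
  assumes F: "F \<in> Forms E A 2" "deRham E A F = 0"
    and G: "G \<in> Forms E A 2" "deRham E A G = 0"
    and H: "H \<in> Forms E A 3" "deRham E A H + wedge F G = 0"
begin

abbreviation P where "P \<equiv> par (Suc 0)"

lemma par_FGH: "P F = F" "P G = G" "P H = fscale (-1) H"
  by (rule par_even_form[OF F(1)] par_even_form[OF G(1)] par_odd_form[OF H(1)], simp)+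

lemma unit_G: "wedge (unit_form A) (P G) = G"
  unfolding par_FGH
proof (rule wedge_unit)
  fix c p and vs :: "'e list"
  assume "\<not> (c \<in> A \<and> p \<in> chart_dom c)"
  then show "G c p vs = 0" by (intro form_support[OF FormsD[OF G(1)]]) blast
qed

lemma deRham_H: "deRham E A H = fscale (-1) (wedge F G)"
  using H(2) by (simp add: fscale_def fun_eq_iff eq_neg_iff_add_eq_0)

text \<open>Rewrite rules towards a normal form with H before F before G. The 2-forms are even and
  commute with everything; the odd form H squares to 0.\<close>

lemma wedge_reorder:
  "wedge F (wedge H \<alpha>) = wedge H (wedge F \<alpha>)"
  "wedge G (wedge H \<alpha>) = wedge H (wedge G \<alpha>)"
  "wedge G (wedge F \<alpha>) = wedge F (wedge G \<alpha>)"
  "wedge H (wedge H \<alpha>) = 0"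
proof -
  have FH: "wedge F H = wedge H F" and GH: "wedge G H = wedge H G" and GF: "wedge G F = wedge F G"
    and HH: "wedge H H = 0"
    by (rule wedge_commute_even[OF par_FGH(1)], rule wedge_commute_even[OF par_FGH(2)],
        rule wedge_commute_even[OF par_FGH(2)], rule wedge_odd_self[OF par_FGH(3)])
  note cong = arg_cong[of _ _ "\<lambda>\<beta>. wedge \<beta> \<alpha>"]
  show "wedge F (wedge H \<alpha>) = wedge H (wedge F \<alpha>)" using cong[OF FH] by (simp only: wedge_assoc)
  show "wedge G (wedge H \<alpha>) = wedge H (wedge G \<alpha>)" using cong[OF GH] by (simp only: wedge_assoc)
  show "wedge G (wedge F \<alpha>) = wedge F (wedge G \<alpha>)" using cong[OF GF] by (simp only: wedge_assoc)
  show "wedge H (wedge H \<alpha>) = 0" using cong[OF HH] by (simp only: wedge_assoc wedge_zero_left)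
qed

lemma par_wedge_FGH:
  "P (wedge F \<alpha>) = wedge F (P \<alpha>)" "P (wedge G \<alpha>) = wedge G (P \<alpha>)"
  "P (wedge H \<alpha>) = fscale (-1) (wedge H (P \<alpha>))"
  by (simp_all only: par_wedge par_FGH wedge_scale_left)

lemma deRham_wedge_FGH:
  assumes "is_form E A \<alpha>"
  shows "deRham E A (wedge F \<alpha>) = wedge F (deRham E A \<alpha>)"
    "deRham E A (wedge G \<alpha>) = wedge G (deRham E A \<alpha>)"
    "deRham E A (wedge H \<alpha>) = fscale (-1) (wedge F (wedge G \<alpha>)) + fscale (-1) (wedge H (deRham E A \<alpha>))"
  by (simp_all add: deRham_wedge FormsD[OF F(1)] FormsD[OF G(1)] FormsD[OF H(1)] assms par_FGH F(2) G(2)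
      deRham_H wedge_scale_left wedge_assoc)

text \<open>Write x as the sum of (a_n + b_n \<theta>) t^n, with \<theta> the generator of index
  \<open>j\<close>. The sign \<open>P\<close> arises when the derivative by \<theta> passes b_n; the
  factor n + 1 and the shifted index come from the derivative by t.\<close>

lemma Qdiff_empty:
  "Qdiff E A j F G H x {} n =
    deRham E A (x {} n) + wedge F (P (x {j} n)) + fscale (real (Suc n)) (wedge H (x {} (Suc n)))"
  by (simp add: Qdiff_def alg_mult_add_left incl_eq odd_gen_eq mono_alg_mono_alg mono_alg_mult
      d_forms_def d_odd_def d_t_def wedge_scale_right)

text \<open>Here \<open>P\<close> has another origin: in the product (\<theta> G) a_{n+1} the
  generator moves to the right past the form a_{n+1}, while G is even and causes no sign.\<close>

lemma Qdiff_single: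
  "Qdiff E A j F G H x {j} n = deRham E A (x {j} n) +
    fscale (real (Suc n)) (wedge H (x {j} (Suc n)) + wedge G (P (x {} (Suc n))))"
  by (simp add: Qdiff_def alg_mult_add_left incl_eq odd_gen_eq mono_alg_mono_alg mono_alg_mult
      d_forms_def d_odd_def d_t_def wedge_scale_right par_scale unit_G fscale_add_right)

lemma Qdiff_other:
  assumes "\<And>I n. \<not> I \<subseteq> {j} \<Longrightarrow> x I n = 0" "\<not> K \<subseteq> {j}"
  shows "Qdiff E A j F G H x K n = 0"
proof -
  have "\<not> K - {j} \<subseteq> {j}" "\<not> insert j K \<subseteq> {j}" using assms(2) by blast+
  then have "x K m = 0" "x (K - {j}) m = 0" "x (insert j K) m = 0" for m
    using assms(1)[of K m] assms(1)[of "K - {j}" m] assms(1)[of "insert j K" m] assms(2) by simp_all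
  then show ?thesis
    by (simp add: Qdiff_def alg_mult_add_left incl_eq odd_gen_eq mono_alg_mono_alg mono_alg_mult
        d_forms_def d_odd_def d_t_def)
qed

lemma Qdiff_in:
  assumes x: "x \<in> Coch E A {j} k"
  shows "Qdiff E A j F G H x \<in> Coch E A {j} (k + 1)"
proof (rule Coch_singleI)
  fix n
  note a = Coch_empty[OF x] and b = Coch_single[OF x, of j]
  show "Qdiff E A j F G H x {} n \<in> Forms E A (k + 1 - 2 * int n)"
    unfolding Qdiff_empty
  proof (intro Forms_add Forms_scale)
    show "deRham E A (x {} n) \<in> Forms E A (k + 1 - 2 * int n)"
      using Forms_deRham[OF a[of n]] by (simp add: algebra_simps)
    show "wedge F (P (x {j} n)) \<in> Forms E A (k + 1 - 2 * int n)"
      using Forms_wedge[OF F(1) Forms_par_1[OF b[of n]]] by (simp add: algebra_simps)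
    show "wedge H (x {} (Suc n)) \<in> Forms E A (k + 1 - 2 * int n)"
      using Forms_wedge[OF H(1) a[of "Suc n"]] by (simp add: algebra_simps)
  qed
  show "Qdiff E A j F G H x {j} n \<in> Forms E A (k + 1 - 1 - 2 * int n)"
    unfolding Qdiff_single
  proof (intro Forms_add Forms_scale)
    show "deRham E A (x {j} n) \<in> Forms E A (k + 1 - 1 - 2 * int n)"
      using Forms_deRham[OF b[of n]] by (simp add: algebra_simps)
    show "wedge H (x {j} (Suc n)) \<in> Forms E A (k + 1 - 1 - 2 * int n)"
      using Forms_wedge[OF H(1) b[of "Suc n"]] by (simp add: algebra_simps)
    show "wedge G (P (x {} (Suc n))) \<in> Forms E A (k + 1 - 1 - 2 * int n)"
      using Forms_wedge[OF G(1) Forms_par_1[OF a[of "Suc n"]]] by (simp add: algebra_simps)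
  qed
next
  fix I n assume "\<not> I \<subseteq> {j}"
  then show "Qdiff E A j F G H x I n = 0"
    using Qdiff_other Coch_support[OF x] by blast
qed

lemma Coch_is_form: "x \<in> Coch E A S k \<Longrightarrow> is_form E A (x I n)"
  using CochD FormsD by blast

lemma Qdiff_add:
  assumes x: "x \<in> Coch E A {j} k" and y: "y \<in> Coch E A {j} k"
  shows "Qdiff E A j F G H (x + y) = Qdiff E A j F G H x + Qdiff E A j F G H y"
  by (rule Coch_eqI[OF Qdiff_in[OF Coch_add[OF x y]] Coch_add[OF Qdiff_in[OF x] Qdiff_in[OF y]]])
    (simp_all add: Qdiff_empty Qdiff_single deRham_add Coch_is_form[OF x] Coch_is_form[OF y]
      wedge_add_right par_add fscale_add_right add_ac)

lemma Qdiff_scale: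
  assumes x: "x \<in> Coch E A {j} k"
  shows "Qdiff E A j F G H (alg_scale r x) = alg_scale r (Qdiff E A j F G H x)"
  by (rule Coch_eqI[OF Qdiff_in[OF Coch_scale[OF x]] Coch_scale[OF Qdiff_in[OF x]]])
    (simp_all add: alg_scale_def Qdiff_empty Qdiff_single deRham_scale Coch_is_form[OF x]
      wedge_scale_right par_scale fscale_add_right mult.commute)

text \<open>Terms with d and a 2-form cancel because d anticommutes with \<open>P\<close>, terms
  with H and a 2-form because \<open>P\<close> reverses H, and terms with d and H by the Leibniz
  rule. What remains is dH against the product of the 2-forms, which is the hypothesis on H.\<close>

lemma Qdiff_Qdiff:
  assumes x: "x \<in> Coch E A {j} k"
  shows "Qdiff E A j F G H (Qdiff E A j F G H x) = 0"
proof (rule Coch_eqI[OF Qdiff_in[OF Qdiff_in[OF x]] Coch_zero])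
  note is_form = Coch_is_form[OF x] FormsD[OF F(1)] FormsD[OF G(1)] FormsD[OF H(1)]
    is_form_add is_form_scale is_form_wedge is_form_par_1 is_form_deRham
  note rules = deRham_add deRham_scale deRham_par_1 deRham_deRham deRham_wedge_FGH par_wedge_FGH
    par_add par_scale wedge_add_right wedge_scale_right wedge_reorder fscale_add_right is_form
  fix n
  show "Qdiff E A j F G H (Qdiff E A j F G H x) {} n = 0 {} n"
    unfolding Qdiff_empty Qdiff_single
    \<comment> \<open>The rules bring all products and differentials to normal form; after that the
      cancellation is linear arithmetic on values.\<close>
    by (simp only: rules par_par fscale_fscale fscale_zero par_zero wedge_zero_right deRham_zero)
      (simp add: fun_eq_iff fscale_def algebra_simps)
  show "Qdiff E A j F G H (Qdiff E A j F G H x) {j} n = 0 {j} n"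
    unfolding Qdiff_empty Qdiff_single
    by (simp only: rules par_par fscale_fscale fscale_zero par_zero wedge_zero_right deRham_zero)
      (simp add: fun_eq_iff fscale_def algebra_simps)
qed

lemma fcomplex_Coch: "fcomplex alg_scale (Coch E A {j}) (Qdiff E A j F G H)"
proof -
  interpret scaling alg_scale by (rule scaling_alg_scale)
  show ?thesis
    by unfold_locales (simp_all add: linsub_Coch Qdiff_in Qdiff_add Qdiff_scale Qdiff_Qdiff)
qed

lemma incl_in: "\<omega> \<in> Forms E A k \<Longrightarrow> incl \<omega> \<in> Coch E A {j} k"
  by (rule Coch_singleI) (auto simp: incl_def Forms_zero)

lemma fcomplex_map_incl:
  "fcomplex_map fscale (Forms E A) (deRham E A) alg_scale (Coch E A {j}) (Qdiff E A j F G H) incl"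
proof -
  interpret src: fcomplex fscale "Forms E A" "deRham E A" by (rule fcomplex_Forms)
  interpret tgt: fcomplex alg_scale "Coch E A {j}" "Qdiff E A j F G H" by (rule fcomplex_Coch)
  show ?thesis
  proof
    fix \<omega> \<eta> :: "('a, 'e) form" and k r
    assume \<omega>: "\<omega> \<in> Forms E A k"
    show "incl \<omega> \<in> Coch E A {j} k" by (rule incl_in[OF \<omega>])
    show "incl (\<omega> + \<eta>) = incl \<omega> + incl \<eta>" by (simp add: incl_def fun_eq_iff)
    show "incl (fscale r \<omega>) = alg_scale r (incl \<omega>)" by (auto simp: incl_def alg_scale_def fun_eq_iff)
    show "incl (deRham E A \<omega>) = Qdiff E A j F G H (incl \<omega>)"
      by (rule Coch_eqI[OF incl_in[OF Forms_deRham[OF \<omega>]] Qdiff_in[OF incl_in[OF \<omega>]]])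
        (simp_all add: Qdiff_empty Qdiff_single, simp_all add: incl_def)
  qed
qed

end

text \<open>The operator qbar q times the derivative by t squares to 0, so its exponential has two
  terms. Integration over q picks b_n from the first and the multiple of a_{n+1} from the
  second.\<close>

lemma T_dual_eq:
  assumes x: "x \<in> Coch E A {q} k"
  shows "T_dual A x = (\<lambda>I n. if I = {} then x {q} n
    else if I = {qbar} then fscale (real (Suc n)) (x {} (Suc n)) else 0)"
proof -
  define D :: "('a, 'b) alg \<Rightarrow> ('a, 'b) alg" where "D = (\<lambda>x. (odd_gen A qbar \<star> odd_gen A q) \<star> d_t x)"
  \<comment> \<open>The number of \<open>qbar\<close> is below that of \<open>q\<close>, so their
    product is already in order and carries no sign.\<close>
  have "{(i, j). i \<in> {qbar} \<and> j \<in> {q} \<and> j < i} = {}" by auto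
  then have "shuffle_sign {qbar} {q} = 1"
    unfolding shuffle_sign_def by (simp only: card.empty power_0)
  moreover have "wedge (unit_form A) (unit_form A) = unit_form A"
    by (rule wedge_unit) (auto simp: unit_form_def)
  ultimately have "odd_gen A qbar \<star> odd_gen A q = mono_alg {qbar, q} (unit_form A)"
    by (simp add: odd_gen_eq mono_alg_mono_alg insert_commute)
  then have D: "D y K n = (if finite K \<and> {qbar, q} \<subseteq> K then
      fscale (shuffle_sign {qbar, q} (K - {qbar, q})) (wedge (unit_form A) (d_t y (K - {qbar, q}) n)) else 0)" for y K n
    by (simp add: D_def mono_alg_mult par_even)
  \<comment> \<open>\<open>D y\<close> lives on index sets containing both generators, whereas a
    second application reads it on sets containing neither.\<close>
  have DD: "D (D y) = 0" for y
  proof (intro ext)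
    fix K n c p vs
    have "d_t (D y) (K - {qbar, q}) n = 0" by (simp add: d_t_def D)
    then show "D (D y) K n c p vs = 0 K n c p vs" unfolding D[of "D y"] by simp
  qed
  have "alg_exp D x = x + D x"
  proof (intro ext)
    fix I n c p vs
    have "(D ^^ j) x I n c p vs / fact j = 0" if "j \<notin> {0, 1}" for j
    proof -
      from that have "j \<noteq> 0" "j \<noteq> 1" by auto
      then have "j = Suc (Suc (j - 2))" by arith
      then obtain i where "j = Suc (Suc i)" ..
      then show ?thesis by (simp add: DD)
    qed
    then have "(\<Sum>j. (D ^^ j) x I n c p vs / fact j) = (\<Sum>j\<in>{0, 1}. (D ^^ j) x I n c p vs / fact j)"
      by (intro suminf_finite) auto
    then show "alg_exp D x I n c p vs = (x + D x) I n c p vs"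
      by (simp add: alg_exp_def)
  qed
  then have T: "T_dual A x I n = (if q \<in> I then 0 else x (insert q I) n + D x (insert q I) n)" for I n
    by (simp add: T_dual_def fiber_int_def D_def)
  show ?thesis
  proof (intro ext)
    fix I n c p vs
    consider "I = {}" | "I = {qbar}" | "q \<in> I" | "q \<notin> I" "\<not> I \<subseteq> {qbar}" by blast
    then have "T_dual A x I n = (if I = {} then x {q} n
        else if I = {qbar} then fscale (real (Suc n)) (x {} (Suc n)) else 0)"
    proof cases
      case 1
      then show ?thesis by (simp add: T D)
    next
      case 2
      have f: "is_form E A (x {} (Suc n))" using CochD[OF x] FormsD by blast
      have "wedge (unit_form A) (d_t x {} n) = d_t x {} n"
      proof (rule wedge_unit)
        fix c p and vs :: "'b list" assume "\<not> (c \<in> A \<and> p \<in> chart_dom c)"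
        then have "x {} (Suc n) c p vs = 0"
          using f unfolding is_form_iff by blast
        then show "d_t x {} n c p vs = 0" by (simp add: d_t_def fscale_def)
      qed
      \<comment> \<open>A cochain without \<open>qbar\<close> contributes nothing here through the
        identity term of the exponential.\<close>
      moreover have "x {q, qbar} n = 0" by (rule Coch_support[OF x]) simp
      ultimately show ?thesis using 2 by (simp add: T D d_t_def)
    next
      case 3
      then show ?thesis by (auto simp: T)
    next
      case 4
      have "\<not> insert q I \<subseteq> {q}" "\<not> insert q I - {qbar, q} \<subseteq> {q}" using 4 by auto
      note Coch_support[OF x this(1)] Coch_support[OF x this(2)]
      then show ?thesis using 4 by (auto simp: T D d_t_def)
    qed
    then show "T_dual A x I n c p vs = (if I = {} then x {q} n
        else if I = {qbar} then fscale (real (Suc n)) (x {} (Suc n)) else 0) c p vs"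
      by simp
  qed
qed

context twisted_pair
begin

text \<open>T-duality exchanges the two curvatures; the condition on H is symmetric in them because
  2-forms commute.\<close>

sublocale bar: twisted_pair X E A G F H
proof
  show "deRham E A H + wedge G F = 0"
    using H(2) wedge_commute_even[OF par_FGH(2), of F] by simp
qed (use F G H in auto)

lemma T_dual_empty: "x \<in> Coch E A {q} k \<Longrightarrow> T_dual A x {} n = x {q} n"
  and T_dual_single: "x \<in> Coch E A {q} k \<Longrightarrow> T_dual A x {qbar} n = fscale (real (Suc n)) (x {} (Suc n))"
  by (simp_all add: T_dual_eq)

lemma T_dual_in:
  assumes x: "x \<in> Coch E A {q} k"
  shows "T_dual A x \<in> Coch E A {qbar} (k - 1)"
proof (rule Coch_singleI)
  fix n
  show "T_dual A x {} n \<in> Forms E A (k - 1 - 2 * int n)"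
    using Coch_single[OF x] by (simp add: T_dual_empty[OF x])
  show "T_dual A x {qbar} n \<in> Forms E A (k - 1 - 1 - 2 * int n)"
    unfolding T_dual_single[OF x] using Forms_scale[OF Coch_empty[OF x, of "Suc n"]]
    by (simp add: algebra_simps)
next
  fix I n assume "\<not> I \<subseteq> {qbar}"
  then show "T_dual A x I n = 0" by (auto simp: T_dual_eq[OF x])
qed

text \<open>The reindexing makes \<open>T_dual\<close> a map that preserves the degree, as
  \<open>fcomplex_map\<close> demands.\<close>

lemma fcomplex_Coch_shift:
  "fcomplex alg_scale (\<lambda>k. Coch E A {qbar} (k - 1)) (Qdiff E A qbar G F H)"
proof -
  interpret bar: fcomplex alg_scale "Coch E A {qbar}" "Qdiff E A qbar G F H"
    by (rule bar.fcomplex_Coch)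
  show ?thesis
  proof
    fix x k assume "x \<in> Coch E A {qbar} (k - 1)"
    from bar.D_in[OF this] show "Qdiff E A qbar G F H x \<in> Coch E A {qbar} (k + 1 - 1)" by simp
  qed (simp_all add: bar.linsub_S bar.D_add bar.D_sc bar.D_D)
qed

text \<open>The two coefficient formulas exchange roles: \<open>Qdiff_single\<close> matches
  \<open>bar.Qdiff_empty\<close>, and \<open>Qdiff_empty\<close> matches
  \<open>bar.Qdiff_single\<close>, with the curvatures exchanged accordingly. In the second case the
  H term carries (n + 1)(n + 2) on both sides.\<close>

lemma T_dual_Qdiff:
  assumes x: "x \<in> Coch E A {q} k"
  shows "T_dual A (Qdiff E A q F G H x) = Qdiff E A qbar G F H (T_dual A x)"
proof (rule Coch_eqI[OF T_dual_in[OF Qdiff_in[OF x]] bar.Qdiff_in[OF T_dual_in[OF x]]])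
  fix n
  show "T_dual A (Qdiff E A q F G H x) {} n = Qdiff E A qbar G F H (T_dual A x) {} n"
    unfolding T_dual_empty[OF Qdiff_in[OF x]] Qdiff_single bar.Qdiff_empty T_dual_empty[OF x] T_dual_single[OF x]
    by (simp add: par_scale wedge_scale_right fscale_add_right add_ac)
  show "T_dual A (Qdiff E A q F G H x) {qbar} n = Qdiff E A qbar G F H (T_dual A x) {qbar} n"
    unfolding T_dual_single[OF Qdiff_in[OF x]] Qdiff_empty bar.Qdiff_single T_dual_empty[OF x] T_dual_single[OF x]
    by (simp add: deRham_scale Coch_is_form[OF x] wedge_scale_right fscale_add_right add_ac)
qed

lemma fcomplex_map_T_dual:
  "fcomplex_map alg_scale (Coch E A {q}) (Qdiff E A q F G H)
     alg_scale (\<lambda>k. Coch E A {qbar} (k - 1)) (Qdiff E A qbar G F H) (T_dual A)"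
proof -
  interpret src: fcomplex alg_scale "Coch E A {q}" "Qdiff E A q F G H" by (rule fcomplex_Coch)
  interpret tgt: fcomplex alg_scale "\<lambda>k. Coch E A {qbar} (k - 1)" "Qdiff E A qbar G F H"
    by (rule fcomplex_Coch_shift)
  show ?thesis
  proof
    fix x k assume x: "x \<in> Coch E A {q} k"
    show "T_dual A x \<in> Coch E A {qbar} (k - 1)" by (rule T_dual_in[OF x])
    show "T_dual A (alg_scale r x) = alg_scale r (T_dual A x)" for r
      by (rule Coch_eqI[OF T_dual_in[OF Coch_scale[OF x]] Coch_scale[OF T_dual_in[OF x]]])
        (simp_all only: T_dual_empty[OF Coch_scale[OF x]] T_dual_single[OF Coch_scale[OF x]],
          simp_all add: alg_scale_def T_dual_empty[OF x] T_dual_single[OF x] mult.commute)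
    show "T_dual A (Qdiff E A q F G H x) = Qdiff E A qbar G F H (T_dual A x)"
      by (rule T_dual_Qdiff[OF x])
    fix y assume y: "y \<in> Coch E A {q} k"
    show "T_dual A (x + y) = T_dual A x + T_dual A y"
      by (rule Coch_eqI[OF T_dual_in[OF Coch_add[OF x y]] Coch_add[OF T_dual_in[OF x] T_dual_in[OF y]]])
        (simp_all add: T_dual_empty[OF x] T_dual_empty[OF y] T_dual_empty[OF Coch_add[OF x y]] T_dual_single[OF x]
          T_dual_single[OF y] T_dual_single[OF Coch_add[OF x y]] fscale_add_right)
  qed
qed

lemma short_exact_T_dual:
  "short_exact fscale (Forms E A) (deRham E A) alg_scale (Coch E A {q}) (Qdiff E A q F G H)
     alg_scale (\<lambda>k. Coch E A {qbar} (k - 1)) (Qdiff E A qbar G F H) incl (T_dual A)"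
proof -
  interpret f: fcomplex_map fscale "Forms E A" "deRham E A" alg_scale "Coch E A {q}" "Qdiff E A q F G H" incl
    by (rule fcomplex_map_incl)
  interpret g: fcomplex_map alg_scale "Coch E A {q}" "Qdiff E A q F G H"
    alg_scale "\<lambda>k. Coch E A {qbar} (k - 1)" "Qdiff E A qbar G F H" "T_dual A"
    by (rule fcomplex_map_T_dual)
  show ?thesis
  proof
    fix k
    show "inj_on incl (Forms E A k)"
    proof (rule inj_onI)
      fix \<omega> \<eta> :: "('a, 'e) form" assume "incl \<omega> = incl \<eta>"
      then have "incl \<omega> {} 0 = incl \<eta> {} 0" by simp
      then show "\<omega> = \<eta>" by (simp add: incl_def)
    qed
    show "incl ` Forms E A k = {y \<in> Coch E A {q} k. T_dual A y = 0}"
    proof (intro Set.set_eqI iffI)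
      fix y assume "y \<in> incl ` Forms E A k"
      then obtain \<omega> where \<omega>: "\<omega> \<in> Forms E A k" "y = incl \<omega>" by blast
      have y: "y \<in> Coch E A {q} k" unfolding \<omega>(2) by (rule incl_in[OF \<omega>(1)])
      have "T_dual A y = 0"
        by (rule Coch_eqI[OF T_dual_in[OF y] Coch_zero])
          (simp_all add: T_dual_empty[OF y] T_dual_single[OF y], simp_all add: \<omega>(2) incl_def)
      with y show "y \<in> {y \<in> Coch E A {q} k. T_dual A y = 0}" by simp
    next
      fix y assume "y \<in> {y \<in> Coch E A {q} k. T_dual A y = 0}"
      then have y: "y \<in> Coch E A {q} k" and 0: "T_dual A y = 0" by auto
      have q: "y {q} n = 0" for n
      proof -
        have "y {q} n = T_dual A y {} n" by (rule T_dual_empty[OF y, symmetric])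
        then show ?thesis by (simp only: 0 zero_fun_apply)
      qed
      have t: "y {} (Suc n) = 0" for n
      proof -
        \<comment> \<open>The kernel condition annihilates only n + 1 times the coefficient, so it
          is divided out.\<close>
        have "fscale (1 / real (Suc n)) (fscale (real (Suc n)) (y {} (Suc n))) = 0"
          using T_dual_single[OF y, of n] 0 by (metis fscale_zero zero_fun_apply)
        then show ?thesis by simp
      qed
      have 1: "y {} 0 \<in> Forms E A k" using Coch_empty[OF y, of 0] by simp
      have "y = incl (y {} 0)"
      proof (rule Coch_eqI[OF y incl_in[OF 1]])
        fix n
        show "y {} n = incl (y {} 0) {} n" by (cases n) (simp_all add: incl_def t)
        show "y {q} n = incl (y {} 0) {q} n" using q by (simp add: incl_def)
      qed
      with 1 show "y \<in> incl ` Forms E A k" by blast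
    qed
    show "T_dual A ` Coch E A {q} k = Coch E A {qbar} (k - 1)"
    proof
      show "T_dual A ` Coch E A {q} k \<subseteq> Coch E A {qbar} (k - 1)"
        using T_dual_in by blast
      show "Coch E A {qbar} (k - 1) \<subseteq> T_dual A ` Coch E A {q} k"
      proof
        fix z assume z: "z \<in> Coch E A {qbar} (k - 1)"
        \<comment> \<open>Solves b_n = z_n and (n + 1) a_{n+1} = z'_n for the two coefficients of
          \<open>z\<close>. The form a_0 is unconstrained and is set to 0.\<close>
        define y where "y = (\<lambda>I n. if I = {} then case n of 0 \<Rightarrow> 0 | Suc m \<Rightarrow> fscale (1 / real (Suc m)) (z {qbar} m)
          else if I = {q} then z {} n else 0)"
        have y: "y \<in> Coch E A {q} k"
        proof (rule Coch_singleI)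
          fix n
          show "y {} n \<in> Forms E A (k - 2 * int n)"
          proof (cases n)
            case (Suc m)
            then show ?thesis
              using Forms_scale[OF Coch_single[OF z, of qbar m], of "1 / real (Suc m)"]
              by (simp add: y_def algebra_simps)
          qed (simp add: y_def Forms_zero)
          show "y {q} n \<in> Forms E A (k - 1 - 2 * int n)"
            using Coch_empty[OF z, of n] by (simp add: y_def)
        qed (auto simp: y_def)
        have "z = T_dual A y"
          by (rule Coch_eqI[OF z T_dual_in[OF y]])
            (simp_all add: T_dual_empty[OF y] T_dual_single[OF y], simp_all add: y_def)
        with y show "z \<in> T_dual A ` Coch E A {q} k" by blast
      qed
    qed
  qed
qed

end

text \<open>Translates results about the reindexed complex into the degree k - 1 cohomology of the
  dual bundle.\<close>

lemma cohomology_shift: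
  "cohomology (shift C) D k = cohomology C D (k - 1)"
  "coh_class (shift C) D k = coh_class C D (k - 1)"
  "coh_map f (shift C) D k = coh_map f C D (k - 1)"
  by (simp_all add: cohomology_def cocycles_def coboundaries_def shift_def coh_class_def[abs_def] coh_map_def[abs_def])

theorem theorem3p3:
  fixes X :: "'a topology" and E :: "'e::euclidean_space set" and A :: "('a, 'e) chart set"
    and F Fbar H :: "('a, 'e) form"
  assumes M: "smooth_manifold X E A"
    and F: "F \<in> carrier (Omega E A 2)" "deRham E A F = 0"
    and Fbar: "Fbar \<in> carrier (Omega E A 2)" "deRham E A Fbar = 0"
    and H: "H \<in> carrier (Omega E A 3)" "deRham E A H + wedge F Fbar = 0"
  shows
    "short_exact_complexes
       (Omega E A) (deRham E A) incl
       (C_P E A) (Q_P E A F Fbar H) (T_dual A)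
       (shift (C_Pbar E A)) (Q_Pbar E A F Fbar H) \<and>
     (\<exists>\<delta>. \<forall>k.
        linear_map (H_M E A k) (H_P E A F Fbar H k) (incl_coh E A F Fbar H k) \<and>
        linear_map (H_P E A F Fbar H k) (H_Pbar E A F Fbar H (k - 1)) (T_coh E A F Fbar H k) \<and>
        is_connecting E A F Fbar H k (\<delta> k) \<and>
        exact_at (H_M E A k) (incl_coh E A F Fbar H k) (H_P E A F Fbar H k)
          (T_coh E A F Fbar H k) (H_Pbar E A F Fbar H (k - 1)) \<and>
        exact_at (H_P E A F Fbar H k) (T_coh E A F Fbar H k) (H_Pbar E A F Fbar H (k - 1))
          (\<delta> k) (H_M E A (k + 1)) \<and>
        exact_at (H_Pbar E A F Fbar H (k - 1)) (\<delta> k) (H_M E A (k + 1))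
          (incl_coh E A F Fbar H (k + 1)) (H_P E A F Fbar H (k + 1))) \<and>
     (\<forall>k \<ge> int (dim E).
        linear_iso (H_P E A F Fbar H (k + 1)) (H_Pbar E A F Fbar H k) (T_coh E A F Fbar H (k + 1)))"
proof -
  interpret twisted_pair X E A F Fbar H
    using assms by unfold_locales (simp_all add: carrier_Omega)
  interpret se: short_exact fscale "Forms E A" "deRham E A" alg_scale "Coch E A {q}" "Qdiff E A q F Fbar H"
    alg_scale "\<lambda>k. Coch E A {qbar} (k - 1)" "Qdiff E A qbar Fbar F H" incl "T_dual A"
    by (rule short_exact_T_dual)
  \<comment> \<open>The complexes on plain sets are literally the given records, so the abstract
    results only need to be rewritten.\<close>
  have C: "se.f.src.C = Omega E A" "se.f.tgt.C = C_P E A" "se.g.tgt.C = shift (C_Pbar E A)"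
    by (simp_all add: fun_eq_iff Omega_eq C_P_def C_Pbar_def Cochains_eq shift_def)
  have Q: "Qdiff E A q F Fbar H = Q_P E A F Fbar H" "Qdiff E A qbar Fbar F H = Q_Pbar E A F Fbar H"
    by (simp_all add: fun_eq_iff Q_P_def Q_Pbar_def)
  note cohs = H_M_def H_P_def H_Pbar_def incl_coh_def T_coh_def cohomology_shift[symmetric]
  have 1: "short_exact_complexes (Omega E A) (deRham E A) incl (C_P E A) (Q_P E A F Fbar H) (T_dual A)
       (shift (C_Pbar E A)) (Q_Pbar E A F Fbar H)"
    using se.short_exact_complexes unfolding C Q .
  have 2: "linear_map (H_M E A k) (H_P E A F Fbar H k) (incl_coh E A F Fbar H k)" for k
    using se.f.linear_map_coh[of k] unfolding C Q cohs .
  have 3: "linear_map (H_P E A F Fbar H k) (H_Pbar E A F Fbar H (k - 1)) (T_coh E A F Fbar H k)" for k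
    using se.g.linear_map_coh[of k] unfolding C Q cohs .
  have 4: "is_connecting E A F Fbar H k (se.connecting k)" for k
    unfolding is_connecting_def
  proof (intro conjI ballI impI)
    show "linear_map (H_Pbar E A F Fbar H (k - 1)) (H_M E A (k + 1)) (se.connecting k)"
      using se.linear_map_connecting[of k] unfolding C Q cohs .
    fix x \<omega> assume "x \<in> carrier (C_P E A k)" "\<omega> \<in> carrier (Omega E A (k + 1))" "Q_P E A F Fbar H x = incl \<omega>"
    then have "se.connecting k (se.g.tgt.cl k (T_dual A x)) = se.f.src.cl (k + 1) \<omega>"
      by (intro se.connecting_cl) (simp_all add: C_P_def Cochains_eq carrier_Omega Q_P_def)
    then have "se.connecting k (coh_class se.g.tgt.C (Qdiff E A qbar Fbar F H) k (T_dual A x)) =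
        coh_class se.f.src.C (deRham E A) (k + 1) \<omega>"
      unfolding se.g.tgt.coh_class_eq se.f.src.coh_class_eq .
    then show "se.connecting k (coh_class (C_Pbar E A) (Q_Pbar E A F Fbar H) (k - 1) (T_dual A x)) =
        coh_class (Omega E A) (deRham E A) (k + 1) \<omega>"
      unfolding C Q cohomology_shift .
  qed
  have 5: "exact_at (H_M E A k) (incl_coh E A F Fbar H k) (H_P E A F Fbar H k)
      (T_coh E A F Fbar H k) (H_Pbar E A F Fbar H (k - 1))" for k
    using se.exact_middle[of k] unfolding C Q cohs .
  have 6: "exact_at (H_P E A F Fbar H k) (T_coh E A F Fbar H k) (H_Pbar E A F Fbar H (k - 1))
      (se.connecting k) (H_M E A (k + 1))" for k
    using se.exact_right[of k] unfolding C Q cohs .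
  have 7: "exact_at (H_Pbar E A F Fbar H (k - 1)) (se.connecting k) (H_M E A (k + 1))
      (incl_coh E A F Fbar H (k + 1)) (H_P E A F Fbar H (k + 1))" for k
    using se.exact_left[of k] unfolding C Q cohs .
  have 8: "linear_iso (H_P E A F Fbar H (k + 1)) (H_Pbar E A F Fbar H k) (T_coh E A F Fbar H (k + 1))"
    if "int (dim E) \<le> k" for k
  proof -
    have "Forms E A l = {0}" if "int (dim E) < l" for l
      using Forms_above_dim[OF _ that] Forms_zero by blast
    \<comment> \<open>Both degrees k + 1 and k + 2 must exceed the dimension: the map starts in
      degree k + 1, and its connecting map ends in degree k + 2.\<close>
    with that have "Forms E A (k + 1) = {0}" "Forms E A (k + 1 + 1) = {0}" by simp_all
    from se.linear_iso_coh[OF this] show ?thesis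
      unfolding C Q cohomology_shift H_P_def H_Pbar_def T_coh_def by simp
  qed
  show ?thesis
    using 1 2 3 4 5 6 7 8 by blast
qed

end
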